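(* Let $N\ge4$ be fixed, $n_1+n_2=N$, and for each $p$ let $\bm X_1,\ldots,\bm X_{n_1}$ be i.i.d. $N_p(\bm\mu_1,\Sigma)$ and $\bm Y_1,\ldots,\bm Y_{n_2}$ be i.i.d. $N_p(\bm\mu_2,\Sigma)$ (the two samples independent), with $\bm X_i=(X_{i1},\ldots,X_{ip})^T$, $\bm Y_k=(Y_{k1},\ldots,Y_{kp})^T$. Let $\bar X_j=\frac1{n_1}\sum_i X_{ij}$, $\bar Y_j=\frac1{n_2}\sum_k Y_{kj}$, $s_{j,\mathrm{pool}}^2=\frac{1}{N-2}\{\sum_i(X_{ij}-\bar X_j)^2+\sum_k(Y_{kj}-\bar Y_j)^2\}$, $t_{Nj}=\sqrt{n_1n_2/N}(\bar X_j-\bar Y_j)/s_{j,\mathrm{pool}}$, $\nu_2=N-2$, $V_{Nj}=N\log(1+t_{Nj}^2/\nu_2)$ and $T_2=\sum_{j=1}^pV_{Nj}$. Let $\Psi=\Gamma'/\Gamma$, $D(x)=\Psi\{(x+1)/2\}-\Psi(x/2)$, $G_1=ND(\nu_2)$, $G_2=N^2\{D^2(\nu_2)-2D'(\nu_2)\}$. Assume $\{V_{Nj}\}_{j\ge1}$ is stationary and satisfies: (C1) with $\alpha(\mathcal F,\mathcal G)=\sup\{|P(A\cap B)-P(A)P(B)|: A\in\mathcal F, B\in\mathcal G\}$, $\mathcal F_a^b=\sigma\{V_{Nj}: a\le j\le b\}$, $\alpha(r)=\sup\{\alpha(\mathcal F_1^k,\mathcal F_{k+r}^p):1\le k\le p-r\}$,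 one has $\alpha(r)\downarrow0$ as $r\to\infty$; (C2) $\sum_{r=1}^\infty\alpha(r)^{\delta/(2+\delta)}<\infty$ for some $\delta>0$, and for every $k\ge0$ the limit $\gamma(k)=\lim_{p\to\infty}\frac1{p-k}\sum_{j=1}^{p-k}\mathrm{Cov}(V_{Nj},V_{N,j+k})$ exists. Then under $H_0:\bm\mu_1=\bm\mu_2$, $$\frac{T_2-pG_1}{\tau_2\sqrt p}\xrightarrow{\mathcal D}N(0,1)\quad\text{as }p\to\infty,$$ where $\tau_2^2=G_2-G_1^2+2\sum_{k=1}^\infty\gamma(k)$.
   Context: $\Gamma$ is the gamma function; $\Sigma$ is the common (not necessarily diagonal) covariance matrix; $\xrightarrow{\mathcal D}$ is convergence in distribution. *)

theory Defs
  imports "HOL-Probability.Probability"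
begin

definition normal_measure :: "real \<Rightarrow> real \<Rightarrow> real measure" where
  "normal_measure m v =
     (if v > 0 then density lborel (normal_density m (sqrt v)) else return borel m)"

text \<open>A real-valued process Z indexed by coordinates j :: nat is Gaussian with mean
  function mu and covariance Sig iff every finite linear combination of coordinates is
  normally distributed with the corresponding mean and variance.  Restricted to the first
  p coordinates this says exactly that (Z 1, ..., Z p) is N_p(mu, Sig).\<close>

definition gaussian_process ::
  "'a measure \<Rightarrow> (nat \<Rightarrow> 'a \<Rightarrow> real) \<Rightarrow> (nat \<Rightarrow> real) \<Rightarrow> (nat \<Rightarrow> nat \<Rightarrow> real) \<Rightarrow> bool" where
  "gaussian_process M Z mu Sig \<longleftrightarrow>
     (\<forall>j. Z j \<in> borel_measurable M) \<and>
     (\<forall>J c. finite J \<longrightarrow>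
        distr M borel (\<lambda>\<omega>. \<Sum>j\<in>J. c j * Z j \<omega>) =
        normal_measure (\<Sum>j\<in>J. c j * mu j) (\<Sum>j\<in>J. \<Sum>k\<in>J. c j * c k * Sig j k))"

definition xbar :: "nat \<Rightarrow> (nat \<Rightarrow> nat \<Rightarrow> 'a \<Rightarrow> real) \<Rightarrow> nat \<Rightarrow> 'a \<Rightarrow> real" where
  "xbar n X j \<omega> = (\<Sum>i=1..n. X i j \<omega>) / real n"

definition s2pool ::
  "nat \<Rightarrow> nat \<Rightarrow> (nat \<Rightarrow> nat \<Rightarrow> 'a \<Rightarrow> real) \<Rightarrow> (nat \<Rightarrow> nat \<Rightarrow> 'a \<Rightarrow> real) \<Rightarrow> nat \<Rightarrow> 'a \<Rightarrow> real" where
  "s2pool n1 n2 X Y j \<omega> =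
     ((\<Sum>i=1..n1. (X i j \<omega> - xbar n1 X j \<omega>)\<^sup>2) + (\<Sum>k=1..n2. (Y k j \<omega> - xbar n2 Y j \<omega>)\<^sup>2))
     / (real (n1 + n2) - 2)"

definition tstat ::
  "nat \<Rightarrow> nat \<Rightarrow> (nat \<Rightarrow> nat \<Rightarrow> 'a \<Rightarrow> real) \<Rightarrow> (nat \<Rightarrow> nat \<Rightarrow> 'a \<Rightarrow> real) \<Rightarrow> nat \<Rightarrow> 'a \<Rightarrow> real" where
  "tstat n1 n2 X Y j \<omega> =
     sqrt (real n1 * real n2 / real (n1 + n2)) * (xbar n1 X j \<omega> - xbar n2 Y j \<omega>)
     / sqrt (s2pool n1 n2 X Y j \<omega>)"

definition Vstat ::
  "nat \<Rightarrow> nat \<Rightarrow> (nat \<Rightarrow> nat \<Rightarrow> 'a \<Rightarrow> real) \<Rightarrow> (nat \<Rightarrow> nat \<Rightarrow> 'a \<Rightarrow> real) \<Rightarrow> nat \<Rightarrow> 'a \<Rightarrow> real" where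
  "Vstat n1 n2 X Y j \<omega> =
     real (n1 + n2) * ln (1 + (tstat n1 n2 X Y j \<omega>)\<^sup>2 / (real (n1 + n2) - 2))"

definition T2stat ::
  "nat \<Rightarrow> nat \<Rightarrow> (nat \<Rightarrow> nat \<Rightarrow> 'a \<Rightarrow> real) \<Rightarrow> (nat \<Rightarrow> nat \<Rightarrow> 'a \<Rightarrow> real) \<Rightarrow> nat \<Rightarrow> 'a \<Rightarrow> real" where
  "T2stat n1 n2 X Y p \<omega> = (\<Sum>j=1..p. Vstat n1 n2 X Y j \<omega>)"

definition Dfun :: "real \<Rightarrow> real" where
  "Dfun x = Digamma ((x + 1) / 2) - Digamma (x / 2)"

definition G1 :: "nat \<Rightarrow> real" where
  "G1 N = real N * Dfun (real N - 2)"

definition G2 :: "nat \<Rightarrow> real" where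
  "G2 N = (real N)\<^sup>2 * ((Dfun (real N - 2))\<^sup>2 - 2 * deriv Dfun (real N - 2))"

definition stationary_seq :: "'a measure \<Rightarrow> (nat \<Rightarrow> 'a \<Rightarrow> real) \<Rightarrow> bool" where
  "stationary_seq M V \<longleftrightarrow>
     (\<forall>h. distr M (Pi\<^sub>M UNIV (\<lambda>_. borel)) (\<lambda>\<omega> j. V (j + 1 + h) \<omega>) =
          distr M (Pi\<^sub>M UNIV (\<lambda>_. borel)) (\<lambda>\<omega> j. V (j + 1) \<omega>))"

definition cov :: "'a measure \<Rightarrow> ('a \<Rightarrow> real) \<Rightarrow> ('a \<Rightarrow> real) \<Rightarrow> real" where
  "cov M U W = integral\<^sup>L M (\<lambda>\<omega>. (U \<omega> - integral\<^sup>L M U) * (W \<omega> - integral\<^sup>L M W))"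

definition sigma_gen :: "'a measure \<Rightarrow> (nat \<Rightarrow> 'a \<Rightarrow> real) \<Rightarrow> nat set \<Rightarrow> 'a set set" where
  "sigma_gen M V J = sigma_sets (space M) (\<Union>j\<in>J. {V j -` B \<inter> space M | B. B \<in> sets borel})"

definition alpha_dep :: "'a measure \<Rightarrow> 'a set set \<Rightarrow> 'a set set \<Rightarrow> real" where
  "alpha_dep M F G = (SUP AB\<in>F \<times> G. \<bar>measure M (fst AB \<inter> snd AB) - measure M (fst AB) * measure M (snd AB)\<bar>)"

text \<open>Strong mixing coefficient alpha(r) of the infinite sequence (V j)_{j>=1}:
  sup over k >= 1 of alpha(F_1^k, F_{k+r}^infinity); this is the supremum over p of the
  paper's p-dependent coefficient.\<close>
definition alpha_mix :: "'a measure \<Rightarrow> (nat \<Rightarrow> 'a \<Rightarrow> real) \<Rightarrow> nat \<Rightarrow> real" where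
  "alpha_mix M V r = (SUP k\<in>{1..}. alpha_dep M (sigma_gen M V {1..k}) (sigma_gen M V {k + r..}))"

end

theory Submission
  imports Defs "HOL-Real_Asymp.Real_Asymp"
begin

text \<open>
  Law of one coordinate. A Helmert transformation, carried out one plane rotation at a time, turns
  the pooled sample into an independent pair (S, W) of a chi-square variable with N - 2 degrees of
  freedom and a standard normal variable, with t^2 / (N - 2) = W^2 / S. Hence W / sqrt S has density
  proportional to (1 + v^2) powr - (N - 1) / 2, and the moment generating function of
  ln (1 + W^2 / S) is a quotient of Gamma functions, whose first two derivatives at 0 are the
  digamma expressions in G1 and G2.

  Central limit theorem. Put f j = E exp (i t S_j / sqrt n) for the partial sums S_j of the centered
  stationary sequence X. Expanding exp (i t X_j / sqrt n) to second order leaves E (exp (i t S_(j-1) / sqrt n) X_j),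
  which is telescoped over the past of j down to time 0. The lag l term is close to
  (i t / sqrt n) Cov (X_(j-l), X_j) f (j-1) and, by Davydov's covariance inequality, at most a constant
  times alpha(l) powr (\<delta> / (2 + \<delta>)) / sqrt n. The summability of these rates yields
  f j = (1 - \<tau>^2 t^2 / (2 n)) f (j-1) up to an error of smaller order than 1 / n, so f n tends to
  exp (- \<tau>^2 t^2 / 2), and Levy's continuity theorem applies. No blocking or truncation of the
  sequence is needed.
\<close>

section \<open>Covariance inequalities under strong mixing\<close>

text \<open>Each lag must keep its own factor \<theta> = t / sqrt n. Telescoping over L lags only
  would leave a covariance of size a(L) without that factor; multiplied by \<theta> and summed over
  n steps it could contribute sqrt n * a(L), and L would have to grow with n. Down to time 0 every
  term is an increment of size \<theta> |X|, so discarded lags cost \<theta>^2 times the tail of a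
  convergent series, and L and the gap r are fixed before n tends to infinity.

  Davydov's inequality is applied to the products X_i * X_(i+l) as well. They need a moment of order
  q, hence X one of order 2 q, where q = 2 + \<delta> turns 1 - 2 / q into \<delta> / (2 +
  \<delta>). All these moments come from the moment generating function of ln (1 + W^2 / S), which
  is finite to the right of 0.

  The \<gamma>(k) are given as limits of averaged covariances; stationarity makes the averages
  constant, so that \<gamma>(k) is the covariance at lag k and \<gamma>(0) = G2 - G1^2. The constant
  in the density of W / sqrt S, a multiple of E sqrt S, is never evaluated: total mass one
  determines it.\<close>

context prob_space
begin

text \<open>The average of the n indicators of the level sets n U >= k, for k = 1, ..., n, is floor
  (n U) / n, which is within 1 / n of \<open>U\<close>. An average of indicators of sets of
  \<open>F\<close> inherits the bound \<open>c\<close> without loss; then n tends to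
  infinity.\<close>

lemma abs_expectation_mult_le_unit_interval:
  fixes U W :: "'a \<Rightarrow> real"
  assumes F: "subalgebra M F"
    and W: "integrable M W"
    and c: "\<And>A. A \<in> sets F \<Longrightarrow> \<bar>\<integral>\<omega>. indicator A \<omega> * W \<omega> \<partial>M\<bar> \<le> c"
    and U: "U \<in> borel_measurable F" "\<And>\<omega>. 0 \<le> U \<omega>" "\<And>\<omega>. U \<omega> \<le> 1"
  shows "\<bar>\<integral>\<omega>. U \<omega> * W \<omega> \<partial>M\<bar> \<le> c"
proof -
  have UM: "U \<in> borel_measurable M"
    by (rule measurable_from_subalg[OF F U(1)])
  have intUW: "integrable M (\<lambda>\<omega>. U \<omega> * W \<omega>)"
    by (rule Bochner_Integration.integrable_bound[OF W])
       (use UM W U in \<open>auto simp: abs_mult mult_left_le_one_le intro!: AE_I2\<close>)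
  have main: "\<bar>\<integral>\<omega>. U \<omega> * W \<omega> \<partial>M\<bar> \<le> c + (\<integral>\<omega>. \<bar>W \<omega>\<bar> \<partial>M) / real n" if n: "n > 0" for n :: nat
  proof -
    define A where "A k = {\<omega> \<in> space M. real k \<le> real n * U \<omega>}" for k :: nat
    have A: "A k \<in> sets F" for k
    proof -
      have "{\<omega> \<in> space F. real k \<le> real n * U \<omega>} \<in> sets F" using U(1) by measurable
      then show ?thesis using F by (simp add: A_def subalgebra_def)
    qed
    have AM: "A k \<in> sets M" for k using A F by (auto simp: subalgebra_def)
    define Uf where "Uf \<omega> = (\<Sum>k=1..n. indicator (A k) \<omega>) / real n" for \<omega>
    have Uf_floor: "Uf \<omega> = real (nat \<lfloor>real n * U \<omega>\<rfloor>) / real n" if "\<omega> \<in> space M" for \<omega>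
    proof -
      have le: "nat \<lfloor>real n * U \<omega>\<rfloor> \<le> n"
      proof -
        have "real n * U \<omega> \<le> real n" using U(3)[of \<omega>] by (simp add: mult_left_le)
        then show ?thesis by linarith
      qed
      have eq: "{k \<in> {1..n}. real k \<le> real n * U \<omega>} = {1..nat \<lfloor>real n * U \<omega>\<rfloor>}"
        using le U(2)[of \<omega>] by (auto simp: le_nat_floor le_floor_iff nat_le_iff) linarith+
      have "(\<Sum>k=1..n. indicator (A k) \<omega> :: real) = (\<Sum>k=1..n. if real k \<le> real n * U \<omega> then 1 else 0)"
        using that by (intro sum.cong) (auto simp: A_def indicator_def)
      also have "\<dots> = real (card {k \<in> {1..n}. real k \<le> real n * U \<omega>})"
        by (simp add: sum.If_cases Int_def)
      finally have "(\<Sum>k=1..n. indicator (A k) \<omega> :: real) = real (nat \<lfloor>real n * U \<omega>\<rfloor>)"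
        unfolding eq by simp
      then show ?thesis unfolding Uf_def by simp
    qed
    have diff: "\<bar>U \<omega> - Uf \<omega>\<bar> \<le> 1 / real n" if "\<omega> \<in> space M" for \<omega>
    proof -
      have "0 \<le> real n * U \<omega>" using U(2) by simp
      then have "\<bar>real n * U \<omega> - real (nat \<lfloor>real n * U \<omega>\<rfloor>)\<bar> \<le> 1" by linarith
      then have "\<bar>(real n * U \<omega> - real (nat \<lfloor>real n * U \<omega>\<rfloor>)) / real n\<bar> \<le> 1 / real n"
        using n by (simp add: abs_divide divide_right_mono)
      then show ?thesis using n by (simp add: Uf_floor[OF that] diff_divide_distrib)
    qed
    have intA: "integrable M (\<lambda>\<omega>. indicator (A k) \<omega> * W \<omega>)" for k
      using integrable_mult_indicator[OF AM W] by simp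
    have Uf_eq: "Uf \<omega> * W \<omega> = (\<Sum>k=1..n. indicator (A k) \<omega> * W \<omega>) / real n" for \<omega>
      by (simp add: Uf_def sum_distrib_right)
    have intUf: "integrable M (\<lambda>\<omega>. Uf \<omega> * W \<omega>)"
      unfolding Uf_eq by (intro integrable_divide Bochner_Integration.integrable_sum intA)
    have "\<bar>\<integral>\<omega>. Uf \<omega> * W \<omega> \<partial>M\<bar> = \<bar>\<Sum>k=1..n. \<integral>\<omega>. indicator (A k) \<omega> * W \<omega> \<partial>M\<bar> / real n"
      unfolding Uf_eq integral_divide_zero Bochner_Integration.integral_sum[OF intA] by simp
    also have "\<dots> \<le> (\<Sum>k=1..n. \<bar>\<integral>\<omega>. indicator (A k) \<omega> * W \<omega> \<partial>M\<bar>) / real n"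
      by (intro divide_right_mono sum_abs) simp
    also have "\<dots> \<le> (\<Sum>k=1..n. c) / real n"
      by (intro divide_right_mono sum_mono c A) simp
    also have "\<dots> = c" using n by simp
    finally have 1: "\<bar>\<integral>\<omega>. Uf \<omega> * W \<omega> \<partial>M\<bar> \<le> c" .
    have "\<bar>(\<integral>\<omega>. U \<omega> * W \<omega> \<partial>M) - (\<integral>\<omega>. Uf \<omega> * W \<omega> \<partial>M)\<bar> = \<bar>\<integral>\<omega>. U \<omega> * W \<omega> - Uf \<omega> * W \<omega> \<partial>M\<bar>"
      using intUW intUf by simp
    also have "\<dots> \<le> (\<integral>\<omega>. \<bar>U \<omega> * W \<omega> - Uf \<omega> * W \<omega>\<bar> \<partial>M)"
      by (rule integral_abs_bound)
    also have "\<dots> \<le> (\<integral>\<omega>. \<bar>W \<omega>\<bar> / real n \<partial>M)"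
    proof (rule integral_mono)
      show "integrable M (\<lambda>\<omega>. \<bar>U \<omega> * W \<omega> - Uf \<omega> * W \<omega>\<bar>)" using intUW intUf by simp
      show "integrable M (\<lambda>\<omega>. \<bar>W \<omega>\<bar> / real n)" using W by simp
      fix \<omega> assume "\<omega> \<in> space M"
      have "\<bar>U \<omega> * W \<omega> - Uf \<omega> * W \<omega>\<bar> = \<bar>U \<omega> - Uf \<omega>\<bar> * \<bar>W \<omega>\<bar>"
        by (metis abs_mult left_diff_distrib)
      also have "\<dots> \<le> 1 / real n * \<bar>W \<omega>\<bar>"
        by (intro mult_right_mono diff \<open>\<omega> \<in> space M\<close>) simp
      finally show "\<bar>U \<omega> * W \<omega> - Uf \<omega> * W \<omega>\<bar> \<le> \<bar>W \<omega>\<bar> / real n" by simp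
    qed
    also have "\<dots> = (\<integral>\<omega>. \<bar>W \<omega>\<bar> \<partial>M) / real n" by simp
    finally show ?thesis using 1 by linarith
  qed
  have "(\<lambda>n. c + (\<integral>\<omega>. \<bar>W \<omega>\<bar> \<partial>M) / real n) \<longlonglongrightarrow> c + 0"
    by (intro tendsto_intros lim_const_over_n)
  then show ?thesis
    by (intro LIMSEQ_le_const) (auto intro!: exI[of _ 1] main)
qed

text \<open>The positive and the negative part of \<open>U\<close>, divided by \<open>a\<close>,
  take values in [0, 1]. Each contributes \<open>c\<close>, whence the factor 2.\<close>

lemma abs_expectation_mult_le:
  fixes U W :: "'a \<Rightarrow> real"
  assumes F: "subalgebra M F"
    and W: "integrable M W"
    and c: "\<And>A. A \<in> sets F \<Longrightarrow> \<bar>\<integral>\<omega>. indicator A \<omega> * W \<omega> \<partial>M\<bar> \<le> c"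
    and U: "U \<in> borel_measurable F" "\<And>\<omega>. \<bar>U \<omega>\<bar> \<le> a" and a: "a > 0"
  shows "\<bar>\<integral>\<omega>. U \<omega> * W \<omega> \<partial>M\<bar> \<le> 2 * a * c"
proof -
  define P where "P \<omega> = max 0 (U \<omega> / a)" for \<omega>
  define Q where "Q \<omega> = max 0 (- U \<omega> / a)" for \<omega>
  have [measurable]: "P \<in> borel_measurable F" "Q \<in> borel_measurable F"
    unfolding P_def Q_def using U(1) by measurable
  have PM: "P \<in> borel_measurable M" "Q \<in> borel_measurable M"
    by (rule measurable_from_subalg[OF F], measurable)+
  have b: "U \<omega> \<le> a" "- U \<omega> \<le> a" for \<omega> using U(2)[of \<omega>] by auto
  have P01: "0 \<le> P \<omega>" "P \<omega> \<le> 1" "0 \<le> Q \<omega>" "Q \<omega> \<le> 1" for \<omega>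
    using b[of \<omega>] a by (auto simp: P_def Q_def divide_simps)
  have int: "integrable M (\<lambda>\<omega>. P \<omega> * W \<omega>)" "integrable M (\<lambda>\<omega>. Q \<omega> * W \<omega>)"
    by (rule Bochner_Integration.integrable_bound[OF W];
        use PM W P01 in \<open>auto simp: abs_mult mult_left_le_one_le intro!: AE_I2\<close>)+
  have "U \<omega> * W \<omega> = a * (P \<omega> * W \<omega> - Q \<omega> * W \<omega>)" for \<omega>
    using a by (auto simp: P_def Q_def max_def field_simps)
  then have "(\<integral>\<omega>. U \<omega> * W \<omega> \<partial>M) = a * ((\<integral>\<omega>. P \<omega> * W \<omega> \<partial>M) - (\<integral>\<omega>. Q \<omega> * W \<omega> \<partial>M))"
    using int by simp
  moreover have "\<bar>\<integral>\<omega>. P \<omega> * W \<omega> \<partial>M\<bar> \<le> c" "\<bar>\<integral>\<omega>. Q \<omega> * W \<omega> \<partial>M\<bar> \<le> c"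
    by (rule abs_expectation_mult_le_unit_interval[OF F W c]; simp add: P01)+
  ultimately have "\<bar>\<integral>\<omega>. U \<omega> * W \<omega> \<partial>M\<bar> \<le> a * (c + c)"
    using a by (simp add: abs_mult)
  then show ?thesis by (simp add: algebra_simps)
qed

text \<open>The mixing bound concerns pairs of sets. Indicators are replaced by bounded functions in
  one factor at a time, first by \<open>W\<close> for a fixed set of \<open>F\<close>, then by
  \<open>U\<close>; each pass costs twice the bound of the function, which gives the 4.\<close>

lemma mixing_covariance_bounded:
  fixes U W :: "'a \<Rightarrow> real"
  assumes F: "subalgebra M F"
    and G: "subalgebra M G"
    and \<alpha>: "\<And>A B. A \<in> sets F \<Longrightarrow> B \<in> sets G \<Longrightarrow> \<bar>prob (A \<inter> B) - prob A * prob B\<bar> \<le> \<alpha>"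
    and U: "U \<in> borel_measurable F" "\<And>\<omega>. \<bar>U \<omega>\<bar> \<le> a" and a: "a > 0"
    and W: "W \<in> borel_measurable G" "\<And>\<omega>. \<bar>W \<omega>\<bar> \<le> b" and b: "b > 0"
  shows "\<bar>expectation (\<lambda>\<omega>. U \<omega> * W \<omega>) - expectation U * expectation W\<bar> \<le> 4 * a * b * \<alpha>"
proof -
  have UM: "U \<in> borel_measurable M" by (rule measurable_from_subalg[OF F U(1)])
  have WM: "W \<in> borel_measurable M" by (rule measurable_from_subalg[OF G W(1)])
  have intU: "integrable M U" by (rule integrable_const_bound[of _ a]) (use U UM in auto)
  have intW: "integrable M W" by (rule integrable_const_bound[of _ b]) (use W WM in auto)
  have intUW: "integrable M (\<lambda>\<omega>. U \<omega> * W \<omega>)"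
    by (rule integrable_const_bound[of _ "a * b"])
       (use U W UM WM a in \<open>auto simp: abs_mult intro!: mult_mono\<close>)
  have 1: "\<bar>\<integral>\<omega>. indicator A \<omega> * (W \<omega> - expectation W) \<partial>M\<bar> \<le> 2 * b * \<alpha>" if A: "A \<in> sets F" for A
  proof -
    have AM: "A \<in> sets M" using A F by (auto simp: subalgebra_def)
    have intA: "integrable M (indicator A :: 'a \<Rightarrow> real)"
      using AM by (simp add: emeasure_eq_measure)
    have intAW: "integrable M (\<lambda>\<omega>. indicator A \<omega> * W \<omega>)"
      using integrable_mult_indicator[OF AM intW] by simp
    \<comment> \<open>Here \<open>W\<close> is the test function and the centered indicator of
      \<open>A\<close> the integrand: its integral over a set \<open>B\<close> is exactly the
      difference that mixing bounds.\<close>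
    have "\<bar>\<integral>\<omega>. W \<omega> * (indicator A \<omega> - prob A) \<partial>M\<bar> \<le> 2 * b * \<alpha>"
    proof (rule abs_expectation_mult_le[OF G _ _ W b])
      show "integrable M (\<lambda>\<omega>. indicator A \<omega> - prob A)" using intA by simp
      fix B assume B: "B \<in> sets G"
      have BM: "B \<in> sets M" using B G by (auto simp: subalgebra_def)
      have "(\<lambda>\<omega>. indicator B \<omega> * (indicator A \<omega> - prob A))
          = (\<lambda>\<omega>. indicator (A \<inter> B) \<omega> - prob A * indicator B \<omega> :: real)"
        by (auto simp: indicator_def)
      then have "(\<integral>\<omega>. indicator B \<omega> * (indicator A \<omega> - prob A) \<partial>M) = prob (A \<inter> B) - prob A * prob B"
        using AM BM by (simp add: emeasure_eq_measure)
      then show "\<bar>\<integral>\<omega>. indicator B \<omega> * (indicator A \<omega> - prob A) \<partial>M\<bar> \<le> \<alpha>"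
        using \<alpha>[OF A B] by simp
    qed
    also have "(\<integral>\<omega>. W \<omega> * (indicator A \<omega> - prob A) \<partial>M) = (\<integral>\<omega>. indicator A \<omega> * W \<omega> \<partial>M) - expectation W * prob A"
      using intAW intW by (simp add: right_diff_distrib mult.commute)
    also have "\<dots> = (\<integral>\<omega>. indicator A \<omega> * (W \<omega> - expectation W) \<partial>M)"
      using intAW intA AM by (simp add: right_diff_distrib)
    finally show ?thesis .
  qed
  have "\<bar>\<integral>\<omega>. U \<omega> * (W \<omega> - expectation W) \<partial>M\<bar> \<le> 2 * a * (2 * b * \<alpha>)"
    by (rule abs_expectation_mult_le[OF F _ 1 U a]) (use intW in simp_all)
  moreover have "(\<integral>\<omega>. U \<omega> * (W \<omega> - expectation W) \<partial>M) = expectation (\<lambda>\<omega>. U \<omega> * W \<omega>) - expectation U * expectation W"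
    using intU intUW by (simp add: right_diff_distrib)
  ultimately show ?thesis by (simp add: algebra_simps)
qed

end

section \<open>Truncation and Davydov's covariance inequality\<close>

lemma powr_le_one_plus_powr:
  fixes x :: real
  assumes "0 \<le> x" "0 < p" "p \<le> q"
  shows "x powr p \<le> 1 + x powr q"
proof (cases "x \<le> 1")
  case True
  then have "x powr p \<le> 1" using assms by (intro powr_le1) auto
  then show ?thesis by (simp add: add_increasing2)
next
  case False
  then have "x powr p \<le> x powr q" using assms by (intro powr_mono) auto
  then show ?thesis by simp
qed

lemma abs_power_le_one_plus_powr:
  fixes x :: real
  assumes "0 < n" "real n \<le> q"
  shows "\<bar>x\<bar> ^ n \<le> 1 + \<bar>x\<bar> powr q"
  using powr_le_one_plus_powr[of "\<bar>x\<bar>" "real n" q] assms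
  by (cases "x = 0") (auto simp: powr_realpow power_0_left)

definition clip :: "real \<Rightarrow> real \<Rightarrow> real" where
  "clip T x = max (- T) (min T x)"

lemma measurable_clip [measurable]: "clip T \<in> borel_measurable borel"
  unfolding clip_def by measurable

lemma abs_clip_le: "T \<ge> 0 \<Longrightarrow> \<bar>clip T x\<bar> \<le> T"
  by (auto simp: clip_def)

lemma abs_clip_le_abs: "T \<ge> 0 \<Longrightarrow> \<bar>clip T x\<bar> \<le> \<bar>x\<bar>"
  by (auto simp: clip_def)

text \<open>Clipping multiplies by a factor in [0, 1], so the error is at most |u w| <= m^2, where m
  is the larger of |u| and |w|. It vanishes unless m > T, and then m^2 = m^q * m^(2 - q) <= m^q *
  T^(2 - q) because 2 - q < 0.\<close>

lemma clip_mult_error: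
  fixes u w :: real
  assumes T: "T \<ge> 1" and q: "q > 2"
  shows "\<bar>u * w - clip T u * clip T w\<bar> \<le> (\<bar>u\<bar> powr q + \<bar>w\<bar> powr q) * T powr (2 - q)"
proof (cases "\<bar>u\<bar> \<le> T \<and> \<bar>w\<bar> \<le> T")
  case True
  then have "clip T u = u" "clip T w = w" by (auto simp: clip_def)
  then show ?thesis by simp
next
  case False
  define m where "m = max \<bar>u\<bar> \<bar>w\<bar>"
  have m: "m > T" using False by (auto simp: m_def)
  have clip: "\<exists>c. clip T x = c * x \<and> 0 \<le> c \<and> c \<le> 1" for x
  proof (cases "\<bar>x\<bar> \<le> T")
    case True
    then show ?thesis by (intro exI[of _ 1]) (auto simp: clip_def)
  next
    case False
    then show ?thesis using T
      by (intro exI[of _ "T / \<bar>x\<bar>"], cases "x > 0") (auto simp: clip_def divide_simps)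
  qed
  obtain c where c: "clip T u = c * u" "0 \<le> c" "c \<le> 1" using clip by blast
  obtain d where d: "clip T w = d * w" "0 \<le> d" "d \<le> 1" using clip by blast
  have cd: "0 \<le> c * d" "c * d \<le> 1" using c d by (auto intro: mult_le_one)
  have "u * w - clip T u * clip T w = (1 - c * d) * (u * w)" by (simp add: c d algebra_simps)
  then have "\<bar>u * w - clip T u * clip T w\<bar> = (1 - c * d) * \<bar>u * w\<bar>"
    using cd by (simp add: abs_mult)
  also have "\<dots> \<le> 1 * \<bar>u * w\<bar>" using cd by (intro mult_right_mono) auto
  also have "\<dots> \<le> m * m" by (auto simp: abs_mult m_def intro!: mult_mono)
  also have "\<dots> = m powr 2" using m T by (simp add: powr_numeral power2_eq_square)
  also have "\<dots> = m powr q * m powr (2 - q)" by (simp flip: powr_add)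
  also have "\<dots> \<le> m powr q * T powr (2 - q)"
    using m T q by (intro mult_left_mono powr_mono2') auto
  also have "\<dots> \<le> (\<bar>u\<bar> powr q + \<bar>w\<bar> powr q) * T powr (2 - q)"
    by (intro mult_right_mono) (auto simp: m_def max_def)
  finally show ?thesis .
qed

text \<open>A single variable would allow T^(1 - q). As T >= 1, the weaker T^(2 - q) holds too, and
  all truncation errors in \<open>davydov_covariance\<close> share one rate.\<close>

lemma clip_error:
  fixes u :: real
  assumes T: "T \<ge> 1" and q: "q > 2"
  shows "\<bar>u - clip T u\<bar> \<le> \<bar>u\<bar> powr q * T powr (2 - q)"
proof (cases "\<bar>u\<bar> \<le> T")
  case True
  then have "clip T u = u" by (auto simp: clip_def)
  then show ?thesis by simp
next
  case False
  have "\<bar>u - clip T u\<bar> \<le> \<bar>u\<bar>" using False T by (auto simp: clip_def)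
  also have "\<dots> = \<bar>u\<bar> powr 1" using False T by simp
  also have "\<dots> \<le> \<bar>u\<bar> powr 2" using False T by (intro powr_mono) auto
  also have "\<dots> = \<bar>u\<bar> powr q * \<bar>u\<bar> powr (2 - q)" by (simp flip: powr_add)
  also have "\<dots> \<le> \<bar>u\<bar> powr q * T powr (2 - q)"
    using False T q by (intro mult_left_mono powr_mono2') auto
  finally show ?thesis .
qed

text \<open>The summands stem from the covariance of the clipped variables (4), the truncation error
  in the mean of the product (2 B), and that in the product of the means, each of which is at most 1
  + B.\<close>

definition davydov_const :: "real \<Rightarrow> real" where
  "davydov_const B = 4 + 2 * B + 2 * (1 + B) * B"

context prob_space
begin

lemma integrable_of_abs_powr:
  fixes U :: "'a \<Rightarrow> real"
  assumes [measurable]: "U \<in> borel_measurable M"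
    and int: "integrable M (\<lambda>\<omega>. \<bar>U \<omega>\<bar> powr q)" and q: "q \<ge> 1"
    and B: "expectation (\<lambda>\<omega>. \<bar>U \<omega>\<bar> powr q) \<le> B"
  shows "integrable M U" "expectation (\<lambda>\<omega>. \<bar>U \<omega>\<bar>) \<le> 1 + B"
proof -
  have le: "\<bar>U \<omega>\<bar> \<le> 1 + \<bar>U \<omega>\<bar> powr q" for \<omega>
    using abs_power_le_one_plus_powr[of 1 q "U \<omega>"] q by simp
  have int': "integrable M (\<lambda>\<omega>. 1 + \<bar>U \<omega>\<bar> powr q)" using int by simp
  show *: "integrable M U"
    by (rule Bochner_Integration.integrable_bound[OF int'])
       (use le in \<open>auto intro!: AE_I2 simp: abs_of_nonneg add_nonneg_nonneg\<close>)
  have "expectation (\<lambda>\<omega>. \<bar>U \<omega>\<bar>) \<le> expectation (\<lambda>\<omega>. 1 + \<bar>U \<omega>\<bar> powr q)"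
    by (rule integral_mono) (use * int' le in auto)
  also have "\<dots> \<le> 1 + B" using int B by (simp add: prob_space)
  finally show "expectation (\<lambda>\<omega>. \<bar>U \<omega>\<bar>) \<le> 1 + B" .
qed

lemma integrable_mult_of_abs_powr:
  fixes U W :: "'a \<Rightarrow> real"
  assumes [measurable]: "U \<in> borel_measurable M" "W \<in> borel_measurable M"
    and int: "integrable M (\<lambda>\<omega>. \<bar>U \<omega>\<bar> powr q)" "integrable M (\<lambda>\<omega>. \<bar>W \<omega>\<bar> powr q)"
    and q: "q \<ge> 2"
  shows "integrable M (\<lambda>\<omega>. U \<omega> * W \<omega>)"
proof -
  have le: "\<bar>U \<omega> * W \<omega>\<bar> \<le> (1 + \<bar>U \<omega>\<bar> powr q) + (1 + \<bar>W \<omega>\<bar> powr q)" for \<omega>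
  proof -
    have "\<bar>U \<omega> * W \<omega>\<bar> \<le> \<bar>U \<omega>\<bar>^2 + \<bar>W \<omega>\<bar>^2"
      using sum_squares_bound[of "\<bar>U \<omega>\<bar>" "\<bar>W \<omega>\<bar>"] mult_nonneg_nonneg[of "\<bar>U \<omega>\<bar>" "\<bar>W \<omega>\<bar>"]
      unfolding abs_mult by linarith
    then show ?thesis
      using abs_power_le_one_plus_powr[of 2 q "U \<omega>"] abs_power_le_one_plus_powr[of 2 q "W \<omega>"] q by simp
  qed
  have "integrable M (\<lambda>\<omega>. (1 + \<bar>U \<omega>\<bar> powr q) + (1 + \<bar>W \<omega>\<bar> powr q))" using int by simp
  then show ?thesis
  proof (rule Bochner_Integration.integrable_bound)
    show "AE \<omega> in M. norm (U \<omega> * W \<omega>) \<le> norm ((1 + \<bar>U \<omega>\<bar> powr q) + (1 + \<bar>W \<omega>\<bar> powr q))"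
      using le by (intro AE_I2) (auto intro: order_trans)
  qed measurable
qed

text \<open>Both variables are clipped at a level T. The bounded covariance costs T^2 \<alpha>, the
  truncation T^(2 - q), and T = \<alpha>^(-1/q) makes both equal to \<alpha>^(1 - 2/q). A common
  moment bound \<open>B\<close> stands in place of the product of norms, so the constant is not
  homogeneous in \<open>U\<close> and \<open>W\<close>.\<close>

lemma davydov_covariance:
  fixes U W :: "'a \<Rightarrow> real"
  assumes F: "subalgebra M F" and G: "subalgebra M G"
    and \<alpha>: "\<And>A B. A \<in> sets F \<Longrightarrow> B \<in> sets G \<Longrightarrow> \<bar>prob (A \<inter> B) - prob A * prob B\<bar> \<le> \<alpha>"
    and \<alpha>01: "0 \<le> \<alpha>" "\<alpha> \<le> 1" and q: "q > 2"
    and U: "U \<in> borel_measurable F" "integrable M (\<lambda>\<omega>. \<bar>U \<omega>\<bar> powr q)" "expectation (\<lambda>\<omega>. \<bar>U \<omega>\<bar> powr q) \<le> B"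
    and W: "W \<in> borel_measurable G" "integrable M (\<lambda>\<omega>. \<bar>W \<omega>\<bar> powr q)" "expectation (\<lambda>\<omega>. \<bar>W \<omega>\<bar> powr q) \<le> B"
  shows "\<bar>expectation (\<lambda>\<omega>. U \<omega> * W \<omega>) - expectation U * expectation W\<bar>
          \<le> davydov_const B * \<alpha> powr (1 - 2 / q)"
proof -
  have UM[measurable]: "U \<in> borel_measurable M" by (rule measurable_from_subalg[OF F U(1)])
  have WM[measurable]: "W \<in> borel_measurable M" by (rule measurable_from_subalg[OF G W(1)])
  have intU: "integrable M U" "expectation (\<lambda>\<omega>. \<bar>U \<omega>\<bar>) \<le> 1 + B"
    using integrable_of_abs_powr[OF UM U(2) _ U(3)] q by auto
  have intW: "integrable M W" "expectation (\<lambda>\<omega>. \<bar>W \<omega>\<bar>) \<le> 1 + B"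
    using integrable_of_abs_powr[OF WM W(2) _ W(3)] q by auto
  have intUW: "integrable M (\<lambda>\<omega>. U \<omega> * W \<omega>)"
    by (rule integrable_mult_of_abs_powr) (use U W q in auto)
  have B0: "B \<ge> 0"
  proof -
    have "0 \<le> expectation (\<lambda>\<omega>. \<bar>U \<omega>\<bar> powr q)" by (intro integral_nonneg_AE) auto
    then show ?thesis using U(3) by linarith
  qed
  define c where "c = expectation (\<lambda>\<omega>. U \<omega> * W \<omega>) - expectation U * expectation W"
  have main: "\<bar>c\<bar> \<le> 4 * T\<^sup>2 * \<alpha> + (2 * B + 2 * (1 + B) * B) * T powr (2 - q)" if T: "T \<ge> 1" for T
  proof -
    let ?U = "\<lambda>\<omega>. clip T (U \<omega>)" and ?W = "\<lambda>\<omega>. clip T (W \<omega>)"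
    let ?t = "T powr (2 - q)"
    have clipU: "\<bar>?U \<omega>\<bar> \<le> T" and clipW: "\<bar>?W \<omega>\<bar> \<le> T" for \<omega> using T by (auto intro: abs_clip_le)
    have intcU: "integrable M ?U" by (rule integrable_const_bound[of _ T]) (use clipU in auto)
    have intcW: "integrable M ?W" by (rule integrable_const_bound[of _ T]) (use clipW in auto)
    have intcUW: "integrable M (\<lambda>\<omega>. ?U \<omega> * ?W \<omega>)"
      by (rule integrable_const_bound[of _ "T * T"])
         (use clipU clipW T in \<open>auto simp: abs_mult intro!: mult_mono AE_I2\<close>)
    have 1: "\<bar>expectation (\<lambda>\<omega>. ?U \<omega> * ?W \<omega>) - expectation ?U * expectation ?W\<bar> \<le> 4 * T * T * \<alpha>"
      by (rule mixing_covariance_bounded[OF F G \<alpha>]) (use U(1) W(1) T clipU clipW in auto)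
    have "\<bar>expectation (\<lambda>\<omega>. U \<omega> * W \<omega>) - expectation (\<lambda>\<omega>. ?U \<omega> * ?W \<omega>)\<bar>
        = \<bar>expectation (\<lambda>\<omega>. U \<omega> * W \<omega> - ?U \<omega> * ?W \<omega>)\<bar>" using intUW intcUW by simp
    also have "\<dots> \<le> expectation (\<lambda>\<omega>. \<bar>U \<omega> * W \<omega> - ?U \<omega> * ?W \<omega>\<bar>)" by (rule integral_abs_bound)
    also have "\<dots> \<le> expectation (\<lambda>\<omega>. (\<bar>U \<omega>\<bar> powr q + \<bar>W \<omega>\<bar> powr q) * ?t)"
      by (rule integral_mono) (use intUW intcUW U W clip_mult_error[OF T q] in auto)
    also have "\<dots> = (expectation (\<lambda>\<omega>. \<bar>U \<omega>\<bar> powr q) + expectation (\<lambda>\<omega>. \<bar>W \<omega>\<bar> powr q)) * ?t"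
      using U W by simp
    also have "\<dots> \<le> (B + B) * ?t" using U W by (intro mult_right_mono add_mono) auto
    finally have 2: "\<bar>expectation (\<lambda>\<omega>. U \<omega> * W \<omega>) - expectation (\<lambda>\<omega>. ?U \<omega> * ?W \<omega>)\<bar> \<le> 2 * B * ?t" by simp
    have clip_exp: "\<bar>expectation Z - expectation (\<lambda>\<omega>. clip T (Z \<omega>))\<bar> \<le> B * ?t"
      if "integrable M Z" "integrable M (\<lambda>\<omega>. clip T (Z \<omega>))" "integrable M (\<lambda>\<omega>. \<bar>Z \<omega>\<bar> powr q)"
         "expectation (\<lambda>\<omega>. \<bar>Z \<omega>\<bar> powr q) \<le> B" for Z
    proof -
      have "\<bar>expectation Z - expectation (\<lambda>\<omega>. clip T (Z \<omega>))\<bar> = \<bar>expectation (\<lambda>\<omega>. Z \<omega> - clip T (Z \<omega>))\<bar>"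
        using that by simp
      also have "\<dots> \<le> expectation (\<lambda>\<omega>. \<bar>Z \<omega> - clip T (Z \<omega>)\<bar>)" by (rule integral_abs_bound)
      also have "\<dots> \<le> expectation (\<lambda>\<omega>. \<bar>Z \<omega>\<bar> powr q * ?t)"
        by (rule integral_mono) (use that clip_error[OF T q] in auto)
      also have "\<dots> \<le> B * ?t" using that by (auto intro!: mult_right_mono)
      finally show ?thesis .
    qed
    have EU: "\<bar>expectation U\<bar> \<le> 1 + B" using intU integral_abs_bound[of M U] by linarith
    have EcW: "\<bar>expectation ?W\<bar> \<le> 1 + B"
    proof -
      have "\<bar>expectation ?W\<bar> \<le> expectation (\<lambda>\<omega>. \<bar>?W \<omega>\<bar>)" by (rule integral_abs_bound)
      also have "\<dots> \<le> expectation (\<lambda>\<omega>. \<bar>W \<omega>\<bar>)"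
        by (rule integral_mono) (use intcW intW T abs_clip_le_abs in auto)
      finally show ?thesis using intW by linarith
    qed
    have split: "expectation U * expectation W - expectation ?U * expectation ?W
       = expectation U * (expectation W - expectation ?W) + (expectation U - expectation ?U) * expectation ?W"
      by (simp add: algebra_simps)
    have "\<bar>expectation U * expectation W - expectation ?U * expectation ?W\<bar> \<le> \<bar>expectation U\<bar> * \<bar>expectation W - expectation ?W\<bar>
          + \<bar>expectation U - expectation ?U\<bar> * \<bar>expectation ?W\<bar>"
      unfolding split by (simp only: abs_mult [symmetric] abs_triangle_ineq)
    also have "\<dots> \<le> (1 + B) * (B * ?t) + (B * ?t) * (1 + B)"
      by (intro add_mono mult_mono EU EcW clip_exp[OF intU(1) intcU U(2,3)] clip_exp[OF intW(1) intcW W(2,3)])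
         (use B0 in simp_all)
    finally have 3: "\<bar>expectation U * expectation W - expectation ?U * expectation ?W\<bar> \<le> 2 * (1 + B) * B * ?t"
      by (simp add: algebra_simps)
    have "\<bar>c\<bar> \<le> 4 * T * T * \<alpha> + 2 * B * ?t + 2 * (1 + B) * B * ?t"
      using 1 2 3 unfolding c_def by linarith
    then show ?thesis by (simp add: algebra_simps power2_eq_square)
  qed
  show ?thesis
  proof (cases "\<alpha> = 0")
    case True
    \<comment> \<open>The balancing level would be infinite here, so T is sent to infinity in
      \<open>main\<close>.\<close>
    have "((\<lambda>T. (2 * B + 2 * (1 + B) * B) * T powr (2 - q)) \<longlongrightarrow> (2 * B + 2 * (1 + B) * B) * 0) at_top"
      by (intro tendsto_mult tendsto_const tendsto_neg_powr filterlim_ident) (use q in auto)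
    then have "\<bar>c\<bar> \<le> 0"
      by (intro tendsto_lowerbound[where F = at_top and f = "\<lambda>T. (2 * B + 2 * (1 + B) * B) * T powr (2 - q)"])
         (use main True in \<open>auto simp: eventually_at_top_linorder intro!: exI[of _ 1]\<close>)
    then show ?thesis using True by (simp add: c_def)
  next
    case False
    define T where "T = \<alpha> powr (- 1 / q)"
    have "\<alpha> powr (1 / q) \<le> 1" using \<alpha>01 q by (intro powr_le1) auto
    then have T: "T \<ge> 1" using \<alpha>01 False by (simp add: T_def powr_minus_divide)
    have "T\<^sup>2 * \<alpha> = \<alpha> powr (- 1 / q * 2) * \<alpha> powr 1"
      using T \<alpha>01 False by (simp add: T_def powr_powr flip: powr_numeral)
    also have "\<dots> = \<alpha> powr (1 - 2 / q)" by (simp only: powr_add [symmetric]) simp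
    finally have T2: "T\<^sup>2 * \<alpha> = \<alpha> powr (1 - 2 / q)" .
    have "- 1 / q * (2 - q) = 1 - 2 / q" using q by (simp add: field_simps)
    then have "T powr (2 - q) = \<alpha> powr (1 - 2 / q)" by (simp only: T_def powr_powr)
    then show ?thesis using main[OF T] T2 by (simp add: c_def davydov_const_def algebra_simps)
  qed
qed

end

section \<open>A central limit theorem for strongly mixing sequences\<close>

lemma norm_iexp_minus_one_le: "norm (iexp x - 1) \<le> \<bar>x\<bar>"
  using iexp_approx1[of x 0] by simp

lemma norm_iexp_minus_two_terms_le: "norm (iexp x - 1 - \<i> * x) \<le> x\<^sup>2 / 2"
  using iexp_approx1[of x 1] by (simp add: power2_eq_square algebra_simps)

lemma norm_iexp_minus_three_terms_le: "norm (iexp x - 1 - \<i> * x + x\<^sup>2 / 2) \<le> \<bar>x\<bar> ^ 3 / 6"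
  using iexp_approx1[of x 2]
  by (simp add: power2_eq_square power3_eq_cube fact_numeral eval_nat_numeral algebra_simps)

text \<open>Since |c| <= 1, the error of one step is not amplified by the later ones, and one-step
  errors simply add up. The first \<open>L\<close> steps have their own bound \<open>e0\<close>,
  because the sharp estimate of an increment needs \<open>L\<close> earlier lags.\<close>

lemma norm_recursion_le:
  fixes f :: "nat \<Rightarrow> complex" and c :: complex
  assumes "f 0 = 1" "norm c \<le> 1" "0 \<le> e0" "0 \<le> e1"
    and early: "\<And>j. j < L \<Longrightarrow> norm (f (Suc j) - c * f j) \<le> e0"
    and late: "\<And>j. L \<le> j \<Longrightarrow> norm (f (Suc j) - c * f j) \<le> e1"
  shows "norm (f n - c ^ n) \<le> real L * e0 + real n * e1"
proof -
  have "norm (f n - c ^ n) \<le> real (min n L) * e0 + real n * e1"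
  proof (induction n)
    case 0
    then show ?case using assms by simp
  next
    case (Suc n)
    have "f (Suc n) - c ^ Suc n = (f (Suc n) - c * f n) + c * (f n - c ^ n)"
      by (simp add: algebra_simps)
    then have "norm (f (Suc n) - c ^ Suc n) \<le> norm (f (Suc n) - c * f n) + norm c * norm (f n - c ^ n)"
      by (metis norm_mult norm_triangle_ineq)
    also have "\<dots> \<le> norm (f (Suc n) - c * f n) + norm (f n - c ^ n)"
      using \<open>norm c \<le> 1\<close> by (simp add: mult_left_le_one_le)
    finally have *: "norm (f (Suc n) - c ^ Suc n) \<le> norm (f (Suc n) - c * f n) + (real (min n L) * e0 + real n * e1)"
      using Suc by linarith
    show ?case
    proof (cases "n < L")
      case True
      then have "min (Suc n) L = Suc (min n L)" by simp
      then show ?thesis using * early[OF True] \<open>0 \<le> e1\<close> by (simp add: algebra_simps)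
    next
      case False
      then have "min (Suc n) L = min n L" by simp
      then show ?thesis using * late[of n] False by (simp add: algebra_simps)
    qed
  qed
  also have "\<dots> \<le> real L * e0 + real n * e1"
    using assms by (intro add_mono mult_right_mono) auto
  finally show ?thesis .
qed

section \<open>Mixing sequences: moment bounds and covariance inequalities\<close>

lemma complex_integrableI:
  fixes f :: "'a \<Rightarrow> complex"
  assumes "integrable M (\<lambda>x. Re (f x))" "integrable M (\<lambda>x. Im (f x))"
  shows "integrable M f"
proof -
  have "integrable M (\<lambda>x. complex_of_real (Re (f x)) + \<i> * complex_of_real (Im (f x)))"
    using assms by (intro Bochner_Integration.integrable_add integrable_mult_right integrable_of_real)
  then show ?thesis by (simp add: complex_eq [symmetric])
qed

text \<open>\<open>P k\<close> and \<open>Q k\<close> stand for the \<sigma>-algebras of the past up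
  to k and of the future from k. Time starts at 1, and \<open>mixing\<close> includes the lag r = 0.
  Moments of order 2 q give the product of two variables a moment of order q. Stationarity enters as
  \<open>covariance\<close>: the covariance depends on the lag alone.\<close>

locale mixing_sequence = prob_space +
  fixes P Q :: "nat \<Rightarrow> 'a measure" and X :: "nat \<Rightarrow> 'a \<Rightarrow> real"
    and \<alpha> :: "nat \<Rightarrow> real" and q B :: real and \<gamma> :: "nat \<Rightarrow> real"
  assumes subalgebra_past: "subalgebra M (P k)"
    and subalgebra_future: "subalgebra M (Q k)"
    and past_measurable: "1 \<le> j \<Longrightarrow> j \<le> k \<Longrightarrow> X j \<in> borel_measurable (P k)"
    and future_measurable: "1 \<le> k \<Longrightarrow> k \<le> j \<Longrightarrow> X j \<in> borel_measurable (Q k)"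
    and mixing: "1 \<le> k \<Longrightarrow> A \<in> sets (P k) \<Longrightarrow> C \<in> sets (Q (k + r)) \<Longrightarrow>
                   \<bar>prob (A \<inter> C) - prob A * prob C\<bar> \<le> \<alpha> r"
    and \<alpha>_nonneg: "0 \<le> \<alpha> r" and \<alpha>_le_1: "\<alpha> r \<le> 1"
    and q_gt_2: "q > 2"
    and centered: "1 \<le> j \<Longrightarrow> expectation (X j) = 0"
    and moment_integrable: "1 \<le> j \<Longrightarrow> integrable M (\<lambda>\<omega>. \<bar>X j \<omega>\<bar> powr (2 * q))"
    and moment_bound: "1 \<le> j \<Longrightarrow> expectation (\<lambda>\<omega>. \<bar>X j \<omega>\<bar> powr (2 * q)) \<le> B"
    and covariance: "1 \<le> i \<Longrightarrow> expectation (\<lambda>\<omega>. X i \<omega> * X (i + l) \<omega>) = \<gamma> l"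
    and summable_mixing: "summable (\<lambda>r. \<alpha> (Suc r) powr (1 - 2 / q))"
begin

definition a :: "nat \<Rightarrow> real" where "a r = \<alpha> r powr (1 - 2 / q)"

text \<open>One constant for all estimates: twice Davydov's constant, for real and imaginary part,
  at the q-th moment bound 1 + 2 B; then 3 (1 + B) for products of three variables; then 2 (1 + B)^2
  for a covariance times a first absolute moment.\<close>

definition K :: real where
  "K = 2 * davydov_const (1 + 2 * B) + 3 * (1 + B) + 2 * (1 + B)\<^sup>2"

lemma a_nonneg: "0 \<le> a r"
  by (simp add: a_def)

lemma X_measurable: "1 \<le> j \<Longrightarrow> X j \<in> borel_measurable M"
  using measurable_from_subalg[OF subalgebra_past past_measurable] by blast

lemma B_nonneg: "0 \<le> B"
proof -
  have "0 \<le> expectation (\<lambda>\<omega>. \<bar>X 1 \<omega>\<bar> powr (2 * q))" by (intro integral_nonneg_AE) auto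
  also have "\<dots> \<le> B" by (rule moment_bound) simp
  finally show ?thesis .
qed

lemma davydov_const_nonneg: "0 \<le> davydov_const (1 + 2 * B)"
  using B_nonneg by (simp add: davydov_const_def)

lemma K_ge: "2 * davydov_const (1 + 2 * B) \<le> K" "3 * (1 + B) + 2 * (1 + B)\<^sup>2 \<le> K" "3 * (1 + B) \<le> K"
  "2 * (1 + B) \<le> K" "1 + B \<le> K" "1 \<le> K"
  using B_nonneg davydov_const_nonneg by (simp_all add: K_def add_increasing add_increasing2)

lemma abs_X_power:
  assumes "1 \<le> j" "0 < n" "n \<le> 4"
  shows "integrable M (\<lambda>\<omega>. \<bar>X j \<omega>\<bar> ^ n)" "expectation (\<lambda>\<omega>. \<bar>X j \<omega>\<bar> ^ n) \<le> 1 + B"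
proof -
  note [measurable] = X_measurable[OF \<open>1 \<le> j\<close>]
  have le: "\<bar>X j \<omega>\<bar> ^ n \<le> 1 + \<bar>X j \<omega>\<bar> powr (2 * q)" for \<omega>
    using q_gt_2 assms by (intro abs_power_le_one_plus_powr) auto
  have int: "integrable M (\<lambda>\<omega>. 1 + \<bar>X j \<omega>\<bar> powr (2 * q))" using moment_integrable[OF \<open>1 \<le> j\<close>] by simp
  show 1: "integrable M (\<lambda>\<omega>. \<bar>X j \<omega>\<bar> ^ n)"
    by (rule Bochner_Integration.integrable_bound[OF int]) (use le in \<open>auto intro!: AE_I2\<close>)
  have "expectation (\<lambda>\<omega>. \<bar>X j \<omega>\<bar> ^ n) \<le> expectation (\<lambda>\<omega>. 1 + \<bar>X j \<omega>\<bar> powr (2 * q))"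
    by (rule integral_mono[OF 1 int le])
  also have "\<dots> \<le> 1 + B"
    using moment_integrable[OF \<open>1 \<le> j\<close>] moment_bound[OF \<open>1 \<le> j\<close>] by (simp add: prob_space)
  finally show "expectation (\<lambda>\<omega>. \<bar>X j \<omega>\<bar> ^ n) \<le> 1 + B" .
qed

lemma integrable_X: "1 \<le> j \<Longrightarrow> integrable M (X j)"
  using abs_X_power(1)[of j 1] X_measurable[of j] integrable_abs_iff[of "X j" M] by simp

lemma abs_X_mult3:
  assumes "1 \<le> i" "1 \<le> j" "1 \<le> k"
  shows "integrable M (\<lambda>\<omega>. \<bar>X i \<omega>\<bar> * \<bar>X j \<omega>\<bar> * \<bar>X k \<omega>\<bar>)"
    "expectation (\<lambda>\<omega>. \<bar>X i \<omega>\<bar> * \<bar>X j \<omega>\<bar> * \<bar>X k \<omega>\<bar>) \<le> 3 * (1 + B)"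
proof -
  note [measurable] = X_measurable[OF assms(1)] X_measurable[OF assms(2)] X_measurable[OF assms(3)]
  let ?s = "\<lambda>\<omega>. \<bar>X i \<omega>\<bar> ^ 3 + \<bar>X j \<omega>\<bar> ^ 3 + \<bar>X k \<omega>\<bar> ^ 3"
  have le: "\<bar>X i \<omega>\<bar> * \<bar>X j \<omega>\<bar> * \<bar>X k \<omega>\<bar> \<le> ?s \<omega>" for \<omega>
  proof -
    define m where "m = max \<bar>X i \<omega>\<bar> (max \<bar>X j \<omega>\<bar> \<bar>X k \<omega>\<bar>)"
    have "\<bar>X i \<omega>\<bar> * \<bar>X j \<omega>\<bar> * \<bar>X k \<omega>\<bar> \<le> m * m * m"
      by (intro mult_mono) (auto simp: m_def)
    also have "\<dots> = m ^ 3" by (simp add: power3_eq_cube)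
    also have "\<dots> \<le> ?s \<omega>" by (auto simp: m_def max_def)
    finally show ?thesis .
  qed
  have int: "integrable M ?s" using abs_X_power(1)[of _ 3] assms by simp
  show 1: "integrable M (\<lambda>\<omega>. \<bar>X i \<omega>\<bar> * \<bar>X j \<omega>\<bar> * \<bar>X k \<omega>\<bar>)"
    by (rule Bochner_Integration.integrable_bound[OF int])
       (use le in \<open>auto intro!: AE_I2 simp: abs_mult intro: order_trans\<close>)
  have "expectation (\<lambda>\<omega>. \<bar>X i \<omega>\<bar> * \<bar>X j \<omega>\<bar> * \<bar>X k \<omega>\<bar>) \<le> expectation ?s"
    by (rule integral_mono[OF 1 int le])
  also have "\<dots> \<le> 3 * (1 + B)"
    using abs_X_power[of _ 3] assms by (simp add: add_mono[OF add_mono, of _ "1+B" _ "1+B" _ "1+B", simplified])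
  finally show "expectation (\<lambda>\<omega>. \<bar>X i \<omega>\<bar> * \<bar>X j \<omega>\<bar> * \<bar>X k \<omega>\<bar>) \<le> 3 * (1 + B)" .
qed

lemma abs_X_mult2:
  assumes "1 \<le> i" "1 \<le> j"
  shows "integrable M (\<lambda>\<omega>. X i \<omega> * X j \<omega>)"
    "expectation (\<lambda>\<omega>. \<bar>X i \<omega> * X j \<omega>\<bar>) \<le> 2 * (1 + B)"
proof -
  note [measurable] = X_measurable[OF assms(1)] X_measurable[OF assms(2)]
  let ?s = "\<lambda>\<omega>. \<bar>X i \<omega>\<bar> ^ 2 + \<bar>X j \<omega>\<bar> ^ 2"
  have le: "\<bar>X i \<omega> * X j \<omega>\<bar> \<le> ?s \<omega>" for \<omega>
    using sum_squares_bound[of "\<bar>X i \<omega>\<bar>" "\<bar>X j \<omega>\<bar>"] mult_nonneg_nonneg[of "\<bar>X i \<omega>\<bar>" "\<bar>X j \<omega>\<bar>"]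
    unfolding abs_mult by linarith
  have int: "integrable M ?s" using abs_X_power(1)[of _ 2] assms by simp
  show 1: "integrable M (\<lambda>\<omega>. X i \<omega> * X j \<omega>)"
    by (rule Bochner_Integration.integrable_bound[OF int]) (use le in \<open>auto intro!: AE_I2\<close>)
  have "expectation (\<lambda>\<omega>. \<bar>X i \<omega> * X j \<omega>\<bar>) \<le> expectation ?s"
    by (rule integral_mono[OF _ int le]) (use 1 in simp)
  also have "\<dots> = expectation (\<lambda>\<omega>. \<bar>X i \<omega>\<bar> ^ 2) + expectation (\<lambda>\<omega>. \<bar>X j \<omega>\<bar> ^ 2)"
    using abs_X_power(1)[of _ 2] assms by (intro Bochner_Integration.integral_add) auto
  also have "\<dots> \<le> (1 + B) + (1 + B)"
    using assms by (intro add_mono abs_X_power(2)) auto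
  finally show "expectation (\<lambda>\<omega>. \<bar>X i \<omega> * X j \<omega>\<bar>) \<le> 2 * (1 + B)" by simp
qed

lemma X_powr:
  assumes "1 \<le> j"
  shows "integrable M (\<lambda>\<omega>. \<bar>X j \<omega>\<bar> powr q)" "expectation (\<lambda>\<omega>. \<bar>X j \<omega>\<bar> powr q) \<le> 1 + 2 * B"
proof -
  note [measurable] = X_measurable[OF \<open>1 \<le> j\<close>]
  have le: "\<bar>X j \<omega>\<bar> powr q \<le> 1 + \<bar>X j \<omega>\<bar> powr (2 * q)" for \<omega>
    using q_gt_2 by (intro powr_le_one_plus_powr) auto
  have int: "integrable M (\<lambda>\<omega>. 1 + \<bar>X j \<omega>\<bar> powr (2 * q))" using moment_integrable[OF \<open>1 \<le> j\<close>] by simp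
  show 1: "integrable M (\<lambda>\<omega>. \<bar>X j \<omega>\<bar> powr q)"
    by (rule Bochner_Integration.integrable_bound[OF int]) (use le in \<open>auto intro!: AE_I2\<close>)
  have "expectation (\<lambda>\<omega>. \<bar>X j \<omega>\<bar> powr q) \<le> expectation (\<lambda>\<omega>. 1 + \<bar>X j \<omega>\<bar> powr (2 * q))"
    by (rule integral_mono[OF 1 int le])
  also have "\<dots> \<le> 1 + 2 * B"
    using moment_integrable[OF \<open>1 \<le> j\<close>] moment_bound[OF \<open>1 \<le> j\<close>] B_nonneg by (simp add: prob_space)
  finally show "expectation (\<lambda>\<omega>. \<bar>X j \<omega>\<bar> powr q) \<le> 1 + 2 * B" .
qed

lemma X_mult_powr:
  assumes "1 \<le> i" "1 \<le> j"
  shows "integrable M (\<lambda>\<omega>. \<bar>X i \<omega> * X j \<omega>\<bar> powr q)"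
    "expectation (\<lambda>\<omega>. \<bar>X i \<omega> * X j \<omega>\<bar> powr q) \<le> 1 + 2 * B"
proof -
  note [measurable] = X_measurable[OF assms(1)] X_measurable[OF assms(2)]
  let ?s = "\<lambda>\<omega>. \<bar>X i \<omega>\<bar> powr (2 * q) + \<bar>X j \<omega>\<bar> powr (2 * q)"
  have le: "\<bar>X i \<omega> * X j \<omega>\<bar> powr q \<le> ?s \<omega>" for \<omega>
  proof -
    define m where "m = max \<bar>X i \<omega>\<bar> \<bar>X j \<omega>\<bar>"
    have "\<bar>X i \<omega> * X j \<omega>\<bar> powr q \<le> (m * m) powr q"
      using q_gt_2 by (intro powr_mono2) (auto simp: m_def abs_mult intro!: mult_mono)
    also have "\<dots> = m powr (2 * q)"
      by (simp add: m_def powr_mult flip: powr_add)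
    also have "\<dots> \<le> ?s \<omega>" by (auto simp: m_def max_def)
    finally show ?thesis .
  qed
  have int: "integrable M ?s" using moment_integrable assms by simp
  show 1: "integrable M (\<lambda>\<omega>. \<bar>X i \<omega> * X j \<omega>\<bar> powr q)"
    by (rule Bochner_Integration.integrable_bound[OF int]) (use le in \<open>auto intro!: AE_I2\<close>)
  have "expectation (\<lambda>\<omega>. \<bar>X i \<omega> * X j \<omega>\<bar> powr q) \<le> expectation ?s"
    by (rule integral_mono[OF 1 int le])
  also have "\<dots> = expectation (\<lambda>\<omega>. \<bar>X i \<omega>\<bar> powr (2 * q)) + expectation (\<lambda>\<omega>. \<bar>X j \<omega>\<bar> powr (2 * q))"
    using moment_integrable assms by (intro Bochner_Integration.integral_add) auto
  also have "\<dots> \<le> B + B"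
    using assms by (intro add_mono moment_bound) auto
  finally show "expectation (\<lambda>\<omega>. \<bar>X i \<omega> * X j \<omega>\<bar> powr q) \<le> 1 + 2 * B" by simp
qed

text \<open>Davydov's inequality for the real and the imaginary part of \<open>U\<close>, which
  gives the factor 2 contained in \<open>K\<close>. The majorant \<open>Y\<close> supplies the q-th
  moment: it is a single X_j when \<open>U\<close> is that variable or an increment of the
  exponential divided by \<theta>, and 1 when \<open>U\<close> is the exponential itself.\<close>

lemma covariance_complex:
  fixes U :: "'a \<Rightarrow> complex"
  assumes k: "1 \<le> k"
    and U[measurable]: "U \<in> borel_measurable (P k)"
    and Y: "integrable M (\<lambda>\<omega>. \<bar>Y \<omega>\<bar> powr q)" "expectation (\<lambda>\<omega>. \<bar>Y \<omega>\<bar> powr q) \<le> 1 + 2 * B"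
      "\<And>\<omega>. norm (U \<omega>) \<le> \<bar>Y \<omega>\<bar>"
    and W: "W \<in> borel_measurable (Q (k + r))"
      "integrable M (\<lambda>\<omega>. \<bar>W \<omega>\<bar> powr q)" "expectation (\<lambda>\<omega>. \<bar>W \<omega>\<bar> powr q) \<le> 1 + 2 * B"
  shows "norm (expectation (\<lambda>\<omega>. U \<omega> * W \<omega>) - expectation U * expectation W) \<le> K * a r"
proof -
  have [measurable]: "U \<in> borel_measurable M"
    by (rule measurable_from_subalg[OF subalgebra_past U])
  have WM[measurable]: "W \<in> borel_measurable M"
    by (rule measurable_from_subalg[OF subalgebra_future W(1)])
  have part: "\<bar>expectation (\<lambda>\<omega>. V \<omega> * W \<omega>) - expectation V * expectation W\<bar>
       \<le> davydov_const (1 + 2 * B) * a r \<and> integrable M V \<and> integrable M (\<lambda>\<omega>. V \<omega> * W \<omega>)"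
    if V[measurable]: "V \<in> borel_measurable (P k)" "V \<in> borel_measurable M"
      and le: "\<And>\<omega>. \<bar>V \<omega>\<bar> \<le> norm (U \<omega>)" for V
  proof -
    have le': "\<bar>V \<omega>\<bar> powr q \<le> \<bar>Y \<omega>\<bar> powr q" for \<omega>
      using le[of \<omega>] Y(3)[of \<omega>] q_gt_2 by (intro powr_mono2) auto
    have int: "integrable M (\<lambda>\<omega>. \<bar>V \<omega>\<bar> powr q)"
      by (rule Bochner_Integration.integrable_bound[OF Y(1)]) (use le' in \<open>auto intro!: AE_I2\<close>)
    have "expectation (\<lambda>\<omega>. \<bar>V \<omega>\<bar> powr q) \<le> expectation (\<lambda>\<omega>. \<bar>Y \<omega>\<bar> powr q)"
      by (rule integral_mono[OF int Y(1) le'])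
    then have bd: "expectation (\<lambda>\<omega>. \<bar>V \<omega>\<bar> powr q) \<le> 1 + 2 * B" using Y(2) by simp
    have "\<bar>expectation (\<lambda>\<omega>. V \<omega> * W \<omega>) - expectation V * expectation W\<bar> \<le> davydov_const (1 + 2 * B) * a r"
      unfolding a_def
      by (rule davydov_covariance[OF subalgebra_past subalgebra_future mixing[OF k] \<alpha>_nonneg \<alpha>_le_1 q_gt_2
            V(1) int bd W])
    moreover have "integrable M V"
      by (rule integrable_of_abs_powr[OF V(2) int _ bd]) (use q_gt_2 in simp)
    moreover have "integrable M (\<lambda>\<omega>. V \<omega> * W \<omega>)"
      by (rule integrable_mult_of_abs_powr[OF V(2) WM int W(2)]) (use q_gt_2 in simp)
    ultimately show ?thesis by blast
  qed
  have Re: "\<bar>expectation (\<lambda>\<omega>. Re (U \<omega>) * W \<omega>) - expectation (\<lambda>\<omega>. Re (U \<omega>)) * expectation W\<bar>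
       \<le> davydov_const (1 + 2 * B) * a r \<and> integrable M (\<lambda>\<omega>. Re (U \<omega>)) \<and> integrable M (\<lambda>\<omega>. Re (U \<omega>) * W \<omega>)"
    by (rule part) (auto simp: abs_Re_le_cmod)
  have Im: "\<bar>expectation (\<lambda>\<omega>. Im (U \<omega>) * W \<omega>) - expectation (\<lambda>\<omega>. Im (U \<omega>)) * expectation W\<bar>
       \<le> davydov_const (1 + 2 * B) * a r \<and> integrable M (\<lambda>\<omega>. Im (U \<omega>)) \<and> integrable M (\<lambda>\<omega>. Im (U \<omega>) * W \<omega>)"
    by (rule part) (auto simp: abs_Im_le_cmod)
  have intU: "integrable M U"
    using Re Im by (intro complex_integrableI) simp_all
  have intUW: "integrable M (\<lambda>\<omega>. U \<omega> * W \<omega>)"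
    using Re Im by (intro complex_integrableI) simp_all
  define d where "d = expectation (\<lambda>\<omega>. U \<omega> * W \<omega>) - expectation U * expectation W"
  have "Re d = expectation (\<lambda>\<omega>. Re (U \<omega>) * W \<omega>) - expectation (\<lambda>\<omega>. Re (U \<omega>)) * expectation W"
    using intU intUW by (simp add: d_def flip: integral_Re)
  moreover have "Im d = expectation (\<lambda>\<omega>. Im (U \<omega>) * W \<omega>) - expectation (\<lambda>\<omega>. Im (U \<omega>)) * expectation W"
    using intU intUW by (simp add: d_def flip: integral_Im)
  ultimately have "norm d \<le> 2 * davydov_const (1 + 2 * B) * a r"
    using Re Im cmod_le[of d] by simp
  also have "\<dots> \<le> K * a r"
    using K_ge(1) a_nonneg by (intro mult_right_mono)
  finally show ?thesis by (simp add: d_def)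
qed

end

context prob_space
begin

lemma norm_expectation_mult_le:
  fixes U :: "'a \<Rightarrow> complex" and W Z :: "'a \<Rightarrow> real"
  assumes "U \<in> borel_measurable M" "W \<in> borel_measurable M" "integrable M Z"
    and "\<And>\<omega>. norm (U \<omega>) * \<bar>W \<omega>\<bar> \<le> Z \<omega>"
  shows "integrable M (\<lambda>\<omega>. U \<omega> * W \<omega>)" "norm (expectation (\<lambda>\<omega>. U \<omega> * W \<omega>)) \<le> expectation Z"
proof -
  note [measurable] = assms(1,2)
  show int: "integrable M (\<lambda>\<omega>. U \<omega> * W \<omega>)"
    by (rule Bochner_Integration.integrable_bound[OF assms(3)])
       (use assms(4) in \<open>auto simp: norm_mult intro!: AE_I2 intro: order_trans[OF _ abs_ge_self]\<close>)
  have "norm (expectation (\<lambda>\<omega>. U \<omega> * W \<omega>)) \<le> expectation (\<lambda>\<omega>. norm (U \<omega> * W \<omega>))"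
    by (rule integral_norm_bound)
  also have "\<dots> \<le> expectation Z"
    by (rule integral_mono[OF integrable_norm[OF int] assms(3)]) (use assms(4) in \<open>simp add: norm_mult\<close>)
  finally show "norm (expectation (\<lambda>\<omega>. U \<omega> * W \<omega>)) \<le> expectation Z" .
qed

end

section \<open>Characteristic functions of the partial sums and their increments\<close>

context mixing_sequence
begin

definition S :: "nat \<Rightarrow> 'a \<Rightarrow> real" where "S k \<omega> = (\<Sum>i=1..k. X i \<omega>)"

definition e :: "real \<Rightarrow> nat \<Rightarrow> 'a \<Rightarrow> complex" where "e \<theta> k \<omega> = iexp (\<theta> * S k \<omega>)"

definition f :: "real \<Rightarrow> nat \<Rightarrow> complex" where "f \<theta> k = expectation (e \<theta> k)"

definition tail :: "nat \<Rightarrow> real" where "tail L = (\<Sum>i. a (Suc (i + L)))"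

text \<open>The long-run variance of the sequence, the limit of Var (S n) / n.\<close>

definition \<sigma>2 :: real where "\<sigma>2 = \<gamma> 0 + 2 * (\<Sum>k. \<gamma> (Suc k))"

lemma e_past_measurable: "e \<theta> k \<in> borel_measurable (P k)"
proof -
  have "S k \<in> borel_measurable (P k)"
    unfolding S_def using past_measurable by (intro borel_measurable_sum) auto
  then show ?thesis unfolding e_def by measurable
qed

lemma e_measurable [measurable]: "e \<theta> k \<in> borel_measurable M"
  by (rule measurable_from_subalg[OF subalgebra_past e_past_measurable])

lemma norm_e [simp]: "norm (e \<theta> k \<omega>) = 1"
  by (simp add: e_def)

lemma e_0 [simp]: "e \<theta> 0 \<omega> = 1"
  by (simp add: e_def S_def)

lemma e_Suc: "e \<theta> (Suc k) \<omega> = e \<theta> k \<omega> * iexp (\<theta> * X (Suc k) \<omega>)"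
  by (simp add: e_def S_def ring_distribs exp_add)

lemma integrable_e: "integrable M (e \<theta> k)"
  by (rule integrable_const_bound[of _ 1]) auto

lemma norm_f_le_1: "norm (f \<theta> k) \<le> 1"
proof -
  have "norm (f \<theta> k) \<le> expectation (\<lambda>\<omega>. norm (e \<theta> k \<omega>))"
    unfolding f_def by (rule integral_norm_bound)
  then show ?thesis by (simp add: prob_space)
qed

lemma norm_e_Suc_diff_le: "norm (e \<theta> (Suc k) \<omega> - e \<theta> k \<omega>) \<le> \<bar>\<theta>\<bar> * \<bar>X (Suc k) \<omega>\<bar>"
proof -
  have "e \<theta> (Suc k) \<omega> - e \<theta> k \<omega> = e \<theta> k \<omega> * (iexp (\<theta> * X (Suc k) \<omega>) - 1)"
    by (simp only: e_Suc right_diff_distrib mult_1_right)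
  then show ?thesis
    using norm_iexp_minus_one_le[of "\<theta> * X (Suc k) \<omega>"] by (simp add: norm_mult abs_mult)
qed

lemma norm_e_diff_le:
  assumes "m \<le> n"
  shows "norm (e \<theta> n \<omega> - e \<theta> m \<omega>) \<le> \<bar>\<theta>\<bar> * (\<Sum>u\<in>{m..<n}. \<bar>X (Suc u) \<omega>\<bar>)"
  using assms
proof (induction n rule: dec_induct)
  case (step n)
  have "norm (e \<theta> (Suc n) \<omega> - e \<theta> m \<omega>) \<le> norm (e \<theta> (Suc n) \<omega> - e \<theta> n \<omega>) + norm (e \<theta> n \<omega> - e \<theta> m \<omega>)"
    using norm_triangle_ineq[of "e \<theta> (Suc n) \<omega> - e \<theta> n \<omega>" "e \<theta> n \<omega> - e \<theta> m \<omega>"] by simp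
  then show ?case
    using step norm_e_Suc_diff_le[of \<theta> n \<omega>] by (simp add: ring_distribs)
qed simp

lemma abs_\<gamma>_le: "\<bar>\<gamma> l\<bar> \<le> 2 * (1 + B)"
proof -
  have "\<bar>\<gamma> l\<bar> \<le> expectation (\<lambda>\<omega>. \<bar>X 1 \<omega> * X (1 + l) \<omega>\<bar>)"
    using covariance[of 1 l] integral_abs_bound[of M "\<lambda>\<omega>. X 1 \<omega> * X (1 + l) \<omega>"] by simp
  also have "\<dots> \<le> 2 * (1 + B)" by (rule abs_X_mult2) auto
  finally show ?thesis .
qed

lemma abs_\<gamma>_le_mixing: "\<bar>\<gamma> l\<bar> \<le> K * a l"
proof -
  have "norm (expectation (\<lambda>\<omega>. complex_of_real (X 1 \<omega>) * X (1 + l) \<omega>)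
     - expectation (\<lambda>\<omega>. complex_of_real (X 1 \<omega>)) * expectation (X (1 + l))) \<le> K * a l"
    by (rule covariance_complex[where Y = "X 1"])
       (use past_measurable[of 1 1] future_measurable[of "1 + l" "1 + l"] X_powr in auto)
  moreover have "expectation (\<lambda>\<omega>. complex_of_real (X 1 \<omega>) * X (1 + l) \<omega>) = \<gamma> l"
    using covariance[of 1 l] by (simp flip: of_real_mult)
  ultimately show ?thesis using centered[of "1 + l"] by simp
qed

text \<open>Divided by \<theta>, the increment is dominated by |X_(k+1)|, uniformly in \<theta>, and
  belongs to the past up to k + 1, while the variable at distance \<open>l\<close> is centered.
  Davydov's inequality then gives the mixing rate together with a factor \<theta>.\<close>

lemma increment_covariance:
  "norm (expectation (\<lambda>\<omega>. (e \<theta> (Suc k) \<omega> - e \<theta> k \<omega>) * X (Suc k + l) \<omega>)) \<le> \<bar>\<theta>\<bar> * (K * a l)"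
proof (cases "\<theta> = 0")
  case True
  then show ?thesis by (simp add: e_def)
next
  case False
  let ?U = "\<lambda>\<omega>. (e \<theta> (Suc k) \<omega> - e \<theta> k \<omega>) / \<theta>"
  have [measurable]: "e \<theta> (Suc k) \<in> borel_measurable (P (Suc k))"
    by (rule e_past_measurable)
  \<comment> \<open>The locale does not make \<open>P\<close> increasing, so measurability of
    \<open>e \<theta> k\<close> for \<open>P (Suc k)\<close> is obtained from that of
    \<open>e \<theta> (Suc k)\<close> by cancelling its last factor.\<close>
  have "(\<lambda>\<omega>. e \<theta> (Suc k) \<omega> * iexp (- \<theta> * X (Suc k) \<omega>)) = e \<theta> k"
    by (simp add: e_Suc fun_eq_iff flip: exp_add)
  moreover have "(\<lambda>\<omega>. e \<theta> (Suc k) \<omega> * iexp (- \<theta> * X (Suc k) \<omega>)) \<in> borel_measurable (P (Suc k))"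
    using past_measurable[of "Suc k" "Suc k"] by measurable
  ultimately have [measurable]: "e \<theta> k \<in> borel_measurable (P (Suc k))" by simp
  have "norm (expectation (\<lambda>\<omega>. ?U \<omega> * X (Suc k + l) \<omega>) - expectation ?U * expectation (X (Suc k + l))) \<le> K * a l"
  proof (rule covariance_complex[where Y = "X (Suc k)" and k = "Suc k" and r = l])
    show "norm (?U \<omega>) \<le> \<bar>X (Suc k) \<omega>\<bar>" for \<omega>
      using norm_e_Suc_diff_le[of \<theta> k \<omega>] False by (simp add: norm_divide divide_simps mult.commute)
  qed (use future_measurable[of "Suc k + l" "Suc k + l"] X_powr in auto)
  moreover have "expectation (\<lambda>\<omega>. ?U \<omega> * X (Suc k + l) \<omega>)
     = expectation (\<lambda>\<omega>. (e \<theta> (Suc k) \<omega> - e \<theta> k \<omega>) * X (Suc k + l) \<omega>) / \<theta>"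
    by simp
  ultimately show ?thesis
    using centered[of "Suc k + l"] False by (simp add: norm_divide divide_simps mult.commute)
qed

text \<open>The exponential is moved back to time k + 1 - r. Across the gap of length r, mixing
  decouples it from the centered product at the cost K a(r). The move changes the exponential by at
  most |\<theta>| times a sum of at most r variables |X_u|, and each |X_u| times the product has
  mean at most K.\<close>

lemma product_covariance:
  assumes r: "1 \<le> r"
  shows "norm (expectation (\<lambda>\<omega>. e \<theta> k \<omega> * complex_of_real (X (Suc k) \<omega> * X (Suc k + l) \<omega> - \<gamma> l)))
          \<le> K * a r + \<bar>\<theta>\<bar> * (real r * K)"
proof -
  note [measurable] = X_measurable
  define i where "i = Suc k"
  have i: "1 \<le> i" "1 \<le> i + l" by (auto simp: i_def)
  define Y where "Y \<omega> = X i \<omega> * X (i + l) \<omega> - \<gamma> l" for \<omega>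
  \<comment> \<open>Subtraction of naturals: k' = 0 when the past is shorter than the gap. The
    exponential at time 0 is 1, and the centered product then contributes exactly 0.\<close>
  define k' where "k' = i - r"
  have k': "k' \<le> k" "k - k' \<le> r" using r by (auto simp: k'_def i_def)
  have Ym[measurable]: "Y \<in> borel_measurable M" unfolding Y_def using i by measurable
  have intXX: "integrable M (\<lambda>\<omega>. X i \<omega> * X (i + l) \<omega>)" by (rule abs_X_mult2[OF i])
  have intY: "integrable M Y" unfolding Y_def using intXX by simp
  have EY: "expectation Y = 0"
    unfolding Y_def using intXX covariance[of i l] i by (simp add: prob_space)
  have XY: "integrable M (\<lambda>\<omega>. \<bar>X (Suc u) \<omega>\<bar> * \<bar>Y \<omega>\<bar>) \<and> expectation (\<lambda>\<omega>. \<bar>X (Suc u) \<omega>\<bar> * \<bar>Y \<omega>\<bar>) \<le> K" for u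
  proof -
    let ?Z = "\<lambda>\<omega>. \<bar>X (Suc u) \<omega>\<bar> * \<bar>X i \<omega>\<bar> * \<bar>X (i + l) \<omega>\<bar> + \<bar>\<gamma> l\<bar> * \<bar>X (Suc u) \<omega>\<bar>"
    have u: "1 \<le> Suc u" by simp
    note [measurable] = X_measurable[OF u]
    have le: "\<bar>X (Suc u) \<omega>\<bar> * \<bar>Y \<omega>\<bar> \<le> ?Z \<omega>" for \<omega>
    proof -
      have "\<bar>X (Suc u) \<omega>\<bar> * \<bar>Y \<omega>\<bar> \<le> \<bar>X (Suc u) \<omega>\<bar> * (\<bar>X i \<omega> * X (i + l) \<omega>\<bar> + \<bar>\<gamma> l\<bar>)"
        unfolding Y_def by (intro mult_left_mono) auto
      then show ?thesis by (simp add: abs_mult algebra_simps)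
    qed
    have intX: "integrable M (\<lambda>\<omega>. \<bar>X (Suc u) \<omega>\<bar>)" using integrable_X[OF u] by simp
    have intZ: "integrable M ?Z" using abs_X_mult3(1)[OF u i] intX by simp
    have int: "integrable M (\<lambda>\<omega>. \<bar>X (Suc u) \<omega>\<bar> * \<bar>Y \<omega>\<bar>)"
      by (rule Bochner_Integration.integrable_bound[OF intZ])
         (use le in \<open>auto intro!: AE_I2 simp: abs_mult intro: order_trans\<close>)
    have "expectation (\<lambda>\<omega>. \<bar>X (Suc u) \<omega>\<bar> * \<bar>Y \<omega>\<bar>) \<le> expectation ?Z"
      by (rule integral_mono[OF int intZ le])
    also have "\<dots> = expectation (\<lambda>\<omega>. \<bar>X (Suc u) \<omega>\<bar> * \<bar>X i \<omega>\<bar> * \<bar>X (i + l) \<omega>\<bar>) + \<bar>\<gamma> l\<bar> * expectation (\<lambda>\<omega>. \<bar>X (Suc u) \<omega>\<bar>)"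
      using abs_X_mult3(1)[OF u i] intX by simp
    also have "\<dots> \<le> 3 * (1 + B) + 2 * (1 + B) * (1 + B)"
      using abs_X_mult3(2)[OF u i] abs_X_power(2)[OF u, of 1] abs_\<gamma>_le[of l] B_nonneg
      by (intro add_mono mult_mono) (auto intro: integral_nonneg_AE)
    also have "\<dots> \<le> K" using K_ge(2) by (simp add: power2_eq_square algebra_simps)
    finally show ?thesis using int by simp
  qed
  let ?Z = "\<lambda>\<omega>. \<bar>\<theta>\<bar> * (\<Sum>u\<in>{k'..<k}. \<bar>X (Suc u) \<omega>\<bar> * \<bar>Y \<omega>\<bar>)"
  have intZ: "integrable M ?Z" using XY by (intro integrable_mult_right Bochner_Integration.integrable_sum) auto
  have leZ: "norm (e \<theta> k \<omega> - e \<theta> k' \<omega>) * \<bar>Y \<omega>\<bar> \<le> ?Z \<omega>" for \<omega>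
  proof -
    have "norm (e \<theta> k \<omega> - e \<theta> k' \<omega>) * \<bar>Y \<omega>\<bar> \<le> (\<bar>\<theta>\<bar> * (\<Sum>u\<in>{k'..<k}. \<bar>X (Suc u) \<omega>\<bar>)) * \<bar>Y \<omega>\<bar>"
      by (intro mult_right_mono norm_e_diff_le k') auto
    then show ?thesis by (simp only: mult.assoc sum_distrib_right)
  qed
  note diff = norm_expectation_mult_le[OF _ Ym intZ leZ]
  have d1: "integrable M (\<lambda>\<omega>. (e \<theta> k \<omega> - e \<theta> k' \<omega>) * Y \<omega>)"
    "norm (expectation (\<lambda>\<omega>. (e \<theta> k \<omega> - e \<theta> k' \<omega>) * Y \<omega>)) \<le> expectation ?Z"
    by (rule diff; measurable)+
  have "expectation ?Z = \<bar>\<theta>\<bar> * (\<Sum>u\<in>{k'..<k}. expectation (\<lambda>\<omega>. \<bar>X (Suc u) \<omega>\<bar> * \<bar>Y \<omega>\<bar>))"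
    using XY by (simp add: Bochner_Integration.integral_sum)
  also have "\<dots> \<le> \<bar>\<theta>\<bar> * (\<Sum>u\<in>{k'..<k}. K)"
    using XY by (intro mult_left_mono sum_mono) auto
  also have "\<dots> \<le> \<bar>\<theta>\<bar> * (real r * K)"
    using k' K_ge(6) by (auto intro!: mult_left_mono mult_right_mono simp: of_nat_diff)
  finally have d2: "norm (expectation (\<lambda>\<omega>. (e \<theta> k \<omega> - e \<theta> k' \<omega>) * Y \<omega>)) \<le> \<bar>\<theta>\<bar> * (real r * K)"
    using d1 by simp
  have int': "integrable M (\<lambda>\<omega>. e \<theta> k' \<omega> * Y \<omega>)"
    by (rule norm_expectation_mult_le(1)[where Z = "\<lambda>\<omega>. \<bar>Y \<omega>\<bar>"]) (use intY in auto)
  have d3: "norm (expectation (\<lambda>\<omega>. e \<theta> k' \<omega> * Y \<omega>)) \<le> K * a r"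
  proof (cases "k' = 0")
    case True
    then have "expectation (\<lambda>\<omega>. e \<theta> k' \<omega> * Y \<omega>) = 0" using EY by simp
    then show ?thesis using K_ge(6) a_nonneg[of r] by simp
  next
    case False
    then have k'r: "k' + r = i" by (auto simp: k'_def)
    have intXXc: "integrable M (\<lambda>\<omega>. e \<theta> k' \<omega> * complex_of_real (X i \<omega> * X (i + l) \<omega>))"
      by (rule norm_expectation_mult_le(1)[where Z = "\<lambda>\<omega>. \<bar>X i \<omega> * X (i + l) \<omega>\<bar>"]) (use intXX i in auto)
    have "norm (expectation (\<lambda>\<omega>. e \<theta> k' \<omega> * complex_of_real (X i \<omega> * X (i + l) \<omega>))
       - expectation (e \<theta> k') * expectation (\<lambda>\<omega>. X i \<omega> * X (i + l) \<omega>)) \<le> K * a r"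
      by (rule covariance_complex[where Y = "\<lambda>_. 1" and k = k' and r = r])
         (use False e_past_measurable X_mult_powr[OF i] B_nonneg
            future_measurable[of i i] future_measurable[of i "i + l"] i in \<open>auto simp: k'r prob_space\<close>)
    also have "expectation (\<lambda>\<omega>. e \<theta> k' \<omega> * complex_of_real (X i \<omega> * X (i + l) \<omega>))
       - expectation (e \<theta> k') * expectation (\<lambda>\<omega>. X i \<omega> * X (i + l) \<omega>)
       = expectation (\<lambda>\<omega>. e \<theta> k' \<omega> * complex_of_real (X i \<omega> * X (i + l) \<omega>) - e \<theta> k' \<omega> * \<gamma> l)"
      using covariance[OF i(1), of l] intXXc integrable_e[of \<theta> k'] by simp
    also have "\<dots> = expectation (\<lambda>\<omega>. e \<theta> k' \<omega> * Y \<omega>)"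
      by (simp add: Y_def right_diff_distrib)
    finally show ?thesis .
  qed
  have "expectation (\<lambda>\<omega>. e \<theta> k \<omega> * Y \<omega>)
      = expectation (\<lambda>\<omega>. (e \<theta> k \<omega> - e \<theta> k' \<omega>) * Y \<omega> + e \<theta> k' \<omega> * Y \<omega>)"
    by (simp add: algebra_simps)
  also have "\<dots> = expectation (\<lambda>\<omega>. (e \<theta> k \<omega> - e \<theta> k' \<omega>) * Y \<omega>) + expectation (\<lambda>\<omega>. e \<theta> k' \<omega> * Y \<omega>)"
    using d1 int' by simp
  finally have eq: "expectation (\<lambda>\<omega>. e \<theta> k \<omega> * Y \<omega>)
    = expectation (\<lambda>\<omega>. (e \<theta> k \<omega> - e \<theta> k' \<omega>) * Y \<omega>) + expectation (\<lambda>\<omega>. e \<theta> k' \<omega> * Y \<omega>)" .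
  have "norm (expectation (\<lambda>\<omega>. e \<theta> k \<omega> * Y \<omega>)) \<le> K * a r + \<bar>\<theta>\<bar> * (real r * K)"
    unfolding eq using d2 d3 norm_triangle_ineq[of "expectation (\<lambda>\<omega>. (e \<theta> k \<omega> - e \<theta> k' \<omega>) * Y \<omega>)"
      "expectation (\<lambda>\<omega>. e \<theta> k' \<omega> * Y \<omega>)"] by linarith
  then show ?thesis by (simp add: Y_def i_def)
qed

lemma norm_f_diff_le:
  assumes "m \<le> n"
  shows "norm (f \<theta> n - f \<theta> m) \<le> \<bar>\<theta>\<bar> * (real (n - m) * K)"
proof -
  let ?Z = "\<lambda>\<omega>. \<bar>\<theta>\<bar> * (\<Sum>u\<in>{m..<n}. \<bar>X (Suc u) \<omega>\<bar>)"
  have intX: "integrable M (\<lambda>\<omega>. \<bar>X (Suc u) \<omega>\<bar>)" for u using integrable_X[of "Suc u"] by simp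
  have "f \<theta> n - f \<theta> m = expectation (\<lambda>\<omega>. e \<theta> n \<omega> - e \<theta> m \<omega>)"
    using integrable_e by (simp add: f_def)
  also have "norm \<dots> \<le> expectation (\<lambda>\<omega>. norm (e \<theta> n \<omega> - e \<theta> m \<omega>))"
    by (rule integral_norm_bound)
  also have "\<dots> \<le> expectation ?Z"
    using integrable_e intX by (intro integral_mono norm_e_diff_le assms) auto
  also have "\<dots> = \<bar>\<theta>\<bar> * (\<Sum>u\<in>{m..<n}. expectation (\<lambda>\<omega>. \<bar>X (Suc u) \<omega>\<bar>))"
    using intX by (simp add: Bochner_Integration.integral_sum)
  also have "\<dots> \<le> \<bar>\<theta>\<bar> * (\<Sum>u\<in>{m..<n}. K)"
    using abs_X_power(2)[of _ 1] K_ge(5) by (intro mult_left_mono sum_mono) (auto intro: order_trans)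
  finally show ?thesis by (simp add: of_nat_diff assms)
qed

lemma summable_a: "summable (\<lambda>i. a (Suc (i + L)))"
  using summable_mixing summable_ignore_initial_segment[of "\<lambda>i. a (Suc i)" L] by (simp add: a_def)

lemma tail_nonneg: "0 \<le> tail L"
  unfolding tail_def by (intro suminf_nonneg summable_a a_nonneg)

lemma sum_a_le_tail: "(\<Sum>i\<in>{L..<m}. a (Suc i)) \<le> tail L"
proof -
  have "(\<Sum>i\<in>{L..<m}. a (Suc i)) = (\<Sum>i<m - L. a (Suc (i + L)))"
    by (rule sum.reindex_bij_witness[of _ "\<lambda>i. i + L" "\<lambda>i. i - L"]) auto
  also have "\<dots> \<le> tail L"
    unfolding tail_def by (intro sum_le_suminf summable_a) (auto simp: a_nonneg)
  finally show ?thesis .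
qed

lemma tail_LIMSEQ: "tail \<longlonglongrightarrow> 0"
  unfolding tail_def using suminf_exist_split2[OF summable_a[of 0]] by simp

lemma a_LIMSEQ: "a \<longlonglongrightarrow> 0"
  using summable_LIMSEQ_zero[OF summable_a[of 0]] by (simp add: filterlim_sequentially_Suc)

lemma summable_\<gamma>: "summable (\<lambda>k. \<gamma> (Suc k))"
  by (rule summable_comparison_test'[of "\<lambda>k. K * a (Suc k)" 0])
     (use summable_a[of 0] abs_\<gamma>_le_mixing in \<open>auto intro: summable_mult\<close>)

lemma \<gamma>_tail_le: "\<bar>(\<Sum>k. \<gamma> (Suc k)) - (\<Sum>k<L. \<gamma> (Suc k))\<bar> \<le> K * tail L"
proof -
  have "(\<Sum>k. \<gamma> (Suc k)) - (\<Sum>k<L. \<gamma> (Suc k)) = (\<Sum>k. \<gamma> (Suc (k + L)))"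
    using suminf_split_initial_segment[OF summable_\<gamma>, of L] by simp
  also have "\<bar>\<dots>\<bar> \<le> (\<Sum>k. K * a (Suc (k + L)))"
  proof -
    have s: "summable (\<lambda>k. K * a (Suc (k + L)))" by (intro summable_mult summable_a)
    have sn: "summable (\<lambda>k. \<bar>\<gamma> (Suc (k + L))\<bar>)"
      by (rule summable_comparison_test'[OF s, of 0]) (use abs_\<gamma>_le_mixing in auto)
    have "\<bar>\<Sum>k. \<gamma> (Suc (k + L))\<bar> \<le> (\<Sum>k. \<bar>\<gamma> (Suc (k + L))\<bar>)" by (rule summable_rabs[OF sn])
    also have "\<dots> \<le> (\<Sum>k. K * a (Suc (k + L)))" by (intro suminf_le sn s abs_\<gamma>_le_mixing)
    finally show ?thesis .
  qed
  also have "\<dots> = K * tail L" unfolding tail_def by (rule suminf_mult[OF summable_a])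
  finally show ?thesis .
qed

text \<open>The coefficient of |\<theta>|^3 in \<open>characteristic_increment\<close>: the first K
  is the Taylor remainder, the bracket is the \<theta>^2 error of \<open>norm_T_minus_le\<close> for
  each of the L retained lags, and the last r K comes from lag 0.\<close>

definition D :: "nat \<Rightarrow> nat \<Rightarrow> real" where
  "D L r = K + real L * (K / 2 + real r * K + real L * K\<^sup>2) + real r * K"

text \<open>The contribution of lag i + 1 to the mean of e_m * X_(m+1). For i < m the index
  \<open>Suc (m - Suc i)\<close> is m - i, written so that the difference is visibly an increment
  from k to k + 1.\<close>

definition T :: "real \<Rightarrow> nat \<Rightarrow> nat \<Rightarrow> complex" where
  "T \<theta> m i = expectation (\<lambda>\<omega>. (e \<theta> (Suc (m - Suc i)) \<omega> - e \<theta> (m - Suc i) \<omega>) * X (Suc m) \<omega>)"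

lemma integrable_e_mult_X: "integrable M (\<lambda>\<omega>. e \<theta> k \<omega> * X (Suc m) \<omega>)"
  by (rule norm_expectation_mult_le(1)[where Z = "\<lambda>\<omega>. \<bar>X (Suc m) \<omega>\<bar>"])
     (use integrable_X[of "Suc m"] X_measurable[of "Suc m"] in auto)

text \<open>Telescoping back to time 0, where the sequence is centered, is exact; no term is cut off.\<close>

lemma expectation_e_mult_X: "expectation (\<lambda>\<omega>. e \<theta> m \<omega> * X (Suc m) \<omega>) = (\<Sum>i<m. T \<theta> m i)"
proof -
  have tel: "e \<theta> m \<omega> = (\<Sum>i<m. e \<theta> (Suc (m - Suc i)) \<omega> - e \<theta> (m - Suc i) \<omega>) + 1" for \<omega>
    using sum_lessThan_telescope[of "\<lambda>k. e \<theta> k \<omega>" m]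
    by (subst sum.nat_diff_reindex[of "\<lambda>k. e \<theta> (Suc k) \<omega> - e \<theta> k \<omega>"]) simp
  have "e \<theta> m \<omega> * X (Suc m) \<omega> =
     (\<Sum>i<m. (e \<theta> (Suc (m - Suc i)) \<omega> - e \<theta> (m - Suc i) \<omega>) * X (Suc m) \<omega>) + X (Suc m) \<omega>" for \<omega>
    by (rule trans[OF arg_cong2[where f = "(*)", OF tel refl]]) (simp only: distrib_right mult_1 sum_distrib_right)
  then have "expectation (\<lambda>\<omega>. e \<theta> m \<omega> * X (Suc m) \<omega>) =
     expectation (\<lambda>\<omega>. (\<Sum>i<m. (e \<theta> (Suc (m - Suc i)) \<omega> - e \<theta> (m - Suc i) \<omega>) * X (Suc m) \<omega>) + X (Suc m) \<omega>)"
    by (rule Bochner_Integration.integral_cong[OF refl])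
  also have "\<dots> = (\<Sum>i<m. T \<theta> m i) + expectation (\<lambda>\<omega>. complex_of_real (X (Suc m) \<omega>))"
  proof -
    have int: "integrable M (\<lambda>\<omega>. (e \<theta> (Suc (m - Suc i)) \<omega> - e \<theta> (m - Suc i) \<omega>) * X (Suc m) \<omega>)" for i
      unfolding left_diff_distrib by (intro Bochner_Integration.integrable_diff integrable_e_mult_X)
    have "integrable M (\<lambda>\<omega>. complex_of_real (X (Suc m) \<omega>))" using integrable_X[of "Suc m"] by simp
    then show ?thesis
      unfolding T_def using int
      by (subst Bochner_Integration.integral_add) (auto simp: Bochner_Integration.integral_sum intro!: Bochner_Integration.integrable_sum)
  qed
  finally show ?thesis using centered[of "Suc m"] by simp
qed

text \<open>Serves the discarded lags: the bound is summable over i and independent of m.\<close>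

lemma norm_T_le:
  assumes "i < m"
  shows "norm (T \<theta> m i) \<le> \<bar>\<theta>\<bar> * (K * a (Suc i))"
  using increment_covariance[of \<theta> "m - Suc i" "Suc i"] assms by (simp add: T_def)

text \<open>Three replacements, with k = m - i - 1: the increment by its linear part \<i> \<theta>
  X_(k+1) e_k, with remainder \<theta>^2 X_(k+1)^2 / 2 controlled by third moments; the product
  X_(k+1) * X_(m+1) by its mean, through \<open>product_covariance\<close>; and f(k) by f(m), which
  is i + 1 steps away.\<close>

lemma norm_T_minus_le:
  assumes "i < m" "1 \<le> r"
  shows "norm (T \<theta> m i - \<i> * \<theta> * \<gamma> (Suc i) * f \<theta> m)
     \<le> \<bar>\<theta>\<bar> * (K * a r) + \<theta>\<^sup>2 * (K / 2 + real r * K + real (Suc i) * K\<^sup>2)"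
proof -
  define k where "k = m - Suc i"
  have km: "Suc k + Suc i = Suc m" "k \<le> m" "m - k = Suc i" using assms by (auto simp: k_def)
  note [measurable] = X_measurable[of "Suc k"] X_measurable[of "Suc m"]
  let ?x = "X (Suc k)" and ?y = "X (Suc m)"
  define U where "U \<omega> = e \<theta> (Suc k) \<omega> - e \<theta> k \<omega> - \<i> * \<theta> * ?x \<omega> * e \<theta> k \<omega>" for \<omega>
  have Um[measurable]: "U \<in> borel_measurable M" unfolding U_def by measurable
  have U_le: "norm (U \<omega>) \<le> \<theta>\<^sup>2 / 2 * (?x \<omega>)\<^sup>2" for \<omega>
  proof -
    have "U \<omega> = e \<theta> k \<omega> * (iexp (\<theta> * ?x \<omega>) - 1 - \<i> * complex_of_real (\<theta> * ?x \<omega>))"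
      unfolding U_def e_Suc by (simp add: algebra_simps)
    then have "norm (U \<omega>) = norm (iexp (\<theta> * ?x \<omega>) - 1 - \<i> * complex_of_real (\<theta> * ?x \<omega>))"
      by (simp only: norm_mult norm_e mult_1)
    also have "\<dots> \<le> (\<theta> * ?x \<omega>)\<^sup>2 / 2" by (rule norm_iexp_minus_two_terms_le)
    finally show ?thesis by (simp add: power_mult_distrib)
  qed
  let ?Z = "\<lambda>\<omega>. \<theta>\<^sup>2 / 2 * (\<bar>?x \<omega>\<bar> * \<bar>?x \<omega>\<bar> * \<bar>?y \<omega>\<bar>)"
  have intZ: "integrable M ?Z" using abs_X_mult3(1)[of "Suc k" "Suc k" "Suc m"] by simp
  have leZ: "norm (U \<omega>) * \<bar>?y \<omega>\<bar> \<le> ?Z \<omega>" for \<omega>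
    using mult_right_mono[OF U_le[of \<omega>], of "\<bar>?y \<omega>\<bar>"] by (simp add: power2_eq_square mult.assoc)
  have "expectation ?Z \<le> \<theta>\<^sup>2 / 2 * (3 * (1 + B))"
    using abs_X_mult3(2)[of "Suc k" "Suc k" "Suc m"] by (simp add: mult_left_mono)
  also have "\<dots> \<le> \<theta>\<^sup>2 / 2 * K" using K_ge(3) by (intro mult_left_mono) auto
  finally have 1: "norm (expectation (\<lambda>\<omega>. U \<omega> * ?y \<omega>)) \<le> \<theta>\<^sup>2 * (K / 2)"
    "integrable M (\<lambda>\<omega>. U \<omega> * ?y \<omega>)"
    using norm_expectation_mult_le[OF Um _ intZ leZ] by auto
  have 2: "norm (expectation (\<lambda>\<omega>. e \<theta> k \<omega> * complex_of_real (?x \<omega> * ?y \<omega> - \<gamma> (Suc i)))) \<le> K * a r + \<bar>\<theta>\<bar> * (real r * K)"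
    using product_covariance[OF assms(2), of \<theta> k "Suc i"] km(1) by (simp only: km(1))
  have intxy: "integrable M (\<lambda>\<omega>. e \<theta> k \<omega> * complex_of_real (?x \<omega> * ?y \<omega>))"
    by (rule norm_expectation_mult_le(1)[where Z = "\<lambda>\<omega>. \<bar>?x \<omega> * ?y \<omega>\<bar>"])
       (use abs_X_mult2(1)[of "Suc k" "Suc m"] in auto)
  define E2 where "E2 = expectation (\<lambda>\<omega>. e \<theta> k \<omega> * complex_of_real (?x \<omega> * ?y \<omega> - \<gamma> (Suc i)))"
  have E2: "E2 = expectation (\<lambda>\<omega>. e \<theta> k \<omega> * complex_of_real (?x \<omega> * ?y \<omega>)) - \<gamma> (Suc i) * f \<theta> k"
    using intxy integrable_e[of \<theta> k] by (simp add: E2_def right_diff_distrib f_def)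
  have "T \<theta> m i = expectation (\<lambda>\<omega>. U \<omega> * ?y \<omega> + \<i> * \<theta> * (e \<theta> k \<omega> * complex_of_real (?x \<omega> * ?y \<omega>)))"
    unfolding T_def U_def k_def [symmetric] by (simp add: algebra_simps)
  also have "\<dots> = expectation (\<lambda>\<omega>. U \<omega> * ?y \<omega>) + \<i> * \<theta> * expectation (\<lambda>\<omega>. e \<theta> k \<omega> * complex_of_real (?x \<omega> * ?y \<omega>))"
    using 1 intxy by (subst Bochner_Integration.integral_add) auto
  finally have Teq: "T \<theta> m i - \<i> * \<theta> * \<gamma> (Suc i) * f \<theta> m =
    expectation (\<lambda>\<omega>. U \<omega> * ?y \<omega>) + \<i> * \<theta> * E2 - \<i> * \<theta> * \<gamma> (Suc i) * (f \<theta> m - f \<theta> k)"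
    by (simp add: E2 algebra_simps)
  have 3: "norm (\<i> * \<theta> * \<gamma> (Suc i) * (f \<theta> m - f \<theta> k)) \<le> \<bar>\<theta>\<bar> * K * (\<bar>\<theta>\<bar> * (real (Suc i) * K))"
    using norm_f_diff_le[OF km(2), of \<theta>] abs_\<gamma>_le[of "Suc i"] K_ge(4) K_ge(6) unfolding km(3)
    by (auto simp: norm_mult intro!: mult_mono)
  have 4: "norm (\<i> * \<theta> * E2) \<le> \<bar>\<theta>\<bar> * (K * a r + \<bar>\<theta>\<bar> * (real r * K))"
    using 2 by (simp add: norm_mult E2_def mult_left_mono)
  have "norm (T \<theta> m i - \<i> * \<theta> * \<gamma> (Suc i) * f \<theta> m)
     \<le> norm (expectation (\<lambda>\<omega>. U \<omega> * ?y \<omega>)) + norm (\<i> * \<theta> * E2) + norm (\<i> * \<theta> * \<gamma> (Suc i) * (f \<theta> m - f \<theta> k))"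
    unfolding Teq by (intro order_trans[OF norm_triangle_ineq4] order_trans[OF norm_triangle_ineq] add_mono order_refl)
  also have "\<dots> \<le> \<theta>\<^sup>2 * (K / 2) + \<bar>\<theta>\<bar> * (K * a r + \<bar>\<theta>\<bar> * (real r * K)) + \<bar>\<theta>\<bar> * K * (\<bar>\<theta>\<bar> * (real (Suc i) * K))"
    by (intro add_mono 1 3 4)
  also have "\<dots> = \<bar>\<theta>\<bar> * (K * a r) + \<bar>\<theta>\<bar>\<^sup>2 * (K / 2 + real r * K + real (Suc i) * K\<^sup>2)"
    by (simp add: algebra_simps power2_eq_square)
  finally show ?thesis by simp
qed

text \<open>The last factor of the exponential is expanded with a cubic remainder. The telescoped
  linear term gives - \<theta>^2 f times the first L covariances, the quadratic term - \<theta>^2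
  \<gamma>(0) f / 2; together they are - \<theta>^2 \<sigma>2 f / 2 up to the tail of the series.
  For \<theta>^2 of order 1 / n the cubic errors of n steps sum to order n^(-1/2), while the others
  stay bounded and are made small by the choice of L and r.\<close>

lemma characteristic_increment:
  assumes "L \<le> m" "1 \<le> r"
  shows "norm (f \<theta> (Suc m) - complex_of_real (1 - \<theta>\<^sup>2 * \<sigma>2 / 2) * f \<theta> m)
    \<le> \<bar>\<theta>\<bar> ^ 3 * D L r + \<theta>\<^sup>2 * (K * (real (Suc L) * a r + 2 * tail L))"
proof -
  note [measurable] = X_measurable[of "Suc m"]
  let ?x = "X (Suc m)"
  define G where "G = (\<Sum>k. \<gamma> (Suc k))"
  define GL where "GL = (\<Sum>k<L. \<gamma> (Suc k))"
  define A where "A = expectation (\<lambda>\<omega>. e \<theta> m \<omega> * ?x \<omega>)"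
  define b where "b = expectation (\<lambda>\<omega>. e \<theta> m \<omega> * complex_of_real (?x \<omega> * X (Suc m + 0) \<omega> - \<gamma> 0))"
  define R where "R = expectation (\<lambda>\<omega>. e \<theta> m \<omega> * (iexp (\<theta> * ?x \<omega>) - 1 - \<i> * complex_of_real (\<theta> * ?x \<omega>) + (complex_of_real (\<theta> * ?x \<omega>))\<^sup>2 / 2))"
  define t where "t i = T \<theta> m i - \<i> * \<theta> * \<gamma> (Suc i) * f \<theta> m" for i
  define t' where "t' = (\<Sum>i\<in>{L..<m}. T \<theta> m i)"
  have intx2: "integrable M (\<lambda>\<omega>. e \<theta> m \<omega> * complex_of_real (?x \<omega> * ?x \<omega>))"
    by (rule norm_expectation_mult_le(1)[where Z = "\<lambda>\<omega>. \<bar>?x \<omega> * ?x \<omega>\<bar>"])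
       (use abs_X_mult2(1)[of "Suc m" "Suc m"] in auto)
  have b: "norm b \<le> K * a r + \<bar>\<theta>\<bar> * (real r * K)"
    unfolding b_def by (rule product_covariance[OF assms(2)])
  have b_eq: "b = expectation (\<lambda>\<omega>. e \<theta> m \<omega> * complex_of_real (?x \<omega> * ?x \<omega>)) - \<gamma> 0 * f \<theta> m"
    using intx2 integrable_e[of \<theta> m] by (simp add: b_def right_diff_distrib f_def)
  have x3: "integrable M (\<lambda>\<omega>. \<bar>?x \<omega>\<bar> ^ 3)" "expectation (\<lambda>\<omega>. \<bar>?x \<omega>\<bar> ^ 3) \<le> 1 + B"
    by (rule abs_X_power; simp)+
  have R: "norm R \<le> \<bar>\<theta>\<bar> ^ 3 * K"
  proof -
    let ?I = "\<lambda>\<omega>. e \<theta> m \<omega> * (iexp (\<theta> * ?x \<omega>) - 1 - \<i> * complex_of_real (\<theta> * ?x \<omega>) + (complex_of_real (\<theta> * ?x \<omega>))\<^sup>2 / 2)"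
    have le: "norm (?I \<omega>) \<le> \<bar>\<theta>\<bar> ^ 3 / 6 * \<bar>?x \<omega>\<bar> ^ 3" for \<omega>
    proof -
      have "norm (?I \<omega>) = norm (iexp (\<theta> * ?x \<omega>) - 1 - \<i> * complex_of_real (\<theta> * ?x \<omega>) + (complex_of_real (\<theta> * ?x \<omega>))\<^sup>2 / 2)"
        by (simp only: norm_mult norm_e mult_1)
      also have "\<dots> \<le> \<bar>\<theta> * ?x \<omega>\<bar> ^ 3 / 6"
        using norm_iexp_minus_three_terms_le[of "\<theta> * ?x \<omega>"] by simp
      finally show ?thesis by (simp add: abs_mult power_mult_distrib)
    qed
    have int: "integrable M (\<lambda>\<omega>. \<bar>\<theta>\<bar> ^ 3 / 6 * \<bar>?x \<omega>\<bar> ^ 3)" using x3 by simp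
    have intI: "integrable M ?I"
      by (rule Bochner_Integration.integrable_bound[OF int]) (use le in \<open>auto intro!: AE_I2 intro: order_trans[OF _ abs_ge_self]\<close>)
    have "norm R \<le> expectation (\<lambda>\<omega>. norm (?I \<omega>))" unfolding R_def by (rule integral_norm_bound)
    also have "\<dots> \<le> expectation (\<lambda>\<omega>. \<bar>\<theta>\<bar> ^ 3 / 6 * \<bar>?x \<omega>\<bar> ^ 3)"
      by (rule integral_mono[OF integrable_norm[OF intI] int le])
    also have "\<dots> = \<bar>\<theta>\<bar> ^ 3 / 6 * expectation (\<lambda>\<omega>. \<bar>?x \<omega>\<bar> ^ 3)" by simp
    also have "\<dots> \<le> \<bar>\<theta>\<bar> ^ 3 / 6 * (6 * K)"
      using x3(2) K_ge(5) K_ge(6) by (intro mult_left_mono) auto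
    finally show ?thesis by simp
  qed
  have f_Suc: "f \<theta> (Suc m) = R + f \<theta> m + \<i> * \<theta> * A - \<theta>\<^sup>2 / 2 * expectation (\<lambda>\<omega>. e \<theta> m \<omega> * complex_of_real (?x \<omega> * ?x \<omega>))"
  proof -
    have lin: "expectation (\<lambda>\<omega>. p \<omega> - p' \<omega> - c * r \<omega> + d * s \<omega>)
        = expectation p - expectation p' - c * expectation r + d * expectation s"
      if "integrable M p" "integrable M p'" "integrable M r" "integrable M s"
      for p p' r s :: "'a \<Rightarrow> complex" and c d using that by simp
    have "R = expectation (\<lambda>\<omega>. e \<theta> (Suc m) \<omega> - e \<theta> m \<omega> - \<i> * \<theta> * (e \<theta> m \<omega> * ?x \<omega>) + \<theta>\<^sup>2 / 2 * (e \<theta> m \<omega> * complex_of_real (?x \<omega> * ?x \<omega>)))"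
      unfolding R_def e_Suc by (simp add: algebra_simps power2_eq_square)
    also have "\<dots> = f \<theta> (Suc m) - f \<theta> m - \<i> * \<theta> * A + \<theta>\<^sup>2 / 2 * expectation (\<lambda>\<omega>. e \<theta> m \<omega> * complex_of_real (?x \<omega> * ?x \<omega>))"
      unfolding A_def f_def by (intro lin integrable_e integrable_e_mult_X intx2)
    finally show ?thesis by simp
  qed
  have A_eq: "A = \<i> * \<theta> * GL * f \<theta> m + (\<Sum>i<L. t i) + t'"
  proof -
    have "A = (\<Sum>i<L. T \<theta> m i) + t'"
      unfolding A_def expectation_e_mult_X t'_def using sum.atLeastLessThan_concat[of 0 L m "T \<theta> m"] assms
      by (simp add: lessThan_atLeast0)
    also have "(\<Sum>i<L. T \<theta> m i) = (\<Sum>i<L. \<i> * \<theta> * \<gamma> (Suc i) * f \<theta> m + t i)"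
      by (simp add: t_def)
    also have "\<dots> = \<i> * \<theta> * GL * f \<theta> m + (\<Sum>i<L. t i)"
      by (simp add: sum.distrib GL_def sum_distrib_left sum_distrib_right mult.assoc)
    finally show ?thesis .
  qed
  have t: "norm (\<Sum>i<L. t i) \<le> real L * (\<bar>\<theta>\<bar> * (K * a r) + \<theta>\<^sup>2 * (K / 2 + real r * K + real L * K\<^sup>2))"
  proof -
    have "norm (\<Sum>i<L. t i) \<le> (\<Sum>i<L. \<bar>\<theta>\<bar> * (K * a r) + \<theta>\<^sup>2 * (K / 2 + real r * K + real L * K\<^sup>2))"
    proof (rule sum_norm_le)
      fix i assume i: "i \<in> {..<L}"
      have "norm (t i) \<le> \<bar>\<theta>\<bar> * (K * a r) + \<theta>\<^sup>2 * (K / 2 + real r * K + real (Suc i) * K\<^sup>2)"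
        unfolding t_def by (rule norm_T_minus_le) (use i assms in auto)
      also have "\<dots> \<le> \<bar>\<theta>\<bar> * (K * a r) + \<theta>\<^sup>2 * (K / 2 + real r * K + real L * K\<^sup>2)"
        using i by (intro add_mono mult_left_mono mult_right_mono order_refl) auto
      finally show "norm (t i) \<le> \<bar>\<theta>\<bar> * (K * a r) + \<theta>\<^sup>2 * (K / 2 + real r * K + real L * K\<^sup>2)" .
    qed
    then show ?thesis by simp
  qed
  have t': "norm t' \<le> \<bar>\<theta>\<bar> * (K * tail L)"
  proof -
    have "norm t' \<le> (\<Sum>i\<in>{L..<m}. \<bar>\<theta>\<bar> * (K * a (Suc i)))"
      unfolding t'_def by (rule sum_norm_le) (auto intro: norm_T_le)
    also have "\<dots> = \<bar>\<theta>\<bar> * (K * (\<Sum>i\<in>{L..<m}. a (Suc i)))" by (simp add: sum_distrib_left)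
    also have "\<dots> \<le> \<bar>\<theta>\<bar> * (K * tail L)"
      using sum_a_le_tail K_ge(6) by (intro mult_left_mono) auto
    finally show ?thesis .
  qed
  \<comment> \<open>\<open>\<sigma>2\<close> contains the full series \<open>G\<close>, the retained
    lags only its part \<open>GL\<close>; the last summand is the difference. It and
    \<open>t'\<close> each contribute one \<open>tail L\<close> to the bound.\<close>
  have eq: "f \<theta> (Suc m) - complex_of_real (1 - \<theta>\<^sup>2 * \<sigma>2 / 2) * f \<theta> m
     = R + \<i> * \<theta> * (\<Sum>i<L. t i) + \<i> * \<theta> * t' - \<theta>\<^sup>2 / 2 * b + \<theta>\<^sup>2 * (G - GL) * f \<theta> m"
  proof -
    have b_eq': "expectation (\<lambda>\<omega>. e \<theta> m \<omega> * complex_of_real (?x \<omega> * ?x \<omega>)) = b + \<gamma> 0 * f \<theta> m"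
      using b_eq by simp
    show ?thesis
      unfolding f_Suc A_eq b_eq' \<sigma>2_def G_def [symmetric]
      by (simp add: algebra_simps power2_eq_square)
  qed
  have n1: "norm (\<i> * \<theta> * (\<Sum>i<L. t i)) \<le> \<bar>\<theta>\<bar> * (real L * (\<bar>\<theta>\<bar> * (K * a r) + \<theta>\<^sup>2 * (K / 2 + real r * K + real L * K\<^sup>2)))"
    using t by (simp add: norm_mult mult_left_mono)
  have n2: "norm (\<i> * \<theta> * t') \<le> \<bar>\<theta>\<bar> * (\<bar>\<theta>\<bar> * (K * tail L))"
    using t' by (simp add: norm_mult mult_left_mono)
  have n3: "norm (\<theta>\<^sup>2 / 2 * b) \<le> \<theta>\<^sup>2 * (K * a r + \<bar>\<theta>\<bar> * (real r * K))"
  proof -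
    have "norm (\<theta>\<^sup>2 / 2 * b) = \<theta>\<^sup>2 / 2 * norm b" by (simp add: norm_mult norm_divide norm_power)
    also have "\<dots> \<le> \<theta>\<^sup>2 * (K * a r + \<bar>\<theta>\<bar> * (real r * K))"
      using b by (intro mult_mono) auto
    finally show ?thesis .
  qed
  have n4: "norm (\<theta>\<^sup>2 * (G - GL) * f \<theta> m) \<le> \<theta>\<^sup>2 * (K * tail L)"
  proof -
    have "norm (\<theta>\<^sup>2 * (G - GL) * f \<theta> m) = \<theta>\<^sup>2 * (\<bar>G - GL\<bar> * norm (f \<theta> m))"
      by (simp add: norm_mult norm_power flip: of_real_diff)
    also have "\<dots> \<le> \<theta>\<^sup>2 * (K * tail L * 1)"
      using \<gamma>_tail_le[of L] norm_f_le_1[of \<theta> m] K_ge(6) tail_nonneg[of L]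
      by (intro mult_left_mono mult_mono) (auto simp: G_def GL_def)
    finally show ?thesis by simp
  qed
  have "norm (f \<theta> (Suc m) - complex_of_real (1 - \<theta>\<^sup>2 * \<sigma>2 / 2) * f \<theta> m)
    \<le> norm R + norm (\<i> * \<theta> * (\<Sum>i<L. t i)) + norm (\<i> * \<theta> * t') + norm (\<theta>\<^sup>2 / 2 * b) + norm (\<theta>\<^sup>2 * (G - GL) * f \<theta> m)"
    unfolding eq by (intro norm_triangle_le order_trans[OF norm_triangle_ineq4] add_mono order_refl)
  also have "\<dots> \<le> \<bar>\<theta>\<bar> ^ 3 * K + \<bar>\<theta>\<bar> * (real L * (\<bar>\<theta>\<bar> * (K * a r) + \<theta>\<^sup>2 * (K / 2 + real r * K + real L * K\<^sup>2)))
     + \<bar>\<theta>\<bar> * (\<bar>\<theta>\<bar> * (K * tail L)) + \<theta>\<^sup>2 * (K * a r + \<bar>\<theta>\<bar> * (real r * K)) + \<theta>\<^sup>2 * (K * tail L)"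
    by (intro add_mono R n1 n2 n3 n4)
  also have "\<dots> = \<bar>\<theta>\<bar> ^ 3 * D L r + \<bar>\<theta>\<bar>\<^sup>2 * (K * (real (Suc L) * a r + 2 * tail L))"
  proof -
    define u where "u = \<bar>\<theta>\<bar>"
    have "\<theta>\<^sup>2 = u\<^sup>2" by (simp add: u_def)
    then show ?thesis
      unfolding D_def u_def [symmetric] by (simp add: algebra_simps power2_eq_square power3_eq_cube)
  qed
  finally show ?thesis by simp
qed

text \<open>For the indices m < L, which do not have L lags behind them. There are only L such
  steps, so order |\<theta>| is enough.\<close>

lemma characteristic_increment_crude:
  "norm (f \<theta> (Suc m) - complex_of_real (1 - \<theta>\<^sup>2 * \<sigma>2 / 2) * f \<theta> m) \<le> \<bar>\<theta>\<bar> * K + \<theta>\<^sup>2 * \<bar>\<sigma>2\<bar> / 2"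
proof -
  have "f \<theta> (Suc m) - complex_of_real (1 - \<theta>\<^sup>2 * \<sigma>2 / 2) * f \<theta> m
     = (f \<theta> (Suc m) - f \<theta> m) + complex_of_real (\<theta>\<^sup>2 * \<sigma>2 / 2) * f \<theta> m"
    by (simp add: algebra_simps)
  also have "norm \<dots> \<le> \<bar>\<theta>\<bar> * K + (\<theta>\<^sup>2 * \<bar>\<sigma>2\<bar> / 2) * 1"
  proof (intro norm_triangle_mono)
    show "norm (f \<theta> (Suc m) - f \<theta> m) \<le> \<bar>\<theta>\<bar> * K" using norm_f_diff_le[of m "Suc m" \<theta>] by simp
    show "norm (complex_of_real (\<theta>\<^sup>2 * \<sigma>2 / 2) * f \<theta> m) \<le> (\<theta>\<^sup>2 * \<bar>\<sigma>2\<bar> / 2) * 1"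
      unfolding norm_mult norm_of_real using norm_f_le_1
      by (intro mult_mono) (auto simp: abs_mult)
  qed
  finally show ?thesis by simp
qed

section \<open>Limit of the characteristic functions\<close>

lemma f_0: "f \<theta> 0 = 1"
proof -
  have "e \<theta> 0 = (\<lambda>_. 1)" by (rule ext) simp
  then show ?thesis by (simp add: f_def prob_space)
qed

text \<open>The order of choices is essential: L makes the tail small, then r makes (L + 1) a(r)
  small, and only then n grows. After n steps the factors |\<theta>|^3 and \<theta>^2 have become
  |t|^3 / sqrt n and t^2, so the second part of the error must be small for L and r alone.\<close>

lemma characteristic_function_limit:
  assumes "\<sigma>2 > 0"
  shows "(\<lambda>n. f (t / sqrt (real n)) n) \<longlonglongrightarrow> complex_of_real (exp (- (t\<^sup>2 * \<sigma>2 / 2)))"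
proof -
  let ?\<theta> = "\<lambda>n. t / sqrt (real n)"
  let ?c = "\<lambda>n. complex_of_real (1 - (?\<theta> n)\<^sup>2 * \<sigma>2 / 2)"
  have sq: "(?\<theta> n)\<^sup>2 = t\<^sup>2 / real n" for n by (simp add: power_divide)
  have diff: "(\<lambda>n. f (?\<theta> n) n - ?c n ^ n) \<longlonglongrightarrow> 0"
  proof (rule LIMSEQ_I)
    fix \<epsilon> :: real assume \<epsilon>: "\<epsilon> > 0"
    have "(\<lambda>L. t\<^sup>2 * K * 2 * tail L) \<longlonglongrightarrow> t\<^sup>2 * K * 2 * 0"
      by (intro tendsto_intros tail_LIMSEQ)
    then have "eventually (\<lambda>L. t\<^sup>2 * K * 2 * tail L < \<epsilon> / 2) sequentially"
      by (rule order_tendstoD) (use \<epsilon> in simp)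
    then obtain L where L: "t\<^sup>2 * K * 2 * tail L < \<epsilon> / 2"
      by (auto simp: eventually_sequentially)
    have "(\<lambda>r. t\<^sup>2 * K * real (Suc L) * a r) \<longlonglongrightarrow> t\<^sup>2 * K * real (Suc L) * 0"
      by (intro tendsto_intros a_LIMSEQ)
    then have "eventually (\<lambda>r. t\<^sup>2 * K * real (Suc L) * a r < \<epsilon> / 2) sequentially"
      by (rule order_tendstoD) (use \<epsilon> in simp)
    then obtain r0 where "\<And>r. r \<ge> r0 \<Longrightarrow> t\<^sup>2 * K * real (Suc L) * a r < \<epsilon> / 2"
      by (auto simp: eventually_sequentially)
    then obtain r where r: "1 \<le> r" "t\<^sup>2 * K * real (Suc L) * a r < \<epsilon> / 2"
      by (meson max.cobounded1 max.cobounded2)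
    \<comment> \<open>The part of the accumulated error that does not vanish as n grows, because n
      \<theta>^2 = t^2.\<close>
    define E where "E = t\<^sup>2 * (K * (real (Suc L) * a r + 2 * tail L))"
    have E: "E < \<epsilon>" using L r by (simp add: E_def algebra_simps)
    define b where "b n = real L * (\<bar>?\<theta> n\<bar> * K + (?\<theta> n)\<^sup>2 * \<bar>\<sigma>2\<bar> / 2) + \<bar>t\<bar> ^ 3 * D L r / sqrt (real n) + E" for n
    have "(\<lambda>n. ?\<theta> n) \<longlonglongrightarrow> 0" by real_asymp
    then have "b \<longlonglongrightarrow> real L * (\<bar>0\<bar> * K + 0\<^sup>2 * \<bar>\<sigma>2\<bar> / 2) + 0 + E"
      unfolding b_def by (intro tendsto_intros) (real_asymp | simp)+
    then have "eventually (\<lambda>n. b n < \<epsilon>) sequentially"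
      by (rule order_tendstoD) (use E in simp)
    \<comment> \<open>Together with \<sigma>2 > 0 this keeps 1 - t^2 \<sigma>2 / (2 n) in [-1, 1],
      as \<open>norm_recursion_le\<close> requires of its factor.\<close>
    moreover have "eventually (\<lambda>n. t\<^sup>2 * \<sigma>2 / 2 / real n < 2) sequentially"
      by (rule order_tendstoD(2)[OF lim_const_over_n]) simp
    moreover have "eventually (\<lambda>n. n > 0) sequentially" by (rule eventually_gt_at_top)
    ultimately have "eventually (\<lambda>n. norm (f (?\<theta> n) n - ?c n ^ n) < \<epsilon>) sequentially"
    proof eventually_elim
      case (elim n)
      have c: "norm (?c n) \<le> 1"
      proof -
        have "0 \<le> (?\<theta> n)\<^sup>2 * \<sigma>2 / 2" "(?\<theta> n)\<^sup>2 * \<sigma>2 / 2 \<le> 2"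
          using elim assms by (simp_all add: sq)
        then show ?thesis unfolding norm_of_real by linarith
      qed
      have "D L r \<ge> 0" unfolding D_def using K_ge(6) by (intro add_nonneg_nonneg mult_nonneg_nonneg) auto
      then have e1: "0 \<le> \<bar>?\<theta> n\<bar> ^ 3 * D L r + (?\<theta> n)\<^sup>2 * (K * (real (Suc L) * a r + 2 * tail L))"
        using K_ge(6) a_nonneg tail_nonneg by (intro add_nonneg_nonneg mult_nonneg_nonneg) auto
      have "norm (f (?\<theta> n) n - ?c n ^ n) \<le> real L * (\<bar>?\<theta> n\<bar> * K + (?\<theta> n)\<^sup>2 * \<bar>\<sigma>2\<bar> / 2)
           + real n * (\<bar>?\<theta> n\<bar> ^ 3 * D L r + (?\<theta> n)\<^sup>2 * (K * (real (Suc L) * a r + 2 * tail L)))"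
      proof (rule norm_recursion_le[where f = "f (?\<theta> n)", OF _ c _ e1])
        show "f (?\<theta> n) 0 = 1" by (rule f_0)
        show "0 \<le> \<bar>?\<theta> n\<bar> * K + (?\<theta> n)\<^sup>2 * \<bar>\<sigma>2\<bar> / 2" using K_ge(6) by simp
      qed (rule characteristic_increment_crude characteristic_increment[OF _ r(1)]; assumption)+
      also have "\<dots> = b n"
      proof -
        have "real n * \<bar>?\<theta> n\<bar> ^ 3 = \<bar>t\<bar> ^ 3 / sqrt (real n)"
          using elim by (simp add: power_divide abs_divide power3_eq_cube field_simps)
        moreover have "real n * (?\<theta> n)\<^sup>2 = t\<^sup>2" using elim by (simp add: sq)
        ultimately show ?thesis
          unfolding b_def E_def distrib_left mult.assoc [symmetric] by simp
      qed
      finally show ?case using elim by simp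
    qed
    then show "\<exists>no. \<forall>n\<ge>no. norm (f (?\<theta> n) n - ?c n ^ n - 0) < \<epsilon>"
      by (simp add: eventually_sequentially)
  qed
  have "(\<lambda>n. (1 + (- (t\<^sup>2 * \<sigma>2 / 2)) / real n) ^ n) \<longlonglongrightarrow> exp (- (t\<^sup>2 * \<sigma>2 / 2))"
    by (rule tendsto_exp_limit_sequentially)
  then have "(\<lambda>n. complex_of_real ((1 + (- (t\<^sup>2 * \<sigma>2 / 2)) / real n) ^ n)) \<longlonglongrightarrow> complex_of_real (exp (- (t\<^sup>2 * \<sigma>2 / 2)))"
    by (rule tendsto_of_real)
  moreover have "1 - (?\<theta> n)\<^sup>2 * \<sigma>2 / 2 = 1 + (- (t\<^sup>2 * \<sigma>2 / 2)) / real n" for n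
    by (simp add: sq)
  ultimately have "(\<lambda>n. ?c n ^ n) \<longlonglongrightarrow> complex_of_real (exp (- (t\<^sup>2 * \<sigma>2 / 2)))"
    by (simp only: of_real_power)
  from tendsto_add[OF diff this] show ?thesis by simp
qed

theorem central_limit:
  assumes "\<sigma>2 > 0"
  shows "weak_conv_m (\<lambda>n. distr M borel (\<lambda>\<omega>. S n \<omega> / (sqrt \<sigma>2 * sqrt (real n)))) std_normal_distribution"
proof (rule levy_continuity)
  have S[measurable]: "S n \<in> borel_measurable M" for n
    unfolding S_def using X_measurable by (intro borel_measurable_sum) auto
  show "real_distribution (distr M borel (\<lambda>\<omega>. S n \<omega> / (sqrt \<sigma>2 * sqrt (real n))))" for n
    by (intro real_distribution_distr) measurable
  show "real_distribution std_normal_distribution" by (rule real_dist_normal_dist)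
  fix t :: real
  have "char (distr M borel (\<lambda>\<omega>. S n \<omega> / (sqrt \<sigma>2 * sqrt (real n)))) t = f ((t / sqrt \<sigma>2) / sqrt (real n)) n" for n
    unfolding char_def f_def e_def by (subst integral_distr) (auto simp: field_simps)
  moreover have "(\<lambda>n. f ((t / sqrt \<sigma>2) / sqrt (real n)) n) \<longlonglongrightarrow> complex_of_real (exp (- ((t / sqrt \<sigma>2)\<^sup>2 * \<sigma>2 / 2)))"
    by (rule characteristic_function_limit[OF assms])
  moreover have "complex_of_real (exp (- ((t / sqrt \<sigma>2)\<^sup>2 * \<sigma>2 / 2))) = char std_normal_distribution t"
    using assms by (simp add: char_std_normal_distribution power_divide)
  ultimately show "(\<lambda>n. char (distr M borel (\<lambda>\<omega>. S n \<omega> / (sqrt \<sigma>2 * sqrt (real n)))) t) \<longlonglongrightarrow> char std_normal_distribution t"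
    by simp
qed

end

section \<open>Normal samples and the chi-square law\<close>

abbreviation (input) \<N> :: "real measure" where "\<N> \<equiv> std_normal_distribution"

lemma prob_space_std_normal: "prob_space \<N>"
  by (rule prob_space_normal_density) simp

lemma sigma_finite_std_normal: "sigma_finite_measure \<N>"
  using prob_space_std_normal by (rule prob_space_imp_sigma_finite)

lemma nn_integral_std_normal:
  assumes "f \<in> borel_measurable borel"
  shows "(\<integral>\<^sup>+ x. f x \<partial>\<N>) = (\<integral>\<^sup>+ x. ennreal (std_normal_density x) * f x \<partial>lborel)"
  using assms by (intro nn_integral_density) auto

lemma nn_integral_swap:
  assumes "sigma_finite_measure A" "sigma_finite_measure B"
    and "(\<lambda>(x, y). f x y) \<in> borel_measurable (A \<Otimes>\<^sub>M B)"
  shows "(\<integral>\<^sup>+ y. \<integral>\<^sup>+ x. f x y \<partial>A \<partial>B) = (\<integral>\<^sup>+ x. \<integral>\<^sup>+ y. f x y \<partial>B \<partial>A)"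
proof -
  interpret pair_sigma_finite A B using assms by (simp add: pair_sigma_finite_def)
  show ?thesis by (rule Fubini'[OF assms(3)])
qed

text \<open>The rotation is factored into two shears, so that only one-dimensional affine substitutions
  and Tonelli's theorem are needed.\<close>

lemma nn_integral_rotate:
  fixes g :: "real \<times> real \<Rightarrow> ennreal"
  assumes [measurable]: "g \<in> borel_measurable borel" and cs: "c\<^sup>2 + s\<^sup>2 = 1" "c \<noteq> 0"
  shows "(\<integral>\<^sup>+ x. \<integral>\<^sup>+ y. g (c * x + s * y, - s * x + c * y) \<partial>lborel \<partial>lborel)
       = (\<integral>\<^sup>+ x. \<integral>\<^sup>+ y. g (x, y) \<partial>lborel \<partial>lborel)"
proof -
  note [simp] = lborel.sigma_finite_measure_axioms
  have "(\<integral>\<^sup>+ x. \<integral>\<^sup>+ y. g (c * x + s * y, - s * x + c * y) \<partial>lborel \<partial>lborel)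
      = (\<integral>\<^sup>+ y. \<integral>\<^sup>+ x. g (c * x + s * y, - s * x + c * y) \<partial>lborel \<partial>lborel)"
    by (rule nn_integral_swap[symmetric]) simp_all
  \<comment> \<open>For fixed y, the substitution u = c x + s y turns - s x + c y into (y - s u) /
    c, because c^2 + s^2 = 1. Its factor 1 / |c| is cancelled by the later substitution in y at
    fixed u.\<close>
  also have "\<dots> = (\<integral>\<^sup>+ y. ennreal (1 / \<bar>c\<bar>) * (\<integral>\<^sup>+ u. g (u, (y - s * u) / c) \<partial>lborel) \<partial>lborel)"
  proof (rule nn_integral_cong)
    fix y :: real
    have "(y - s * (s * y + c * x)) / c = - s * x + c * y" for x
    proof -
      have "y - s * (s * y + c * x) = (c\<^sup>2 + s\<^sup>2) * y - s * (s * y + c * x)" using cs by simp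
      also have "\<dots> = c * (- s * x + c * y)" by (simp add: algebra_simps power2_eq_square)
      finally show ?thesis using cs by simp
    qed
    then have "(\<integral>\<^sup>+ u. g (u, (y - s * u) / c) \<partial>lborel)
        = ennreal \<bar>c\<bar> * (\<integral>\<^sup>+ x. g (c * x + s * y, - s * x + c * y) \<partial>lborel)"
      using cs by (subst nn_integral_real_affine[of _ c "s * y"]) (simp_all add: add.commute)
    then show "(\<integral>\<^sup>+ x. g (c * x + s * y, - s * x + c * y) \<partial>lborel)
        = ennreal (1 / \<bar>c\<bar>) * (\<integral>\<^sup>+ u. g (u, (y - s * u) / c) \<partial>lborel)"
      using cs by (simp add: mult.assoc [symmetric] ennreal_mult [symmetric])
  qed
  also have "\<dots> = ennreal (1 / \<bar>c\<bar>) * (\<integral>\<^sup>+ y. \<integral>\<^sup>+ u. g (u, (y - s * u) / c) \<partial>lborel \<partial>lborel)"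
    by (rule nn_integral_cmult) measurable
  also have "(\<integral>\<^sup>+ y. \<integral>\<^sup>+ u. g (u, (y - s * u) / c) \<partial>lborel \<partial>lborel)
      = (\<integral>\<^sup>+ u. \<integral>\<^sup>+ y. g (u, (y - s * u) / c) \<partial>lborel \<partial>lborel)"
    by (rule nn_integral_swap) simp_all
  also have "\<dots> = (\<integral>\<^sup>+ u. ennreal \<bar>c\<bar> * (\<integral>\<^sup>+ v. g (u, v) \<partial>lborel) \<partial>lborel)"
  proof (rule nn_integral_cong)
    fix u :: real
    show "(\<integral>\<^sup>+ y. g (u, (y - s * u) / c) \<partial>lborel) = ennreal \<bar>c\<bar> * (\<integral>\<^sup>+ v. g (u, v) \<partial>lborel)"
      using cs by (subst nn_integral_real_affine[of "\<lambda>y. g (u, (y - s * u) / c)" c "s * u"]) simp_all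
  qed
  also have "\<dots> = ennreal \<bar>c\<bar> * (\<integral>\<^sup>+ u. \<integral>\<^sup>+ v. g (u, v) \<partial>lborel \<partial>lborel)"
    by (rule nn_integral_cmult) measurable
  finally show ?thesis
    using cs by (simp add: mult.assoc [symmetric] ennreal_mult [symmetric])
qed

lemma std_normal_density_rotate:
  assumes "c\<^sup>2 + s\<^sup>2 = 1"
  shows "std_normal_density (c * x + s * y) * std_normal_density (- s * x + c * y)
       = std_normal_density x * std_normal_density y"
proof -
  have "(c * x + s * y)\<^sup>2 + (- s * x + c * y)\<^sup>2 = (c\<^sup>2 + s\<^sup>2) * (x\<^sup>2 + y\<^sup>2)"
    by (simp add: power2_eq_square algebra_simps)
  then have "- (c * x + s * y)\<^sup>2 / 2 + - (- s * x + c * y)\<^sup>2 / 2 = - x\<^sup>2 / 2 + - y\<^sup>2 / 2"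
    using assms by simp
  then have "exp (- (c * x + s * y)\<^sup>2 / 2) * exp (- (- s * x + c * y)\<^sup>2 / 2) = exp (- x\<^sup>2 / 2) * exp (- y\<^sup>2 / 2)"
    by (metis exp_add)
  then show ?thesis by (simp add: std_normal_density_def field_simps)
qed

lemma std_normal_rotate:
  fixes f :: "real \<Rightarrow> real \<Rightarrow> ennreal"
  assumes [measurable]: "(\<lambda>(x, y). f x y) \<in> borel_measurable (borel \<Otimes>\<^sub>M borel)" and cs: "c\<^sup>2 + s\<^sup>2 = 1" "c \<noteq> 0"
  shows "(\<integral>\<^sup>+ x. \<integral>\<^sup>+ y. f (c * x + s * y) (- s * x + c * y) \<partial>\<N> \<partial>\<N>) = (\<integral>\<^sup>+ x. \<integral>\<^sup>+ y. f x y \<partial>\<N> \<partial>\<N>)"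
proof -
  have double: "(\<integral>\<^sup>+ x. \<integral>\<^sup>+ y. h x y \<partial>\<N> \<partial>\<N>)
      = (\<integral>\<^sup>+ x. \<integral>\<^sup>+ y. ennreal (std_normal_density x * std_normal_density y) * h x y \<partial>lborel \<partial>lborel)"
    if [measurable]: "(\<lambda>(x, y). h x y) \<in> borel_measurable (borel \<Otimes>\<^sub>M borel)" for h :: "real \<Rightarrow> real \<Rightarrow> ennreal"
    by (simp add: nn_integral_density nn_integral_cmult [symmetric] ennreal_mult mult.assoc)
  define g where "g p = ennreal (std_normal_density (fst p) * std_normal_density (snd p)) * f (fst p) (snd p)"
    for p :: "real \<times> real"
  have "g \<in> borel_measurable (borel \<Otimes>\<^sub>M borel)" unfolding g_def by measurable
  then have [measurable]: "g \<in> borel_measurable borel" by (simp only: borel_prod)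
  have "(\<integral>\<^sup>+ x. \<integral>\<^sup>+ y. f (c * x + s * y) (- s * x + c * y) \<partial>\<N> \<partial>\<N>)
      = (\<integral>\<^sup>+ x. \<integral>\<^sup>+ y. g (c * x + s * y, - s * x + c * y) \<partial>lborel \<partial>lborel)"
    by (subst double) (simp_all add: g_def std_normal_density_rotate[OF cs(1), simplified])
  also have "\<dots> = (\<integral>\<^sup>+ x. \<integral>\<^sup>+ y. g (x, y) \<partial>lborel \<partial>lborel)"
    by (rule nn_integral_rotate[OF _ cs]) measurable
  also have "\<dots> = (\<integral>\<^sup>+ x. \<integral>\<^sup>+ y. f x y \<partial>\<N> \<partial>\<N>)"
    by (subst double) (simp_all add: g_def)
  finally show ?thesis .
qed

section \<open>Chi-square laws and exponential tilting\<close>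

primrec chi_sq :: "nat \<Rightarrow> real measure" where
  "chi_sq 0 = return borel 0"
| "chi_sq (Suc k) = distr (chi_sq k \<Otimes>\<^sub>M \<N>) borel (\<lambda>(s, u). s + u\<^sup>2)"

lemma sets_chi_sq [simp, measurable_cong]: "sets (chi_sq k) = sets borel"
  by (induction k) simp_all

lemma prob_space_chi_sq: "prob_space (chi_sq k)"
proof (induction k)
  case 0
  then show ?case by (simp add: prob_space_return)
next
  case (Suc k)
  interpret A: prob_space "chi_sq k" by fact
  interpret B: prob_space \<N> by (rule prob_space_std_normal)
  interpret pair_prob_space "chi_sq k" \<N> ..
  show ?case unfolding chi_sq.simps by (rule prob_space_distr) measurable
qed

lemma sigma_finite_chi_sq: "sigma_finite_measure (chi_sq k)"
  using prob_space_chi_sq by (rule prob_space_imp_sigma_finite)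

lemma nn_integral_chi_sq_0: "g \<in> borel_measurable borel \<Longrightarrow> (\<integral>\<^sup>+ s. g s \<partial>chi_sq 0) = g 0"
  by (simp add: nn_integral_return)

text \<open>Chi-square laws grow by one squared normal variable at a time, which is exactly how an
  additional observation changes the sum of squares in \<open>helmert\<close>.\<close>

lemma nn_integral_chi_sq_Suc:
  assumes [measurable]: "g \<in> borel_measurable borel"
  shows "(\<integral>\<^sup>+ s. g s \<partial>chi_sq (Suc k)) = (\<integral>\<^sup>+ s. \<integral>\<^sup>+ u. g (s + u\<^sup>2) \<partial>\<N> \<partial>chi_sq k)"
proof -
  interpret B: sigma_finite_measure \<N> by (rule sigma_finite_std_normal)
  have "(\<integral>\<^sup>+ s. g s \<partial>chi_sq (Suc k)) = (\<integral>\<^sup>+ p. g (fst p + (snd p)\<^sup>2) \<partial>(chi_sq k \<Otimes>\<^sub>M \<N>))"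
    by (simp add: nn_integral_distr case_prod_beta')
  also have "\<dots> = (\<integral>\<^sup>+ s. \<integral>\<^sup>+ u. g (s + u\<^sup>2) \<partial>\<N> \<partial>chi_sq k)"
    by (subst B.nn_integral_fst [symmetric]) simp_all
  finally show ?thesis .
qed

lemma chi_sq_add:
  assumes "g \<in> borel_measurable borel"
  shows "(\<integral>\<^sup>+ s. \<integral>\<^sup>+ t. g (s + t) \<partial>chi_sq b \<partial>chi_sq a) = (\<integral>\<^sup>+ s. g s \<partial>chi_sq (a + b))"
  using assms
proof (induction b arbitrary: g)
  case 0
  then show ?case by (simp add: nn_integral_return)
next
  case (Suc b)
  note [measurable] = Suc.prems
  interpret B: sigma_finite_measure \<N> by (rule sigma_finite_std_normal)
  have "(\<integral>\<^sup>+ s. \<integral>\<^sup>+ t. g (s + t) \<partial>chi_sq (Suc b) \<partial>chi_sq a)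
      = (\<integral>\<^sup>+ s. \<integral>\<^sup>+ t. \<integral>\<^sup>+ u. g ((s + t) + u\<^sup>2) \<partial>\<N> \<partial>chi_sq b \<partial>chi_sq a)"
    by (subst nn_integral_chi_sq_Suc) (simp_all add: add.assoc)
  also have "\<dots> = (\<integral>\<^sup>+ s. \<integral>\<^sup>+ u. g (s + u\<^sup>2) \<partial>\<N> \<partial>chi_sq (a + b))"
    by (rule Suc.IH) measurable
  also have "\<dots> = (\<integral>\<^sup>+ s. g s \<partial>chi_sq (a + Suc b))"
    by (simp only: add_Suc_right nn_integral_chi_sq_Suc[OF Suc.prems])
  finally show ?case .
qed

text \<open>The normal density at u times exp (- c u^2 / 2) is the normal density at sqrt (1 + c) u;
  rescaling u produces the factor (1 + c)^(-1/2).\<close>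

lemma std_normal_tilt:
  fixes g :: "real \<Rightarrow> ennreal"
  assumes [measurable]: "g \<in> borel_measurable borel" and c: "c \<ge> 0"
  shows "(\<integral>\<^sup>+ u. g (u\<^sup>2) * ennreal (exp (- c * u\<^sup>2 / 2)) \<partial>\<N>)
       = ennreal ((1 + c) powr (- 1 / 2)) * (\<integral>\<^sup>+ u. g (u\<^sup>2 / (1 + c)) \<partial>\<N>)"
proof -
  define r where "r = sqrt (1 + c)"
  have r: "r > 0" "r\<^sup>2 = 1 + c" using c by (simp_all add: r_def)
  have dens: "std_normal_density u * exp (- c * u\<^sup>2 / 2) = std_normal_density (r * u)" for u
  proof -
    have "- (r * u)\<^sup>2 / 2 = - u\<^sup>2 / 2 + - c * u\<^sup>2 / 2"
      using r by (simp add: power_mult_distrib field_simps)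
    then have "exp (- (r * u)\<^sup>2 / 2) = exp (- u\<^sup>2 / 2) * exp (- c * u\<^sup>2 / 2)" by (simp only: exp_add)
    then show ?thesis by (simp add: std_normal_density_def)
  qed
  have "(\<integral>\<^sup>+ u. g (u\<^sup>2) * ennreal (exp (- c * u\<^sup>2 / 2)) \<partial>\<N>)
      = (\<integral>\<^sup>+ u. ennreal (std_normal_density (r * u)) * g ((r * u)\<^sup>2 / (1 + c)) \<partial>lborel)"
  proof (subst nn_integral_std_normal)
    show "(\<integral>\<^sup>+ u. ennreal (std_normal_density u) * (g (u\<^sup>2) * ennreal (exp (- c * u\<^sup>2 / 2))) \<partial>lborel)
      = (\<integral>\<^sup>+ u. ennreal (std_normal_density (r * u)) * g ((r * u)\<^sup>2 / (1 + c)) \<partial>lborel)"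
    proof (rule nn_integral_cong)
      fix u :: real
      have "(r * u)\<^sup>2 / (1 + c) = u\<^sup>2" using r c by (simp add: power_mult_distrib)
      then show "ennreal (std_normal_density u) * (g (u\<^sup>2) * ennreal (exp (- c * u\<^sup>2 / 2)))
          = ennreal (std_normal_density (r * u)) * g ((r * u)\<^sup>2 / (1 + c))"
        unfolding dens [symmetric] by (simp add: ennreal_mult mult_ac)
    qed
  qed measurable
  also have "\<dots> = ennreal (1 / r) * (\<integral>\<^sup>+ u. ennreal (std_normal_density u) * g (u\<^sup>2 / (1 + c)) \<partial>lborel)"
    using r by (subst (2) nn_integral_real_affine[where c = r and t = 0])
      (simp_all add: mult.assoc [symmetric] ennreal_mult [symmetric])
  also have "(\<integral>\<^sup>+ u. ennreal (std_normal_density u) * g (u\<^sup>2 / (1 + c)) \<partial>lborel) = (\<integral>\<^sup>+ u. g (u\<^sup>2 / (1 + c)) \<partial>\<N>)"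
    by (subst nn_integral_std_normal) simp_all
  also have "1 / r = (1 + c) powr (- 1 / 2)"
    using c by (simp add: r_def powr_minus_divide powr_half_sqrt)
  finally show ?thesis .
qed

text \<open>Exponential tilting acts on the chi-square law as a change of scale. This determines the
  density of the t-statistic up to a constant, without the density of the chi-square law.\<close>

lemma chi_sq_tilt:
  fixes g :: "real \<Rightarrow> ennreal"
  assumes "g \<in> borel_measurable borel" and c: "c \<ge> 0"
  shows "(\<integral>\<^sup>+ s. g s * ennreal (exp (- c * s / 2)) \<partial>chi_sq k)
       = ennreal ((1 + c) powr (- real k / 2)) * (\<integral>\<^sup>+ s. g (s / (1 + c)) \<partial>chi_sq k)"
  using assms(1)
proof (induction k arbitrary: g)
  case 0
  note [measurable] = 0
  show ?case using c by (subst (1 2) nn_integral_chi_sq_0) simp_all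
next
  case (Suc k)
  note [measurable] = Suc.prems
  note [simp] = sigma_finite_chi_sq sigma_finite_std_normal
  interpret N: sigma_finite_measure \<N> by (rule sigma_finite_std_normal)
  interpret C: sigma_finite_measure "chi_sq k" by (rule sigma_finite_chi_sq)
  let ?K = "ennreal ((1 + c) powr (- real k / 2))" and ?h = "ennreal ((1 + c) powr (- 1 / 2))"
  have "(\<integral>\<^sup>+ s. g s * ennreal (exp (- c * s / 2)) \<partial>chi_sq (Suc k))
      = (\<integral>\<^sup>+ s. \<integral>\<^sup>+ u. g (s + u\<^sup>2) * ennreal (exp (- c * s / 2)) * ennreal (exp (- c * u\<^sup>2 / 2)) \<partial>\<N> \<partial>chi_sq k)"
  proof -
    have "exp (- c * (s + u\<^sup>2) / 2) = exp (- c * s / 2) * exp (- c * u\<^sup>2 / 2)" for s u :: real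
      by (simp only: exp_add [symmetric]) (simp add: field_simps)
    then show ?thesis by (subst nn_integral_chi_sq_Suc) (simp_all add: ennreal_mult mult.assoc)
  qed
  also have "\<dots> = (\<integral>\<^sup>+ s. ?h * (\<integral>\<^sup>+ u. g (s + u\<^sup>2 / (1 + c)) * ennreal (exp (- c * s / 2)) \<partial>\<N>) \<partial>chi_sq k)"
    using std_normal_tilt[OF _ c, of "\<lambda>v. g (s + v) * ennreal (exp (- c * s / 2))" for s]
    by (intro nn_integral_cong) simp
  also have "\<dots> = ?h * (\<integral>\<^sup>+ s. \<integral>\<^sup>+ u. g (s + u\<^sup>2 / (1 + c)) * ennreal (exp (- c * s / 2)) \<partial>\<N> \<partial>chi_sq k)"
    by (rule nn_integral_cmult) measurable
  also have "(\<integral>\<^sup>+ s. \<integral>\<^sup>+ u. g (s + u\<^sup>2 / (1 + c)) * ennreal (exp (- c * s / 2)) \<partial>\<N> \<partial>chi_sq k)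
      = (\<integral>\<^sup>+ u. \<integral>\<^sup>+ s. g (s + u\<^sup>2 / (1 + c)) * ennreal (exp (- c * s / 2)) \<partial>chi_sq k \<partial>\<N>)"
    by (rule nn_integral_swap) simp_all
  also have "\<dots> = (\<integral>\<^sup>+ u. ?K * (\<integral>\<^sup>+ s. g (s / (1 + c) + u\<^sup>2 / (1 + c)) \<partial>chi_sq k) \<partial>\<N>)"
    by (intro nn_integral_cong Suc.IH) measurable
  also have "\<dots> = ?K * (\<integral>\<^sup>+ u. \<integral>\<^sup>+ s. g ((s + u\<^sup>2) / (1 + c)) \<partial>chi_sq k \<partial>\<N>)"
    by (subst nn_integral_cmult) (simp_all add: add_divide_distrib)
  also have "(\<integral>\<^sup>+ u. \<integral>\<^sup>+ s. g ((s + u\<^sup>2) / (1 + c)) \<partial>chi_sq k \<partial>\<N>) = (\<integral>\<^sup>+ s. g (s / (1 + c)) \<partial>chi_sq (Suc k))"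
    by (subst nn_integral_chi_sq_Suc, simp) (rule nn_integral_swap, simp_all)
  also have "?h * (?K * (\<integral>\<^sup>+ s. g (s / (1 + c)) \<partial>chi_sq (Suc k)))
      = ennreal ((1 + c) powr (- 1 / 2) * (1 + c) powr (- real k / 2)) * (\<integral>\<^sup>+ s. g (s / (1 + c)) \<partial>chi_sq (Suc k))"
    by (simp add: ennreal_mult mult.assoc)
  also have "(1 + c) powr (- 1 / 2) * (1 + c) powr (- real k / 2) = (1 + c) powr (- real (Suc k) / 2)"
    by (simp only: powr_add [symmetric]) (simp add: field_simps)
  finally show ?case .
qed

lemma AE_chi_sq_nonneg: "AE s in chi_sq k. 0 \<le> s"
proof (induction k)
  case 0
  show ?case unfolding chi_sq.simps by (subst AE_return) simp_all
next
  case (Suc k)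
  have "(\<integral>\<^sup>+ s. indicator {..<0} s \<partial>chi_sq (Suc k)) = (\<integral>\<^sup>+ s. \<integral>\<^sup>+ u. indicator {..<0} (s + u\<^sup>2) \<partial>\<N> \<partial>chi_sq k)"
    by (rule nn_integral_chi_sq_Suc) simp
  also have "\<dots> = (\<integral>\<^sup>+ s. 0 \<partial>chi_sq k)"
  proof (rule nn_integral_cong_AE)
    show "AE s in chi_sq k. (\<integral>\<^sup>+ u. indicator {..<0} (s + u\<^sup>2) \<partial>\<N>) = 0"
      using Suc
    proof eventually_elim
      case (elim s)
      have "0 \<le> s + u\<^sup>2" for u using elim by simp
      then have "indicator {..<0} (s + u\<^sup>2) = (0 :: ennreal)" for u
        by (simp add: indicator_def not_less)
      then show ?case by simp
    qed
  qed
  finally have "(\<integral>\<^sup>+ s. indicator {..<0} s \<partial>chi_sq (Suc k)) = 0" by simp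
  then have "AE s in chi_sq (Suc k). indicator {..<0} s = (0 :: ennreal)"
    by (subst (asm) nn_integral_0_iff_AE) simp_all
  then show ?case by eventually_elim (auto simp: indicator_def split: if_splits)
qed

text \<open>The last summand is the square of a normal variable, nonzero almost surely, and the rest
  is nonnegative. Strict positivity permits the substitution by sqrt s in
  \<open>t_ratio_density\<close>.\<close>

lemma AE_chi_sq_pos: "AE s in chi_sq (Suc k). 0 < s"
proof -
  have u: "AE u in \<N>. u \<noteq> 0"
    by (subst AE_density, simp) (use AE_lborel_singleton[of "0 :: real"] in \<open>eventually_elim, simp\<close>)
  have "(\<integral>\<^sup>+ s. indicator {..0} s \<partial>chi_sq (Suc k)) = (\<integral>\<^sup>+ s. \<integral>\<^sup>+ u. indicator {..0} (s + u\<^sup>2) \<partial>\<N> \<partial>chi_sq k)"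
    by (rule nn_integral_chi_sq_Suc) simp
  also have "\<dots> = (\<integral>\<^sup>+ s. 0 \<partial>chi_sq k)"
  proof (rule nn_integral_cong_AE)
    show "AE s in chi_sq k. (\<integral>\<^sup>+ u. indicator {..0} (s + u\<^sup>2) \<partial>\<N>) = 0"
      using AE_chi_sq_nonneg
    proof eventually_elim
      case (elim s)
      have "AE u in \<N>. indicator {..0} (s + u\<^sup>2) = (0 :: ennreal)"
        using u
      proof eventually_elim
        fix u :: real assume "u \<noteq> 0"
        then have "0 < s + u\<^sup>2" using elim by (simp add: add_nonneg_pos)
        then show "indicator {..0} (s + u\<^sup>2) = (0 :: ennreal)" by (simp add: indicator_def not_le)
      qed
      then show ?case by (subst nn_integral_0_iff_AE) simp_all
    qed
  qed
  finally have "(\<integral>\<^sup>+ s. indicator {..0} s \<partial>chi_sq (Suc k)) = 0" by simp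
  then have "AE s in chi_sq (Suc k). indicator {..0} s = (0 :: ennreal)"
    by (subst (asm) nn_integral_0_iff_AE) simp_all
  then show ?thesis by eventually_elim (auto simp: indicator_def split: if_splits)
qed

declare chi_sq.simps(2) [simp del]

section \<open>Sample means, sums of squares and the Helmert transformation\<close>

definition smean :: "'i set \<Rightarrow> ('i \<Rightarrow> real) \<Rightarrow> real" where
  "smean I z = (\<Sum>i\<in>I. z i) / real (card I)"

definition ssq :: "'i set \<Rightarrow> ('i \<Rightarrow> real) \<Rightarrow> real" where
  "ssq I z = (\<Sum>i\<in>I. (z i - smean I z)\<^sup>2)"

lemma ssq_alt: "ssq I z = (\<Sum>i\<in>I. (z i)\<^sup>2) - (\<Sum>i\<in>I. z i)\<^sup>2 / real (card I)"
proof (cases "card I = 0")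
  case True
  then show ?thesis by (cases "finite I") (auto simp: ssq_def)
next
  case False
  then have c: "real (card I) \<noteq> 0" by simp
  have "ssq I z = (\<Sum>i\<in>I. (z i)\<^sup>2 - 2 * smean I z * z i + (smean I z)\<^sup>2)"
    unfolding ssq_def by (intro sum.cong) (auto simp: power2_diff)
  also have "\<dots> = (\<Sum>i\<in>I. (z i)\<^sup>2) - 2 * smean I z * (\<Sum>i\<in>I. z i) + real (card I) * (smean I z)\<^sup>2"
    by (simp add: sum.distrib sum_subtractf sum_distrib_left)
  also have "\<dots> = (\<Sum>i\<in>I. (z i)\<^sup>2) - (\<Sum>i\<in>I. z i)\<^sup>2 / real (card I)"
    using c by (simp add: smean_def power2_eq_square field_simps)
  finally show ?thesis .
qed

text \<open>First coordinate of a plane rotation with cosine sqrt (n / (n + 1)) and sine sqrt (1 /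
  (n + 1)), applied to the pair of sqrt n times the old mean and the new value y.\<close>

lemma smean_insert:
  assumes "finite I" "i \<notin> I" "I \<noteq> {}"
  shows "sqrt (real (card (insert i I))) * smean (insert i I) (z(i := y))
    = sqrt (real (card I) / real (Suc (card I))) * (sqrt (real (card I)) * smean I z) + sqrt (1 / real (Suc (card I))) * y"
proof -
  define n where "n = real (card I)"
  have n: "n > 0" using assms by (simp add: n_def card_gt_0_iff)
  have sum: "(\<Sum>j\<in>I. (z(i := y)) j) = (\<Sum>j\<in>I. z j)"
    using assms by (intro sum.cong) auto
  have "sqrt (n / (1 + n)) * sqrt n = n / sqrt (1 + n)"
    using n by (simp add: real_sqrt_divide)
  moreover have "sqrt (1 + n) * ((y + (\<Sum>j\<in>I. z j)) / (1 + n)) = (y + (\<Sum>j\<in>I. z j)) / sqrt (1 + n)"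
    using n by (simp add: field_simps)
  ultimately show ?thesis
    using assms n sum unfolding smean_def
    by (simp add: n_def [symmetric] mult.assoc [symmetric] real_sqrt_divide add_divide_distrib)
qed

text \<open>Second coordinate of the rotation in \<open>smean_insert\<close>: its square is (y -
  mean)^2 * n / (n + 1), the increase of the sum of squares caused by y.\<close>

lemma ssq_insert:
  assumes "finite I" "i \<notin> I" "I \<noteq> {}"
  shows "ssq (insert i I) (z(i := y)) = ssq I z
    + (- sqrt (1 / real (Suc (card I))) * (sqrt (real (card I)) * smean I z) + sqrt (real (card I) / real (Suc (card I))) * y)\<^sup>2"
proof -
  define n where "n = real (card I)"
  have n: "n > 0" using assms by (simp add: n_def card_gt_0_iff)
  define T where "T = (\<Sum>j\<in>I. z j)"
  define Q where "Q = (\<Sum>j\<in>I. (z j)\<^sup>2)"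
  have sum: "(\<Sum>j\<in>I. (z(i := y)) j) = T"
    unfolding T_def using assms by (intro sum.cong) auto
  have sum2: "(\<Sum>j\<in>I. ((z(i := y)) j)\<^sup>2) = Q"
    unfolding Q_def using assms by (intro sum.cong) auto
  have 1: "ssq (insert i I) (z(i := y)) = y\<^sup>2 + Q - (y + T)\<^sup>2 / (1 + n)"
    using assms sum sum2 by (simp add: ssq_alt n_def)
  have 2: "ssq I z = Q - T\<^sup>2 / n" by (simp add: ssq_alt n_def T_def Q_def)
  have "- sqrt (1 / real (Suc (card I))) * (sqrt (real (card I)) * smean I z) + sqrt (real (card I) / real (Suc (card I))) * y
    = (y - T / n) * sqrt (n / (1 + n))"
    by (simp add: smean_def n_def T_def real_sqrt_divide algebra_simps diff_divide_distrib)
  also have "\<dots>\<^sup>2 = (y - T / n)\<^sup>2 * (n / (1 + n))"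
    using n by (simp add: power_mult_distrib)
  also have "\<dots> = y\<^sup>2 + T\<^sup>2 / n - (y + T)\<^sup>2 / (1 + n)"
    using n by (simp add: power2_eq_square divide_simps) (simp add: algebra_simps)
  finally show ?thesis using 1 2 by simp
qed

lemma measurable_smean [measurable]: "smean I \<in> borel_measurable (Pi\<^sub>M I (\<lambda>_. \<N>))"
  unfolding smean_def by measurable

lemma measurable_ssq [measurable]: "ssq I \<in> borel_measurable (Pi\<^sub>M I (\<lambda>_. \<N>))"
  unfolding ssq_def by measurable

text \<open>In the induction step the normalized mean and the new observation are independent
  standard normal variables, and so are the two coordinates of their rotation. One is the new
  normalized mean; the other adds its square to the sum of squares and raises the degrees of freedom
  by one.\<close>

lemma helmert:
  fixes g :: "real \<Rightarrow> real \<Rightarrow> ennreal"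
  assumes "finite I" "I \<noteq> {}" and "(\<lambda>(s, m). g s m) \<in> borel_measurable (borel \<Otimes>\<^sub>M borel)"
  shows "(\<integral>\<^sup>+ z. g (ssq I z) (sqrt (real (card I)) * smean I z) \<partial>(Pi\<^sub>M I (\<lambda>_. \<N>)))
       = (\<integral>\<^sup>+ s. \<integral>\<^sup>+ m. g s m \<partial>\<N> \<partial>chi_sq (card I - 1))"
  using assms
proof (induction I arbitrary: g rule: finite_ne_induct)
  case (singleton i)
  note [measurable] = singleton
  interpret product_sigma_finite "\<lambda>_. \<N>"
    by (rule product_sigma_finite.intro) (rule sigma_finite_std_normal)
  interpret N: sigma_finite_measure \<N> by (rule sigma_finite_std_normal)
  have "(\<integral>\<^sup>+ z. g (ssq {i} z) (sqrt (real (card {i})) * smean {i} z) \<partial>(Pi\<^sub>M {i} (\<lambda>_. \<N>)))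
      = (\<integral>\<^sup>+ z. g 0 (z i) \<partial>(Pi\<^sub>M {i} (\<lambda>_. \<N>)))"
    by (simp add: ssq_def smean_def)
  also have "\<dots> = (\<integral>\<^sup>+ m. g 0 m \<partial>\<N>)"
    by (rule product_nn_integral_singleton) measurable
  also have "\<dots> = (\<integral>\<^sup>+ s. \<integral>\<^sup>+ m. g s m \<partial>\<N> \<partial>chi_sq 0)"
    by (subst nn_integral_chi_sq_0) simp_all
  finally show ?case by simp
next
  case (insert i I)
  note [measurable] = insert.prems
  note [simp] = sigma_finite_chi_sq sigma_finite_std_normal
  interpret product_sigma_finite "\<lambda>_. \<N>"
    by (rule product_sigma_finite.intro) (rule sigma_finite_std_normal)
  interpret N: sigma_finite_measure \<N> by (rule sigma_finite_std_normal)
  define n where "n = card I"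
  have n: "n > 0" using insert by (simp add: n_def card_gt_0_iff)
  define c where "c = sqrt (real n / real (Suc n))"
  define d where "d = sqrt (1 / real (Suc n))"
  have cd: "c\<^sup>2 + d\<^sup>2 = 1" "c \<noteq> 0"
    using n by (simp_all add: c_def d_def add_divide_distrib [symmetric])
  \<comment> \<open>Integrating out the new observation leaves a function of the old sum of squares
    and the old normalized mean, to which the induction hypothesis applies.\<close>
  define G where "G s m = (\<integral>\<^sup>+ y. g (s + (- d * m + c * y)\<^sup>2) (c * m + d * y) \<partial>\<N>)" for s m
  have [measurable]: "(\<lambda>(s, m). G s m) \<in> borel_measurable (borel \<Otimes>\<^sub>M borel)"
    unfolding G_def by measurable
  have "(\<integral>\<^sup>+ z. g (ssq (insert i I) z) (sqrt (real (card (insert i I))) * smean (insert i I) z) \<partial>(Pi\<^sub>M (insert i I) (\<lambda>_. \<N>)))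
      = (\<integral>\<^sup>+ z. \<integral>\<^sup>+ y. g (ssq (insert i I) (z(i := y))) (sqrt (real (card (insert i I))) * smean (insert i I) (z(i := y))) \<partial>\<N> \<partial>(Pi\<^sub>M I (\<lambda>_. \<N>)))"
    using insert.hyps by (intro product_nn_integral_insert) measurable
  also have "\<dots> = (\<integral>\<^sup>+ z. G (ssq I z) (sqrt (real (card I)) * smean I z) \<partial>(Pi\<^sub>M I (\<lambda>_. \<N>)))"
    unfolding G_def c_def d_def n_def
    by (simp only: ssq_insert[OF insert.hyps(1,3,2)] smean_insert[OF insert.hyps(1,3,2)])
  also have "\<dots> = (\<integral>\<^sup>+ s. \<integral>\<^sup>+ m. G s m \<partial>\<N> \<partial>chi_sq (card I - 1))"
    by (rule insert.IH) measurable
  also have "\<dots> = (\<integral>\<^sup>+ s. \<integral>\<^sup>+ u. \<integral>\<^sup>+ m. g (s + u\<^sup>2) m \<partial>\<N> \<partial>\<N> \<partial>chi_sq (card I - 1))"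
  proof (rule nn_integral_cong)
    fix s
    have "(\<integral>\<^sup>+ m. G s m \<partial>\<N>) = (\<integral>\<^sup>+ m. \<integral>\<^sup>+ u. g (s + u\<^sup>2) m \<partial>\<N> \<partial>\<N>)"
      unfolding G_def by (rule std_normal_rotate[OF _ cd, of "\<lambda>m u. g (s + u\<^sup>2) m"]) measurable
    also have "\<dots> = (\<integral>\<^sup>+ u. \<integral>\<^sup>+ m. g (s + u\<^sup>2) m \<partial>\<N> \<partial>\<N>)"
      by (rule nn_integral_swap) simp_all
    finally show "(\<integral>\<^sup>+ m. G s m \<partial>\<N>) = (\<integral>\<^sup>+ u. \<integral>\<^sup>+ m. g (s + u\<^sup>2) m \<partial>\<N> \<partial>\<N>)" .
  qed
  also have "\<dots> = (\<integral>\<^sup>+ s. \<integral>\<^sup>+ m. g s m \<partial>\<N> \<partial>chi_sq (Suc (card I - 1)))"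
    by (rule nn_integral_chi_sq_Suc [symmetric]) measurable
  also have "Suc (card I - 1) = card (insert i I) - 1"
    using insert.hyps n by (simp add: n_def)
  finally show ?case .
qed

text \<open>Each sample is treated by \<open>helmert\<close>. One more rotation, of the two
  normalized means, has the numerator of the t-statistic as first coordinate; the second coordinate
  integrates to one, and the degrees of freedom n - 1 and m - 1 add up.\<close>

lemma helmert_two_samples:
  fixes g :: "real \<Rightarrow> real \<Rightarrow> ennreal"
  assumes I: "finite I" "I \<noteq> {}" and J: "finite J" "J \<noteq> {}" and IJ: "I \<inter> J = {}"
    and [measurable]: "(\<lambda>(s, m). g s m) \<in> borel_measurable (borel \<Otimes>\<^sub>M borel)"
  shows "(\<integral>\<^sup>+ z. g (ssq I z + ssq J z)
            (sqrt (real (card I) * real (card J) / real (card I + card J)) * (smean I z - smean J z))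
            \<partial>(Pi\<^sub>M (I \<union> J) (\<lambda>_. \<N>)))
       = (\<integral>\<^sup>+ s. \<integral>\<^sup>+ w. g s w \<partial>\<N> \<partial>chi_sq (card I + card J - 2))"
proof -
  note [simp] = sigma_finite_chi_sq sigma_finite_std_normal
  interpret product_sigma_finite "\<lambda>_. \<N>"
    by (rule product_sigma_finite.intro) (rule sigma_finite_std_normal)
  interpret N: prob_space \<N> by (rule prob_space_std_normal)
  have C: "sigma_finite_measure (chi_sq k)" for k by simp
  note [measurable (raw)] = sigma_finite_measure.borel_measurable_nn_integral[OF C]
  define n where "n = real (card I)"
  define m where "m = real (card J)"
  have nm: "n > 0" "m > 0" using I J by (simp_all add: n_def m_def card_gt_0_iff)
  \<comment> \<open>The angle for which c * sqrt n * x + d * sqrt m * y is sqrt (n m / (n + m)) * (x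
    - y); the sign of \<open>d\<close> produces the difference.\<close>
  define c where "c = sqrt (m / (n + m))"
  define d where "d = - sqrt (n / (n + m))"
  have cd: "c\<^sup>2 + d\<^sup>2 = 1" "c \<noteq> 0"
    using nm by (simp_all add: c_def d_def add_divide_distrib [symmetric])
  have W: "sqrt (n * m / (n + m)) * (x - y) = c * (sqrt n * x) + d * (sqrt m * y)" for x y
    by (simp add: c_def d_def real_sqrt_divide real_sqrt_mult algebra_simps diff_divide_distrib)
  have ssq_merge: "ssq I (merge I J (x, y)) = ssq I x" "smean I (merge I J (x, y)) = smean I x"
    "ssq J (merge I J (x, y)) = ssq J y" "smean J (merge I J (x, y)) = smean J y" for x y
    using IJ by (auto simp: ssq_alt smean_def merge_def intro!: sum.cong arg_cong2[where f = "(-)"] arg_cong2[where f = "(/)"] arg_cong2[where f = power])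
  have [measurable]: "smean I \<in> borel_measurable (Pi\<^sub>M (I \<union> J) (\<lambda>_. \<N>))" "ssq I \<in> borel_measurable (Pi\<^sub>M (I \<union> J) (\<lambda>_. \<N>))"
    "smean J \<in> borel_measurable (Pi\<^sub>M (I \<union> J) (\<lambda>_. \<N>))" "ssq J \<in> borel_measurable (Pi\<^sub>M (I \<union> J) (\<lambda>_. \<N>))"
    unfolding smean_def ssq_def by measurable
  define H where "H s a = (\<integral>\<^sup>+ t. \<integral>\<^sup>+ b. g (s + t) (c * a + d * b) \<partial>\<N> \<partial>chi_sq (card J - 1))" for s a
  have Hm[measurable]: "(\<lambda>(s, a). H s a) \<in> borel_measurable (borel \<Otimes>\<^sub>M borel)"
    unfolding H_def by measurable
  have "(\<integral>\<^sup>+ z. g (ssq I z + ssq J z) (sqrt (n * m / (n + m)) * (smean I z - smean J z)) \<partial>(Pi\<^sub>M (I \<union> J) (\<lambda>_. \<N>)))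
      = (\<integral>\<^sup>+ x. \<integral>\<^sup>+ y. g (ssq I x + ssq J y) (c * (sqrt n * smean I x) + d * (sqrt m * smean J y)) \<partial>(Pi\<^sub>M J (\<lambda>_. \<N>)) \<partial>(Pi\<^sub>M I (\<lambda>_. \<N>)))"
    using I J IJ by (subst product_nn_integral_fold) (simp_all add: ssq_merge W)
  also have "\<dots> = (\<integral>\<^sup>+ x. H (ssq I x) (sqrt n * smean I x) \<partial>(Pi\<^sub>M I (\<lambda>_. \<N>)))"
    unfolding H_def m_def
    by (intro nn_integral_cong helmert[OF J, of "\<lambda>t b. g (s + t) (c * a + d * b)" for s a]) measurable
  also have "\<dots> = (\<integral>\<^sup>+ s. \<integral>\<^sup>+ a. H s a \<partial>\<N> \<partial>chi_sq (card I - 1))"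
    unfolding n_def by (rule helmert[OF I Hm])
  also have "\<dots> = (\<integral>\<^sup>+ s. \<integral>\<^sup>+ t. \<integral>\<^sup>+ w. g (s + t) w \<partial>\<N> \<partial>chi_sq (card J - 1) \<partial>chi_sq (card I - 1))"
  proof (rule nn_integral_cong)
    fix s
    have "(\<integral>\<^sup>+ a. H s a \<partial>\<N>) = (\<integral>\<^sup>+ t. \<integral>\<^sup>+ a. \<integral>\<^sup>+ b. g (s + t) (c * a + d * b) \<partial>\<N> \<partial>\<N> \<partial>chi_sq (card J - 1))"
      unfolding H_def by (rule nn_integral_swap) simp_all
    also have "\<dots> = (\<integral>\<^sup>+ t. \<integral>\<^sup>+ a. \<integral>\<^sup>+ b. g (s + t) a \<partial>\<N> \<partial>\<N> \<partial>chi_sq (card J - 1))"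
      by (intro nn_integral_cong std_normal_rotate[OF _ cd, of "\<lambda>a b. g (s + t) a" for t]) measurable
    also have "\<dots> = (\<integral>\<^sup>+ t. \<integral>\<^sup>+ w. g (s + t) w \<partial>\<N> \<partial>chi_sq (card J - 1))"
      by (simp add: N.emeasure_space_1[simplified])
    finally show "(\<integral>\<^sup>+ a. H s a \<partial>\<N>) = (\<integral>\<^sup>+ t. \<integral>\<^sup>+ w. g (s + t) w \<partial>\<N> \<partial>chi_sq (card J - 1))" .
  qed
  also have "\<dots> = (\<integral>\<^sup>+ s. \<integral>\<^sup>+ w. g s w \<partial>\<N> \<partial>chi_sq ((card I - 1) + (card J - 1)))"
    by (rule chi_sq_add) measurable
  also have "(card I - 1) + (card J - 1) = card I + card J - 2"
    using nm by (auto simp: n_def m_def)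
  finally show ?thesis by (simp add: n_def m_def)
qed

text \<open>Substitute w = sqrt s * v. The Gaussian factor exp (- v^2 s / 2) is a tilt of the
  chi-square law with parameter v^2, so \<open>chi_sq_tilt\<close> yields (1 + v^2)^(- (k + 1) / 2),
  and rescaling the Jacobian sqrt s adds (1 + v^2)^(- 1 / 2). The mean of sqrt s stays behind as a
  constant.\<close>

lemma t_ratio_density:
  fixes h :: "real \<Rightarrow> ennreal"
  assumes [measurable]: "h \<in> borel_measurable borel"
  shows "(\<integral>\<^sup>+ s. \<integral>\<^sup>+ w. h (w\<^sup>2 / s) \<partial>\<N> \<partial>chi_sq (Suc k))
     = ennreal (1 / sqrt (2 * pi)) * (\<integral>\<^sup>+ s. ennreal (sqrt s) \<partial>chi_sq (Suc k))
       * (\<integral>\<^sup>+ v. h (v\<^sup>2) * ennreal ((1 + v\<^sup>2) powr (- (real k + 2) / 2)) \<partial>lborel)"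
proof -
  note [simp] = sigma_finite_chi_sq sigma_finite_std_normal lborel.sigma_finite_measure_axioms
  interpret N: sigma_finite_measure \<N> by (rule sigma_finite_std_normal)
  interpret C: sigma_finite_measure "chi_sq (Suc k)" by (rule sigma_finite_chi_sq)
  let ?E = "\<integral>\<^sup>+ s. ennreal (sqrt s) \<partial>chi_sq (Suc k)"
  have "(\<integral>\<^sup>+ s. \<integral>\<^sup>+ w. h (w\<^sup>2 / s) \<partial>\<N> \<partial>chi_sq (Suc k))
     = (\<integral>\<^sup>+ s. \<integral>\<^sup>+ v. h (v\<^sup>2) * ennreal (1 / sqrt (2 * pi)) * (ennreal (sqrt s) * ennreal (exp (- v\<^sup>2 * s / 2))) \<partial>lborel \<partial>chi_sq (Suc k))"
  proof (rule nn_integral_cong_AE)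
    show "AE s in chi_sq (Suc k). (\<integral>\<^sup>+ w. h (w\<^sup>2 / s) \<partial>\<N>)
      = (\<integral>\<^sup>+ v. h (v\<^sup>2) * ennreal (1 / sqrt (2 * pi)) * (ennreal (sqrt s) * ennreal (exp (- v\<^sup>2 * s / 2))) \<partial>lborel)"
      using AE_chi_sq_pos
    proof eventually_elim
      case (elim s)
      define r where "r = sqrt s"
      have r: "r > 0" "r\<^sup>2 = s" using elim by (simp_all add: r_def)
      have "(\<integral>\<^sup>+ w. h (w\<^sup>2 / s) \<partial>\<N>) = (\<integral>\<^sup>+ w. ennreal (std_normal_density w) * h (w\<^sup>2 / s) \<partial>lborel)"
        by (rule nn_integral_std_normal) measurable
      also have "\<dots> = ennreal r * (\<integral>\<^sup>+ v. ennreal (std_normal_density (r * v)) * h ((r * v)\<^sup>2 / s) \<partial>lborel)"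
        using r by (subst nn_integral_real_affine[where c = r and t = 0]) simp_all
      also have "\<dots> = (\<integral>\<^sup>+ v. ennreal r * (ennreal (std_normal_density (r * v)) * h ((r * v)\<^sup>2 / s)) \<partial>lborel)"
        by (rule nn_integral_cmult [symmetric]) measurable
      also have "\<dots> = (\<integral>\<^sup>+ v. h (v\<^sup>2) * ennreal (1 / sqrt (2 * pi)) * (ennreal r * ennreal (exp (- v\<^sup>2 * s / 2))) \<partial>lborel)"
      proof (rule nn_integral_cong)
        fix v :: real
        have "(r * v)\<^sup>2 / s = v\<^sup>2" using r elim by (simp add: power_mult_distrib)
        moreover have "ennreal (std_normal_density (r * v)) = ennreal (1 / sqrt (2 * pi)) * ennreal (exp (- v\<^sup>2 * s / 2))"
          using r by (subst ennreal_mult [symmetric]) (simp_all add: std_normal_density_def power_mult_distrib mult.commute)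
        ultimately show "ennreal r * (ennreal (std_normal_density (r * v)) * h ((r * v)\<^sup>2 / s))
           = h (v\<^sup>2) * ennreal (1 / sqrt (2 * pi)) * (ennreal r * ennreal (exp (- v\<^sup>2 * s / 2)))"
          by (simp only: mult_ac)
      qed
      finally show ?case by (simp add: r_def)
    qed
  qed
  also have "\<dots> = (\<integral>\<^sup>+ v. \<integral>\<^sup>+ s. h (v\<^sup>2) * ennreal (1 / sqrt (2 * pi)) * (ennreal (sqrt s) * ennreal (exp (- v\<^sup>2 * s / 2))) \<partial>chi_sq (Suc k) \<partial>lborel)"
    by (rule nn_integral_swap) simp_all
  also have "\<dots> = (\<integral>\<^sup>+ v. ennreal (1 / sqrt (2 * pi)) * ?E * (h (v\<^sup>2) * ennreal ((1 + v\<^sup>2) powr (- (real k + 2) / 2))) \<partial>lborel)"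
  proof (rule nn_integral_cong)
    fix v :: real
    have p: "1 + v\<^sup>2 > 0" by (simp add: add_pos_nonneg)
    have "(\<integral>\<^sup>+ s. ennreal (sqrt s) * ennreal (exp (- v\<^sup>2 * s / 2)) \<partial>chi_sq (Suc k))
        = ennreal ((1 + v\<^sup>2) powr (- real (Suc k) / 2)) * (\<integral>\<^sup>+ s. ennreal (sqrt (s / (1 + v\<^sup>2))) \<partial>chi_sq (Suc k))"
      by (rule chi_sq_tilt) simp_all
    also have "(\<integral>\<^sup>+ s. ennreal (sqrt (s / (1 + v\<^sup>2))) \<partial>chi_sq (Suc k)) = (\<integral>\<^sup>+ s. ennreal ((1 + v\<^sup>2) powr (- 1 / 2)) * ennreal (sqrt s) \<partial>chi_sq (Suc k))"
      using p by (intro nn_integral_cong)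
        (simp add: ennreal_mult' [symmetric] real_sqrt_divide powr_minus_divide powr_half_sqrt)
    also have "\<dots> = ennreal ((1 + v\<^sup>2) powr (- 1 / 2)) * ?E"
      by (rule nn_integral_cmult) measurable
    also have "ennreal ((1 + v\<^sup>2) powr (- real (Suc k) / 2)) * (ennreal ((1 + v\<^sup>2) powr (- 1 / 2)) * ?E)
        = ennreal ((1 + v\<^sup>2) powr (- real (Suc k) / 2) * (1 + v\<^sup>2) powr (- 1 / 2)) * ?E"
      by (simp add: ennreal_mult mult.assoc)
    also have "(1 + v\<^sup>2) powr (- real (Suc k) / 2) * (1 + v\<^sup>2) powr (- 1 / 2) = (1 + v\<^sup>2) powr (- (real k + 2) / 2)"
    proof -
      have "- real (Suc k) / 2 + - 1 / 2 = - (real k + 2) / 2" by (simp add: field_simps)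
      then show ?thesis by (simp only: powr_add [symmetric])
    qed
    finally show "(\<integral>\<^sup>+ s. h (v\<^sup>2) * ennreal (1 / sqrt (2 * pi)) * (ennreal (sqrt s) * ennreal (exp (- v\<^sup>2 * s / 2))) \<partial>chi_sq (Suc k))
        = ennreal (1 / sqrt (2 * pi)) * ?E * (h (v\<^sup>2) * ennreal ((1 + v\<^sup>2) powr (- (real k + 2) / 2)))"
      by (subst nn_integral_cmult) (simp_all add: mult_ac)
  qed
  also have "\<dots> = ennreal (1 / sqrt (2 * pi)) * ?E * (\<integral>\<^sup>+ v. h (v\<^sup>2) * ennreal ((1 + v\<^sup>2) powr (- (real k + 2) / 2)) \<partial>lborel)"
    by (rule nn_integral_cmult) measurable
  finally show ?thesis .
qed

section \<open>Moments of the logarithmic t-statistic\<close>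

lemma nn_integral_gauss:
  assumes t: "t > 0"
  shows "(\<integral>\<^sup>+ v. ennreal (exp (- t * v\<^sup>2)) \<partial>lborel) = ennreal (sqrt (pi / t))"
proof -
  define \<sigma> where "\<sigma> = 1 / sqrt (2 * t)"
  have \<sigma>: "\<sigma> > 0" "\<sigma>\<^sup>2 = 1 / (2 * t)" using t by (simp_all add: \<sigma>_def power_divide)
  have dens: "exp (- t * v\<^sup>2) = sqrt (pi / t) * normal_density 0 \<sigma> v" for v
    using t by (simp add: normal_density_def \<sigma> field_simps)
  interpret prob_space "density lborel (normal_density 0 \<sigma>)"
    using \<sigma>(1) by (rule prob_space_normal_density)
  have "(\<integral>\<^sup>+ v. ennreal (normal_density 0 \<sigma> v) \<partial>lborel) = 1"
    using emeasure_space_1 by (simp add: emeasure_density)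
  moreover have "(\<integral>\<^sup>+ v. ennreal (exp (- t * v\<^sup>2)) \<partial>lborel)
      = ennreal (sqrt (pi / t)) * (\<integral>\<^sup>+ v. ennreal (normal_density 0 \<sigma> v) \<partial>lborel)"
    unfolding dens using t by (subst nn_integral_cmult [symmetric]) (simp_all add: ennreal_mult)
  ultimately show ?thesis by simp
qed

lemma nn_integral_gamma:
  assumes x: "x > 0" and y: "y > 0"
  shows "(\<integral>\<^sup>+ t. ennreal (indicator {0..} t * t powr (x - 1) * exp (- y * t)) \<partial>lborel)
    = ennreal (Gamma x * y powr - x)"
proof -
  let ?I = "\<integral>\<^sup>+ t. ennreal (indicator {0..} t * t powr (x - 1) * exp (- y * t)) \<partial>lborel"
  have "ennreal (Gamma x) = (\<integral>\<^sup>+ t. ennreal (indicator {0..} t * t powr (x - 1) / exp t) \<partial>lborel)"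
    by (rule Gamma_conv_nn_integral_real[OF x])
  also have "\<dots> = ennreal y * (\<integral>\<^sup>+ t. ennreal (indicator {0..} (y * t) * (y * t) powr (x - 1) / exp (y * t)) \<partial>lborel)"
    using y by (subst nn_integral_real_affine[where c = y and t = 0]) simp_all
  also have "\<dots> = ennreal y * (\<integral>\<^sup>+ t. ennreal (y powr (x - 1)) * ennreal (indicator {0..} t * t powr (x - 1) * exp (- y * t)) \<partial>lborel)"
    using y by (intro arg_cong2[where f = "(*)"] nn_integral_cong refl)
      (auto simp: indicator_def powr_mult zero_le_mult_iff exp_minus field_simps ennreal_mult' [symmetric])
  also have "\<dots> = ennreal y * (ennreal (y powr (x - 1)) * ?I)"
    by (subst nn_integral_cmult) simp_all
  also have "\<dots> = ennreal (y powr x) * ?I"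
    using y by (simp add: mult.assoc [symmetric] ennreal_mult [symmetric] powr_mult_base)
  finally have "ennreal (y powr - x) * ennreal (Gamma x) = ennreal (y powr - x) * (ennreal (y powr x) * ?I)"
    by simp
  also have "\<dots> = ?I"
    using y by (simp add: mult.assoc [symmetric] ennreal_mult [symmetric] flip: powr_add)
  finally show ?thesis using x by (simp add: ennreal_mult mult.commute)
qed

text \<open>The beta function at (1/2, x - 1/2), with sqrt pi in the place of Gamma (1/2). It
  normalizes the density (1 + v^2)^(-x), under which v^2 has a beta prime law.\<close>

definition beta_prime_const :: "real \<Rightarrow> real" where
  "beta_prime_const x = sqrt pi * Gamma (x - 1 / 2) / Gamma x"

lemma beta_prime_const_pos: "x > 1 / 2 \<Longrightarrow> beta_prime_const x > 0"
  by (simp add: beta_prime_const_def)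

text \<open>Gamma (x) * (1 + v^2)^(-x) is a gamma integral over t with rate 1 + v^2. After Tonelli,
  the Gaussian integral over v gives sqrt (pi / t), which lowers the parameter from x to x -
  1/2.\<close>

lemma nn_integral_beta_prime:
  assumes x: "x > 1 / 2"
  shows "(\<integral>\<^sup>+ v. ennreal ((1 + v\<^sup>2) powr - x) \<partial>lborel) = ennreal (beta_prime_const x)"
proof -
  let ?I = "\<integral>\<^sup>+ v. ennreal ((1 + v\<^sup>2) powr - x) \<partial>lborel"
  let ?w = "\<lambda>t. indicator {0..} t * t powr (x - 1)"
  have x0: "x > 0" "x - 1 / 2 > 0" using x by auto
  have "ennreal (Gamma x) * ?I = (\<integral>\<^sup>+ v. ennreal (Gamma x) * ennreal ((1 + v\<^sup>2) powr - x) \<partial>lborel)"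
    by (rule nn_integral_cmult [symmetric]) measurable
  also have "\<dots> = (\<integral>\<^sup>+ v. \<integral>\<^sup>+ t. ennreal (?w t * exp (- (1 + v\<^sup>2) * t)) \<partial>lborel \<partial>lborel)"
  proof (rule nn_integral_cong)
    fix v :: real
    have "1 + v\<^sup>2 > 0" by (simp add: add_pos_nonneg)
    then show "ennreal (Gamma x) * ennreal ((1 + v\<^sup>2) powr - x) = (\<integral>\<^sup>+ t. ennreal (?w t * exp (- (1 + v\<^sup>2) * t)) \<partial>lborel)"
      using x0 by (subst nn_integral_gamma) (simp_all add: ennreal_mult)
  qed
  also have "\<dots> = (\<integral>\<^sup>+ t. \<integral>\<^sup>+ v. ennreal (?w t * exp (- (1 + v\<^sup>2) * t)) \<partial>lborel \<partial>lborel)"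
    by (rule lborel_pair.Fubini') measurable
  also have "\<dots> = (\<integral>\<^sup>+ t. ennreal (sqrt pi) * ennreal (indicator {0..} t * t powr (x - 1 / 2 - 1) * exp (- 1 * t)) \<partial>lborel)"
  proof (rule nn_integral_cong)
    fix t :: real
    show "(\<integral>\<^sup>+ v. ennreal (?w t * exp (- (1 + v\<^sup>2) * t)) \<partial>lborel)
      = ennreal (sqrt pi) * ennreal (indicator {0..} t * t powr (x - 1 / 2 - 1) * exp (- 1 * t))"
    proof (cases "t > 0")
      case True
      have "exp (- (1 + v\<^sup>2) * t) = exp (- t) * exp (- t * v\<^sup>2)" for v
        by (simp only: exp_add [symmetric]) (simp add: algebra_simps)
      then have "(\<integral>\<^sup>+ v. ennreal (?w t * exp (- (1 + v\<^sup>2) * t)) \<partial>lborel)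
         = (\<integral>\<^sup>+ v. ennreal (t powr (x - 1) * exp (- t)) * ennreal (exp (- t * v\<^sup>2)) \<partial>lborel)"
        using True by (simp add: ennreal_mult [symmetric] mult.assoc)
      also have "\<dots> = ennreal (t powr (x - 1) * exp (- t)) * ennreal (sqrt (pi / t))"
        using nn_integral_gauss[OF True] by (subst nn_integral_cmult) simp_all
      also have "\<dots> = ennreal (sqrt pi) * ennreal (t powr (x - 1 / 2 - 1) * exp (- t))"
      proof -
        have p: "t powr (x - 1) / sqrt t = t powr (x - 1 / 2 - 1)"
          using True by (simp add: powr_half_sqrt [symmetric] powr_diff [symmetric] algebra_simps)
        have eq: "t powr (x - 1) * exp (- t) * sqrt (pi / t) = sqrt pi * (t powr (x - 1 / 2 - 1) * exp (- t))"
          unfolding real_sqrt_divide p [symmetric] by simp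
        have "ennreal (t powr (x - 1) * exp (- t)) * ennreal (sqrt (pi / t)) = ennreal (t powr (x - 1) * exp (- t) * sqrt (pi / t))"
          by (rule ennreal_mult [symmetric]) (use True in simp_all)
        also have "\<dots> = ennreal (sqrt pi) * ennreal (t powr (x - 1 / 2 - 1) * exp (- t))"
          unfolding eq by (rule ennreal_mult) simp_all
        finally show ?thesis .
      qed
      finally show ?thesis using True by simp
    qed (auto simp: indicator_def)
  qed
  also have "\<dots> = ennreal (sqrt pi) * ennreal (Gamma (x - 1 / 2) * 1 powr - (x - 1 / 2))"
    using x0 by (subst nn_integral_cmult, simp, subst nn_integral_gamma) simp_all
  finally have "ennreal (1 / Gamma x) * (ennreal (Gamma x) * ?I) = ennreal (1 / Gamma x) * ennreal (sqrt pi * Gamma (x - 1 / 2))"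
    using x0 by (simp add: ennreal_mult)
  moreover have "ennreal (1 / Gamma x) * (ennreal (Gamma x) * ?I) = ?I"
    using x0 Gamma_real_pos[of x] by (simp add: mult.assoc [symmetric] ennreal_mult' [symmetric] del: Gamma_real_pos)
  moreover have "ennreal (1 / Gamma x) * ennreal (sqrt pi * Gamma (x - 1 / 2)) = ennreal (beta_prime_const x)"
    using x0 by (simp add: ennreal_mult' [symmetric] beta_prime_const_def)
  ultimately show ?thesis by simp
qed

section \<open>Moments from moment generating functions\<close>

context prob_space
begin

text \<open>As L >= 0, each s^n L^n / n! with s >= 0 is at most exp (s L). Hence all moments exist,
  and on (-\<eta>, \<eta>) the function \<open>m\<close> is the power series with coefficients E L^n
  / n!. Termwise differentiation and uniqueness of derivatives give the first two moments.\<close>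

lemma moments_of_mgf:
  fixes L :: "'a \<Rightarrow> real" and m m' :: "real \<Rightarrow> real"
  assumes L[measurable]: "L \<in> borel_measurable M" and L0: "\<And>\<omega>. 0 \<le> L \<omega>" and \<eta>: "\<eta> > 0"
    and mgf: "\<And>s. \<bar>s\<bar> < \<eta> \<Longrightarrow> (\<integral>\<^sup>+ \<omega>. ennreal (exp (s * L \<omega>)) \<partial>M) = ennreal (m s)"
    and m0: "\<And>s. \<bar>s\<bar> < \<eta> \<Longrightarrow> 0 \<le> m s"
    and deriv1: "\<And>s. \<bar>s\<bar> < \<eta> \<Longrightarrow> (m has_real_derivative m' s) (at s)"
    and deriv2: "(m' has_real_derivative m2) (at 0)"
  shows "expectation L = m' 0" "expectation (\<lambda>\<omega>. (L \<omega>)\<^sup>2) = m2"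
proof -
  have exp_int: "integrable M (\<lambda>\<omega>. exp (s * L \<omega>)) \<and> expectation (\<lambda>\<omega>. exp (s * L \<omega>)) = m s" if "\<bar>s\<bar> < \<eta>" for s
  proof
    show "integrable M (\<lambda>\<omega>. exp (s * L \<omega>))"
      by (rule integrableI_nn_integral_finite[OF _ _ mgf[OF that]]) auto
    show "expectation (\<lambda>\<omega>. exp (s * L \<omega>)) = m s"
      using mgf[OF that] m0[OF that] by (subst integral_eq_nn_integral) auto
  qed
  have term_le: "s ^ n * L \<omega> ^ n / fact n \<le> exp (s * L \<omega>)" if "s \<ge> 0" for s n \<omega>
  proof -
    have "(s * L \<omega>) ^ n / fact n \<le> (\<Sum>k\<le>n. (s * L \<omega>) ^ k / fact k)"
      using that L0 by (intro member_le_sum) auto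
    also have "\<dots> \<le> exp (s * L \<omega>)"
      unfolding exp_def scaleR_conv_of_real
      using that L0 summable_exp[of "s * L \<omega>"]
      by (intro order_trans[OF sum_le_suminf[of "\<lambda>k. (s * L \<omega>) ^ k / fact k" "{..n}"]]) (auto simp: divide_inverse mult.commute)
    finally show ?thesis by (simp add: power_mult_distrib)
  qed
  have int_pow: "integrable M (\<lambda>\<omega>. L \<omega> ^ n)" for n
  proof -
    have "integrable M (\<lambda>\<omega>. (\<eta> / 2) ^ n * L \<omega> ^ n / fact n)"
    proof (rule Bochner_Integration.integrable_bound)
      show "integrable M (\<lambda>\<omega>. exp (\<eta> / 2 * L \<omega>))" using exp_int[of "\<eta> / 2"] \<eta> by simp
      show "AE \<omega> in M. norm ((\<eta> / 2) ^ n * L \<omega> ^ n / fact n) \<le> norm (exp (\<eta> / 2 * L \<omega>))"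
        using term_le[of "\<eta> / 2" n] \<eta> L0 by (intro AE_I2) (simp add: abs_mult power_abs)
    qed measurable
    then have "integrable M (\<lambda>\<omega>. fact n / (\<eta> / 2) ^ n * ((\<eta> / 2) ^ n * L \<omega> ^ n / fact n))"
      by (rule integrable_mult_right)
    then show ?thesis using \<eta> by simp
  qed
  define c where "c n = expectation (\<lambda>\<omega>. L \<omega> ^ n) / fact n" for n
  have sums: "(\<lambda>n. c n * s ^ n) sums m s" if s: "\<bar>s\<bar> < \<eta>" for s
  proof -
    let ?f = "\<lambda>n \<omega>. s ^ n * L \<omega> ^ n / fact n"
    have int: "integrable M (?f n)" for n using int_pow by simp
    have intn: "expectation (\<lambda>\<omega>. norm (?f n \<omega>)) = expectation (\<lambda>\<omega>. \<bar>s\<bar> ^ n * L \<omega> ^ n / fact n)" for n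
      using L0 by (simp add: abs_mult power_abs)
    have exps: "(\<lambda>n. ?f n \<omega>) sums exp (s * L \<omega>)" for \<omega>
      using exp_converges[of "s * L \<omega>"] by (simp add: power_mult_distrib divide_inverse mult_ac)
    have "summable (\<lambda>n. expectation (\<lambda>\<omega>. norm (?f n \<omega>)))"
    proof (rule summableI_nonneg_bounded)
      fix n
      have "(\<Sum>i<n. expectation (\<lambda>\<omega>. norm (?f i \<omega>))) = expectation (\<lambda>\<omega>. \<Sum>i<n. \<bar>s\<bar> ^ i * L \<omega> ^ i / fact i)"
        unfolding intn using int_pow by (subst Bochner_Integration.integral_sum) auto
      also have "\<dots> \<le> expectation (\<lambda>\<omega>. exp (\<bar>s\<bar> * L \<omega>))"
      proof (rule integral_mono)
        show "integrable M (\<lambda>\<omega>. \<Sum>i<n. \<bar>s\<bar> ^ i * L \<omega> ^ i / fact i)" using int_pow by auto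
        show "integrable M (\<lambda>\<omega>. exp (\<bar>s\<bar> * L \<omega>))" using exp_int[of "\<bar>s\<bar>"] s by simp
        show "(\<Sum>i<n. \<bar>s\<bar> ^ i * L \<omega> ^ i / fact i) \<le> exp (\<bar>s\<bar> * L \<omega>)" for \<omega>
        proof -
          have e: "(\<lambda>n. \<bar>s\<bar> ^ n * L \<omega> ^ n / fact n) sums exp (\<bar>s\<bar> * L \<omega>)"
            using exp_converges[of "\<bar>s\<bar> * L \<omega>"] by (simp add: power_mult_distrib divide_inverse mult_ac)
          then show ?thesis
            using sum_le_suminf[OF sums_summable[OF e], of "{..<n}"] sums_unique[OF e] L0 by auto
        qed
      qed
      finally show "(\<Sum>i<n. expectation (\<lambda>\<omega>. norm (?f i \<omega>))) \<le> expectation (\<lambda>\<omega>. exp (\<bar>s\<bar> * L \<omega>))" .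
    qed (simp add: integral_nonneg_AE)
    then have "(\<lambda>n. expectation (?f n)) sums expectation (\<lambda>\<omega>. \<Sum>n. ?f n \<omega>)"
    proof (intro sums_integral int AE_I2)
      fix \<omega>
      have "(\<lambda>n. norm (?f n \<omega>)) = (\<lambda>n. norm ((s * L \<omega>) ^ n /\<^sub>R fact n))"
        by (simp add: power_mult_distrib divide_inverse abs_mult mult_ac)
      then show "summable (\<lambda>n. norm (?f n \<omega>))" using summable_norm_exp[of "s * L \<omega>"] by simp
    qed
    also have "(\<lambda>\<omega>. \<Sum>n. ?f n \<omega>) = (\<lambda>\<omega>. exp (s * L \<omega>))"
      using exps by (simp add: sums_iff)
    also have "expectation \<dots> = m s" using exp_int[OF s] by simp
    also have "(\<lambda>n. expectation (?f n)) = (\<lambda>n. c n * s ^ n)"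
      by (simp add: c_def mult_ac)
    finally show ?thesis .
  qed
  have summ: "summable (\<lambda>n. c n * s ^ n)" if "norm s < \<eta>" for s :: real
    using sums[of s] that by (auto simp: sums_iff)
  have summ': "summable (\<lambda>n. diffs c n * s ^ n)" if "norm s < \<eta>" for s :: real
    by (rule termdiff_converges[OF that summ])
  have open_ball: "open {s :: real. \<bar>s\<bar> < \<eta>}"
    using open_ball[of "0 :: real" \<eta>] by (simp add: ball_def dist_real_def)
  \<comment> \<open>The first derivative is identified on the whole interval and not just at 0,
    because it has to be differentiated once more.\<close>
  have first: "(\<Sum>n. diffs c n * s ^ n) = m' s" if s: "\<bar>s\<bar> < \<eta>" for s
  proof -
    have "((\<lambda>z. \<Sum>n. c n * z ^ n) has_real_derivative (\<Sum>n. diffs c n * s ^ n)) (at s)"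
      by (rule termdiffs_strong'[OF summ]) (use s in auto)
    then have "(m has_real_derivative (\<Sum>n. diffs c n * s ^ n)) (at s)"
      by (rule has_field_derivative_transform_within_open[OF _ open_ball]) (use s sums in \<open>auto simp: sums_iff\<close>)
    then show ?thesis using deriv1[OF s] DERIV_unique by blast
  qed
  have "((\<lambda>z. \<Sum>n. diffs c n * z ^ n) has_real_derivative (\<Sum>n. diffs (diffs c) n * 0 ^ n)) (at 0)"
    by (rule termdiffs_strong'[OF summ']) (use \<eta> in auto)
  then have "(m' has_real_derivative (\<Sum>n. diffs (diffs c) n * 0 ^ n)) (at 0)"
    by (rule has_field_derivative_transform_within_open[OF _ open_ball]) (use first \<eta> in auto)
  then have "(\<Sum>n. diffs (diffs c) n * 0 ^ n) = m2" using deriv2 DERIV_unique by blast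
  then show "expectation (\<lambda>\<omega>. (L \<omega>)\<^sup>2) = m2"
    unfolding powser_zero by (simp add: diffs_def c_def power2_eq_square)
  show "expectation L = m' 0"
    using first[of 0] \<eta> unfolding powser_zero by (simp add: diffs_def c_def)
qed

text \<open>The factor exp (s L) = (1 + \<rho>)^s merely shifts x to x - s, so the moment generating
  function is a quotient of normalizing constants; the choice h = 1 determines \<open>C\<close>. Its
  logarithmic derivative is \<open>d\<close>, so its second derivative at 0 is d(0)^2 +
  d'(0).\<close>

lemma log_beta_prime:
  fixes \<rho> :: "'a \<Rightarrow> real" and x :: real and C :: ennreal
  assumes \<rho>[measurable]: "\<rho> \<in> borel_measurable M" and \<rho>0: "\<And>\<omega>. 0 \<le> \<rho> \<omega>" and x: "x > 1 / 2"
    and law: "\<And>h. h \<in> borel_measurable borel \<Longrightarrow>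
      (\<integral>\<^sup>+ \<omega>. h (\<rho> \<omega>) \<partial>M) = C * (\<integral>\<^sup>+ v. h (v\<^sup>2) * ennreal ((1 + v\<^sup>2) powr - x) \<partial>lborel)"
  defines "L \<equiv> \<lambda>\<omega>. ln (1 + \<rho> \<omega>)"
  shows log_beta_prime_mgf: "\<And>s. s < x - 1 / 2 \<Longrightarrow>
      (\<integral>\<^sup>+ \<omega>. ennreal (exp (s * L \<omega>)) \<partial>M) = ennreal (beta_prime_const (x - s) / beta_prime_const x)"
    and log_beta_prime_mean: "expectation L = Digamma x - Digamma (x - 1 / 2)"
    and log_beta_prime_second_moment:
      "expectation (\<lambda>\<omega>. (L \<omega>)\<^sup>2) = (Digamma x - Digamma (x - 1 / 2))\<^sup>2 + (Polygamma 1 (x - 1 / 2) - Polygamma 1 x)"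
proof -
  have J: "beta_prime_const x > 0" using beta_prime_const_pos[OF x] .
  have "1 = C * (\<integral>\<^sup>+ v. 1 * ennreal ((1 + v\<^sup>2) powr - x) \<partial>lborel)"
    using law[of "\<lambda>_. 1"] by (simp add: emeasure_space_1)
  also have "(\<integral>\<^sup>+ v. 1 * ennreal ((1 + v\<^sup>2) powr - x) \<partial>lborel) = ennreal (beta_prime_const x)"
    using nn_integral_beta_prime[OF x] by simp
  finally have "ennreal (1 / beta_prime_const x) = C * (ennreal (beta_prime_const x) * ennreal (1 / beta_prime_const x))"
    by (metis mult.assoc mult_1)
  then have C: "C = ennreal (1 / beta_prime_const x)"
    using J by (simp add: ennreal_mult' [symmetric])
  show mgf: "(\<integral>\<^sup>+ \<omega>. ennreal (exp (s * L \<omega>)) \<partial>M) = ennreal (beta_prime_const (x - s) / beta_prime_const x)"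
    if s: "s < x - 1 / 2" for s
  proof -
    have "(\<integral>\<^sup>+ \<omega>. ennreal (exp (s * L \<omega>)) \<partial>M) = (\<integral>\<^sup>+ \<omega>. ennreal ((1 + \<rho> \<omega>) powr s) \<partial>M)"
    proof (rule nn_integral_cong)
      fix \<omega>
      have "1 + \<rho> \<omega> > 0" using \<rho>0[of \<omega>] by linarith
      then show "ennreal (exp (s * L \<omega>)) = ennreal ((1 + \<rho> \<omega>) powr s)" by (simp add: L_def powr_def)
    qed
    also have "\<dots> = C * (\<integral>\<^sup>+ v. ennreal ((1 + v\<^sup>2) powr s) * ennreal ((1 + v\<^sup>2) powr - x) \<partial>lborel)"
      by (rule law[of "\<lambda>r. ennreal ((1 + r) powr s)"]) measurable
    also have "(\<lambda>v :: real. ennreal ((1 + v\<^sup>2) powr s) * ennreal ((1 + v\<^sup>2) powr - x)) = (\<lambda>v. ennreal ((1 + v\<^sup>2) powr - (x - s)))"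
      by (simp add: fun_eq_iff ennreal_mult [symmetric] flip: powr_add)
    also have "(\<integral>\<^sup>+ v. ennreal ((1 + v\<^sup>2) powr - (x - s)) \<partial>lborel) = ennreal (beta_prime_const (x - s))"
      using s by (intro nn_integral_beta_prime) simp
    also have "C * ennreal (beta_prime_const (x - s)) = ennreal (beta_prime_const (x - s) / beta_prime_const x)"
      unfolding C using J by (simp add: ennreal_mult' [symmetric])
    finally show ?thesis .
  qed
  define m where "m s = beta_prime_const (x - s) / beta_prime_const x" for s
  define d where "d s = Digamma (x - s) - Digamma (x - s - 1 / 2)" for s
  define m' where "m' s = m s * d s" for s
  have nonpos: "y \<notin> \<int>\<^sub>\<le>\<^sub>0" if "y > 0" for y :: real
    using that by (auto elim!: nonpos_Ints_cases)
  have deriv_m: "(m has_real_derivative m' s) (at s)" if s: "s < x - 1 / 2" for s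
  proof -
    have pos: "x - s - 1 / 2 > 0" "x - s > 0" using s by auto
    have np: "x - s - 1 / 2 \<notin> \<int>\<^sub>\<le>\<^sub>0" "x - s \<notin> \<int>\<^sub>\<le>\<^sub>0" using pos by (auto intro: nonpos)
    have g: "Gamma (x - s) > 0" using pos by simp
    have "((\<lambda>s. beta_prime_const (x - s)) has_real_derivative beta_prime_const (x - s) * d s) (at s)"
      unfolding beta_prime_const_def d_def
      by (rule derivative_eq_intros refl np | use g in force)+ (use g in \<open>simp add: field_simps\<close>)
    then show ?thesis
      unfolding m_def m'_def by (rule DERIV_cdivide [THEN DERIV_cong]) simp
  qed
  have deriv_m': "(m' has_real_derivative (d 0)\<^sup>2 + (Polygamma 1 (x - 1 / 2) - Polygamma 1 x)) (at 0)"
  proof -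
    have np: "x - 0 - 1 / 2 \<notin> \<int>\<^sub>\<le>\<^sub>0" "x - 0 \<notin> \<int>\<^sub>\<le>\<^sub>0" using x by (auto intro: nonpos)
    have "(d has_real_derivative (Polygamma 1 (x - 1 / 2) - Polygamma 1 x)) (at 0)"
      unfolding d_def by (rule derivative_eq_intros refl np | simp)+
    moreover have "(m has_real_derivative m' 0) (at 0)" by (rule deriv_m) (use x in simp)
    moreover have "m 0 = 1" using J by (simp add: m_def)
    ultimately show ?thesis
      unfolding m'_def [abs_def] using DERIV_mult[of m "m' 0" 0 UNIV d "Polygamma 1 (x - 1 / 2) - Polygamma 1 x"]
      by (simp add: m'_def power2_eq_square algebra_simps)
  qed
  have Lm: "L \<in> borel_measurable M" unfolding L_def by measurable
  have L0: "0 \<le> L \<omega>" for \<omega> using \<rho>0[of \<omega>] by (simp add: L_def)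
  note moments = moments_of_mgf[OF Lm L0, of "x - 1 / 2" m m', OF _ _ _ deriv_m deriv_m']
  have mgf': "(\<integral>\<^sup>+ \<omega>. ennreal (exp (s * L \<omega>)) \<partial>M) = ennreal (m s)" if "\<bar>s\<bar> < x - 1 / 2" for s
    using mgf[of s] that by (simp add: m_def)
  have m0: "0 \<le> m s" if "\<bar>s\<bar> < x - 1 / 2" for s
    unfolding m_def using that J by (intro divide_nonneg_pos less_imp_le[OF beta_prime_const_pos]) auto
  have "expectation L = m' 0" "expectation (\<lambda>\<omega>. (L \<omega>)\<^sup>2) = (d 0)\<^sup>2 + (Polygamma 1 (x - 1 / 2) - Polygamma 1 x)"
    by (rule moments; use x mgf' m0 in auto)+
  then show "expectation L = Digamma x - Digamma (x - 1 / 2)"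
    "expectation (\<lambda>\<omega>. (L \<omega>)\<^sup>2) = (Digamma x - Digamma (x - 1 / 2))\<^sup>2 + (Polygamma 1 (x - 1 / 2) - Polygamma 1 x)"
    using J by (simp_all add: m'_def d_def m_def)
qed

end

text \<open>Centering by the common mean, which is the null hypothesis, and scaling by sqrt (Sig j
  j) turns the pooled sample at coordinate j into independent standard normal variables, indexed by
  \<open>Inl\<close> and \<open>Inr\<close>. Mean and scale cancel in the t-statistic, and
  \<open>helmert_two_samples\<close> with \<open>t_ratio_density\<close> gives the law.
  \<open>C\<close> is left open because \<open>log_beta_prime\<close> recovers it.\<close>

lemma tstat_law:
  fixes X Y :: "nat \<Rightarrow> nat \<Rightarrow> 'a \<Rightarrow> real"
  assumes "prob_space M" and n: "n1 + n2 \<ge> 4" "n1 \<ge> 1" "n2 \<ge> 1"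
    and X: "\<forall>i\<in>{1..n1}. gaussian_process M (X i) mu Sig"
    and Y: "\<forall>k\<in>{1..n2}. gaussian_process M (Y k) mu Sig"
    and indep: "prob_space.indep_vars M (\<lambda>_. Pi\<^sub>M UNIV (\<lambda>_. borel))
                  (\<lambda>s \<omega> j. case s of Inl i \<Rightarrow> X i j \<omega> | Inr k \<Rightarrow> Y k j \<omega>)
                  (Inl ` {1..n1} \<union> Inr ` {1..n2})"
    and Sig: "Sig j j > 0"
  shows "\<exists>C. \<forall>h \<in> borel_measurable borel.
      (\<integral>\<^sup>+ \<omega>. h ((tstat n1 n2 X Y j \<omega>)\<^sup>2 / (real (n1 + n2) - 2)) \<partial>M)
        = C * (\<integral>\<^sup>+ v. h (v\<^sup>2) * ennreal ((1 + v\<^sup>2) powr - ((real (n1 + n2) - 1) / 2)) \<partial>lborel)"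
proof -
  interpret prob_space M by fact
  define I where "I = (Inl ` {1..n1} :: (nat + nat) set)"
  define J where "J = (Inr ` {1..n2} :: (nat + nat) set)"
  have IJ: "finite I" "I \<noteq> {}" "finite J" "J \<noteq> {}" "I \<inter> J = {}" "card I = n1" "card J = n2"
    using n by (auto simp: I_def J_def card_image)
  define \<sigma> where "\<sigma> = sqrt (Sig j j)"
  have \<sigma>: "\<sigma> > 0" using Sig by (simp add: \<sigma>_def)
  define w where "w s \<omega> = (case s of Inl i \<Rightarrow> X i j \<omega> | Inr k \<Rightarrow> Y k j \<omega>)" for s \<omega>
  define z where "z s \<omega> = (w s \<omega> - mu j) / \<sigma>" for s \<omega>
  have normal: "distr M borel (\<lambda>\<omega>. (V j \<omega> - mu j) / \<sigma>) = std_normal_distribution \<and> V j \<in> borel_measurable M"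
    if "gaussian_process M V mu Sig" for V
  proof
    show [measurable]: "V j \<in> borel_measurable M" using that by (simp add: gaussian_process_def)
    \<comment> \<open>The Gaussian hypothesis at the single coordinate j: index set {j}, coefficient
      1.\<close>
    have "distr M borel (\<lambda>\<omega>. \<Sum>i\<in>{j}. 1 * V i \<omega>) = normal_measure (\<Sum>i\<in>{j}. 1 * mu i) (\<Sum>i\<in>{j}. \<Sum>k\<in>{j}. 1 * 1 * Sig i k)"
      using that unfolding gaussian_process_def
      by (elim conjE allE[of _ "{j}"] allE[of _ "\<lambda>_. 1"]) simp
    then have "distr M borel (V j) = density lborel (normal_density (mu j) \<sigma>)"
      using Sig by (simp add: normal_measure_def \<sigma>_def)
    then have "distributed M lborel (V j) (normal_density (mu j) \<sigma>)"
      by (auto simp: distributed_def cong: distr_cong)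
    then have "distributed M lborel (\<lambda>\<omega>. (V j \<omega> - mu j) / \<sigma>) std_normal_density"
      using normal_standard_normal_convert[OF \<sigma>] by blast
    then show "distr M borel (\<lambda>\<omega>. (V j \<omega> - mu j) / \<sigma>) = std_normal_distribution"
      by (auto simp: distributed_def cong: distr_cong)
  qed
  have w: "distr M borel (z s) = std_normal_distribution \<and> w s \<in> borel_measurable M" if "s \<in> I \<union> J" for s
    using that normal X Y unfolding I_def J_def z_def w_def by auto
  have zm: "z s \<in> borel_measurable M" if "s \<in> I \<union> J" for s
  proof -
    have [measurable]: "w s \<in> borel_measurable M" using w[OF that] by blast
    show ?thesis unfolding z_def by measurable
  qed
  have "indep_vars (\<lambda>_. borel) (\<lambda>s \<omega>. (\<lambda>x. (x j - mu j) / \<sigma>) (\<lambda>j. case s of Inl i \<Rightarrow> X i j \<omega> | Inr k \<Rightarrow> Y k j \<omega>)) (I \<union> J)"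
    unfolding I_def J_def by (rule indep_vars_compose2[OF indep]) measurable
  then have "indep_vars (\<lambda>_. borel) z (I \<union> J)"
    by (simp add: z_def [abs_def] w_def)
  then have "distr M (Pi\<^sub>M (I \<union> J) (\<lambda>_. borel)) (\<lambda>\<omega>. \<lambda>s\<in>I \<union> J. z s \<omega>) = Pi\<^sub>M (I \<union> J) (\<lambda>s. distr M borel (z s))"
    by (subst (asm) indep_vars_iff_distr_eq_PiM') (use IJ zm in auto)
  also have "\<dots> = Pi\<^sub>M (I \<union> J) (\<lambda>_. std_normal_distribution)"
    using w by (intro PiM_cong) auto
  finally have law: "distr M (Pi\<^sub>M (I \<union> J) (\<lambda>_. borel)) (\<lambda>\<omega>. \<lambda>s\<in>I \<union> J. z s \<omega>) = Pi\<^sub>M (I \<union> J) (\<lambda>_. std_normal_distribution)" .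
  define Z where "Z \<omega> = (\<lambda>s\<in>I \<union> J. z s \<omega>)" for \<omega>
  have Zm[measurable]: "Z \<in> measurable M (Pi\<^sub>M (I \<union> J) (\<lambda>_. borel))"
    unfolding Z_def using zm by (intro measurable_restrict)
  have scale: "\<sigma>\<^sup>2 * ((x - mu j) / \<sigma> - m)\<^sup>2 = (x - (mu j + \<sigma> * m))\<^sup>2" for x m
  proof -
    have "\<sigma> * ((x - mu j) / \<sigma> - m) = x - (mu j + \<sigma> * m)" using \<sigma> by (simp add: field_simps)
    then show ?thesis by (metis power_mult_distrib)
  qed
  have sample: "xbar n U j \<omega> = mu j + \<sigma> * smean (\<iota> ` {1..n}) (Z \<omega>) \<and>
      (\<Sum>i=1..n. (U i j \<omega> - xbar n U j \<omega>)\<^sup>2) = \<sigma>\<^sup>2 * ssq (\<iota> ` {1..n}) (Z \<omega>)"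
    if "n \<ge> 1" "inj \<iota>" and U: "\<And>i. i \<in> {1..n} \<Longrightarrow> \<iota> i \<in> I \<union> J \<and> w (\<iota> i) \<omega> = U i j \<omega>" for n \<iota> U \<omega>
  proof
    have inj: "inj_on \<iota> {1..n}" using that by (auto intro: inj_on_subset)
    have Z: "Z \<omega> (\<iota> i) = (U i j \<omega> - mu j) / \<sigma>" if "i \<in> {1..n}" for i
      using U[OF that] by (simp add: Z_def z_def)
    have "(\<Sum>s\<in>\<iota> ` {1..n}. Z \<omega> s) = (\<Sum>i=1..n. (U i j \<omega> - mu j) / \<sigma>)"
      unfolding sum.reindex[OF inj] comp_def by (intro sum.cong refl Z)
    also have "\<dots> = ((\<Sum>i=1..n. U i j \<omega>) - real n * mu j) / \<sigma>"
      by (simp add: sum_divide_distrib [symmetric] sum_subtractf)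
    finally show xbar: "xbar n U j \<omega> = mu j + \<sigma> * smean (\<iota> ` {1..n}) (Z \<omega>)"
      unfolding xbar_def smean_def card_image[OF inj] using \<open>n \<ge> 1\<close> \<sigma> by (simp add: field_simps)
    have "\<sigma>\<^sup>2 * ssq (\<iota> ` {1..n}) (Z \<omega>) = (\<Sum>i=1..n. \<sigma>\<^sup>2 * ((U i j \<omega> - mu j) / \<sigma> - smean (\<iota> ` {1..n}) (Z \<omega>))\<^sup>2)"
      unfolding ssq_def sum_distrib_left sum.reindex[OF inj] comp_def by (intro sum.cong refl) (simp only: Z)
    also have "\<dots> = (\<Sum>i=1..n. (U i j \<omega> - xbar n U j \<omega>)\<^sup>2)"
      by (simp only: scale xbar)
    finally show "(\<Sum>i=1..n. (U i j \<omega> - xbar n U j \<omega>)\<^sup>2) = \<sigma>\<^sup>2 * ssq (\<iota> ` {1..n}) (Z \<omega>)" ..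
  qed
  have X_sample: "xbar n1 X j \<omega> = mu j + \<sigma> * smean I (Z \<omega>)"
    "(\<Sum>i=1..n1. (X i j \<omega> - xbar n1 X j \<omega>)\<^sup>2) = \<sigma>\<^sup>2 * ssq I (Z \<omega>)" for \<omega>
    using sample[of n1 Inl \<omega> X] n unfolding I_def by (auto simp: w_def)
  have Y_sample: "xbar n2 Y j \<omega> = mu j + \<sigma> * smean J (Z \<omega>)"
    "(\<Sum>i=1..n2. (Y i j \<omega> - xbar n2 Y j \<omega>)\<^sup>2) = \<sigma>\<^sup>2 * ssq J (Z \<omega>)" for \<omega>
    using sample[of n2 Inr \<omega> Y] n unfolding J_def by (auto simp: w_def)
  define \<nu> where "\<nu> = real (n1 + n2) - 2"
  have \<nu>: "\<nu> > 0" using n by (simp add: \<nu>_def)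
  define A where "A = sqrt (real n1 * real n2 / real (n1 + n2))"
  \<comment> \<open>Valid for every \<omega>: where the pooled sum of squares is 0, both sides are
    0, since division by zero gives 0.\<close>
  have ratio: "(tstat n1 n2 X Y j \<omega>)\<^sup>2 / \<nu>
     = (A * (smean I (Z \<omega>) - smean J (Z \<omega>)))\<^sup>2 / (ssq I (Z \<omega>) + ssq J (Z \<omega>))" for \<omega>
  proof -
    define s where "s = ssq I (Z \<omega>) + ssq J (Z \<omega>)"
    have s: "s \<ge> 0" unfolding s_def ssq_def by (intro add_nonneg_nonneg sum_nonneg) auto
    have "s2pool n1 n2 X Y j \<omega> = \<sigma>\<^sup>2 * s / \<nu>"
      unfolding s2pool_def X_sample(2) Y_sample(2) by (simp add: s_def \<nu>_def distrib_left)
    then have "tstat n1 n2 X Y j \<omega> = A * (\<sigma> * (smean I (Z \<omega>) - smean J (Z \<omega>))) / sqrt (\<sigma>\<^sup>2 * s / \<nu>)"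
      unfolding tstat_def A_def X_sample(1) Y_sample(1) by (simp add: right_diff_distrib)
    then have "(tstat n1 n2 X Y j \<omega>)\<^sup>2 = (A * (\<sigma> * (smean I (Z \<omega>) - smean J (Z \<omega>))))\<^sup>2 / (\<sigma>\<^sup>2 * s / \<nu>)"
      using s \<nu> by (simp add: power_divide)
    then show ?thesis
      using \<sigma> \<nu> by (simp add: s_def [symmetric] power_mult_distrib)
  qed
  define C where "C = ennreal (1 / sqrt (2 * pi)) * (\<integral>\<^sup>+ s. ennreal (sqrt s) \<partial>chi_sq (Suc (n1 + n2 - 3)))"
  have "(\<integral>\<^sup>+ \<omega>. h ((tstat n1 n2 X Y j \<omega>)\<^sup>2 / \<nu>) \<partial>M)
        = C * (\<integral>\<^sup>+ v. h (v\<^sup>2) * ennreal ((1 + v\<^sup>2) powr - ((real (n1 + n2) - 1) / 2)) \<partial>lborel)"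
    if [measurable]: "h \<in> borel_measurable borel" for h
  proof -
    define g where "g s m = h (m\<^sup>2 / s)" for s m :: real
    have [measurable]: "(\<lambda>(s, m). g s m) \<in> borel_measurable (borel \<Otimes>\<^sub>M borel)"
      unfolding g_def by measurable
    let ?F = "\<lambda>z. g (ssq I z + ssq J z) (A * (smean I z - smean J z))"
    have [measurable]: "smean I \<in> borel_measurable (Pi\<^sub>M (I \<union> J) (\<lambda>_. borel))" "ssq I \<in> borel_measurable (Pi\<^sub>M (I \<union> J) (\<lambda>_. borel))"
      "smean J \<in> borel_measurable (Pi\<^sub>M (I \<union> J) (\<lambda>_. borel))" "ssq J \<in> borel_measurable (Pi\<^sub>M (I \<union> J) (\<lambda>_. borel))"
      unfolding smean_def ssq_def by measurable
    have "(\<integral>\<^sup>+ \<omega>. h ((tstat n1 n2 X Y j \<omega>)\<^sup>2 / \<nu>) \<partial>M) = (\<integral>\<^sup>+ \<omega>. ?F (Z \<omega>) \<partial>M)"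
      unfolding ratio g_def ..
    also have "\<dots> = (\<integral>\<^sup>+ z. ?F z \<partial>distr M (Pi\<^sub>M (I \<union> J) (\<lambda>_. borel)) Z)"
      by (rule nn_integral_distr [symmetric]) measurable
    also have "distr M (Pi\<^sub>M (I \<union> J) (\<lambda>_. borel)) Z = Pi\<^sub>M (I \<union> J) (\<lambda>_. std_normal_distribution)"
      using law unfolding Z_def [abs_def] .
    also have "(\<integral>\<^sup>+ z. ?F z \<partial>\<dots>) = (\<integral>\<^sup>+ s. \<integral>\<^sup>+ m. g s m \<partial>std_normal_distribution \<partial>chi_sq (n1 + n2 - 2))"
      using helmert_two_samples[OF IJ(1-5), of g] by (simp add: IJ A_def)
    \<comment> \<open>With k = N - 3 the degrees of freedom are k + 1 = N - 2, and the exponent (k +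
      2) / 2 is (N - 1) / 2.\<close>
    also have "n1 + n2 - 2 = Suc (n1 + n2 - 3)" using n by simp
    also have "(\<integral>\<^sup>+ s. \<integral>\<^sup>+ m. g s m \<partial>std_normal_distribution \<partial>chi_sq (Suc (n1 + n2 - 3)))
       = C * (\<integral>\<^sup>+ v. h (v\<^sup>2) * ennreal ((1 + v\<^sup>2) powr (- (real (n1 + n2 - 3) + 2) / 2)) \<partial>lborel)"
      unfolding g_def C_def by (rule t_ratio_density) measurable
    also have "- (real (n1 + n2 - 3) + 2) / 2 = - ((real (n1 + n2) - 1) / 2)"
      using n by (simp add: of_nat_diff field_simps)
    finally show ?thesis .
  qed
  then show ?thesis unfolding \<nu>_def by blast
qed

lemma deriv_Dfun:
  assumes "x > 0"
  shows "deriv Dfun x = (Polygamma 1 ((x + 1) / 2) - Polygamma 1 (x / 2)) / 2"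
proof (rule DERIV_imp_deriv)
  have np: "(x + 1) / 2 \<notin> \<int>\<^sub>\<le>\<^sub>0" "x / 2 \<notin> \<int>\<^sub>\<le>\<^sub>0" using assms by (auto elim!: nonpos_Ints_cases)
  show "(Dfun has_real_derivative (Polygamma 1 ((x + 1) / 2) - Polygamma 1 (x / 2)) / 2) (at x)"
    unfolding Dfun_def by (rule derivative_eq_intros refl np | simp)+
qed

text \<open>The inequality z <= exp z at z = s y / p, raised to the power p. One finite exponential
  moment thereby controls moments of every order.\<close>

lemma powr_le_exp:
  fixes y :: real
  assumes "0 \<le> y" "0 < p" "0 < s"
  shows "y powr p \<le> (p / s) powr p * exp (s * y)"
proof -
  have "s * y / p \<le> exp (s * y / p)" using exp_ge_add_one_self[of "s * y / p"] by linarith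
  then have "(s * y / p) powr p \<le> exp (s * y / p) powr p"
    using assms by (intro powr_mono2) auto
  also have "\<dots> = exp (s * y)" using assms by (simp add: powr_def)
  finally have "(p / s) powr p * (s * y / p) powr p \<le> (p / s) powr p * exp (s * y)"
    by (intro mult_left_mono) auto
  moreover have "(p / s) powr p * (s * y / p) powr p = y powr p"
    using assms by (subst powr_mult [symmetric]) auto
  ultimately show ?thesis by simp
qed

section \<open>Generated \<sigma>-algebras, mixing coefficients and stationarity\<close>

definition generated_algebra :: "'a measure \<Rightarrow> (nat \<Rightarrow> 'a \<Rightarrow> real) \<Rightarrow> nat set \<Rightarrow> 'a measure" where
  "generated_algebra M V J = sigma (space M) (\<Union>j\<in>J. {V j -` B \<inter> space M | B. B \<in> sets borel})"

lemma space_generated_algebra: "space (generated_algebra M V J) = space M"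
  unfolding generated_algebra_def by (rule space_measure_of) auto

text \<open>Links the measure space that \<open>subalgebra\<close> and
  \<open>borel_measurable\<close> require to the family of sets over which \<open>alpha_dep\<close>
  takes its supremum.\<close>

lemma sets_generated_algebra: "sets (generated_algebra M V J) = sigma_gen M V J"
  unfolding generated_algebra_def sigma_gen_def by (rule sets_measure_of) auto

lemma measurable_generated_algebra:
  assumes "j \<in> J"
  shows "V j \<in> borel_measurable (generated_algebra M V J)"
proof (rule measurableI)
  fix B :: "real set" assume "B \<in> sets borel"
  then have "V j -` B \<inter> space M \<in> sigma_gen M V J"
    unfolding sigma_gen_def using assms by (intro sigma_sets.Basic) blast
  then show "V j -` B \<inter> space (generated_algebra M V J) \<in> sets (generated_algebra M V J)"
    by (simp add: space_generated_algebra sets_generated_algebra)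
qed simp

lemma subalgebra_generated_algebra:
  assumes "\<And>j. V j \<in> borel_measurable M"
  shows "subalgebra M (generated_algebra M V J)"
  unfolding subalgebra_def space_generated_algebra sets_generated_algebra sigma_gen_def
  using assms by (auto intro!: sets.sigma_sets_subset dest: measurable_sets)

context prob_space
begin

lemma abs_prob_diff_le_1: "\<bar>prob (A \<inter> B) - prob A * prob B\<bar> \<le> 1"
proof -
  have "0 \<le> prob A * prob B" "prob A * prob B \<le> 1" by (auto intro: mult_le_one)
  moreover have "0 \<le> prob (A \<inter> B)" "prob (A \<inter> B) \<le> 1" by auto
  ultimately show ?thesis by linarith
qed

lemma sigma_gen_nonempty: "sigma_gen M V J \<noteq> {}"
  unfolding sigma_gen_def using sigma_sets.Empty by blast

text \<open>A supremum of reals bounds its family only if the family is bounded above; here the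
  bound is 1.\<close>

lemma alpha_dep_upper:
  assumes "A \<in> F" "B \<in> G"
  shows "\<bar>prob (A \<inter> B) - prob A * prob B\<bar> \<le> alpha_dep M F G"
proof -
  have "bdd_above ((\<lambda>AB. \<bar>prob (fst AB \<inter> snd AB) - prob (fst AB) * prob (snd AB)\<bar>) ` (F \<times> G))"
    by (rule bdd_aboveI2[of _ _ 1]) (rule abs_prob_diff_le_1)
  from cSUP_upper[OF _ this, of "(A, B)"] show ?thesis using assms by (simp add: alpha_dep_def)
qed

lemma alpha_dep_le_1: "F \<noteq> {} \<Longrightarrow> G \<noteq> {} \<Longrightarrow> alpha_dep M F G \<le> 1"
  unfolding alpha_dep_def by (intro cSUP_least abs_prob_diff_le_1) auto

lemma alpha_mix_upper:
  assumes "1 \<le> k" "A \<in> sigma_gen M V {1..k}" "B \<in> sigma_gen M V {k + r..}"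
  shows "\<bar>prob (A \<inter> B) - prob A * prob B\<bar> \<le> alpha_mix M V r"
proof -
  have "bdd_above ((\<lambda>k. alpha_dep M (sigma_gen M V {1..k}) (sigma_gen M V {k + r..})) ` {1..})"
    by (rule bdd_aboveI2[of _ _ 1]) (intro alpha_dep_le_1 sigma_gen_nonempty)
  then have "alpha_dep M (sigma_gen M V {1..k}) (sigma_gen M V {k + r..}) \<le> alpha_mix M V r"
    unfolding alpha_mix_def by (rule cSUP_upper[rotated]) (use assms in simp)
  then show ?thesis using alpha_dep_upper[OF assms(2,3)] by linarith
qed

lemma alpha_mix_bounds: "0 \<le> alpha_mix M V r" "alpha_mix M V r \<le> 1"
proof -
  have "{} \<in> sigma_gen M V J" for J unfolding sigma_gen_def by (rule sigma_sets.Empty)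
  from alpha_mix_upper[OF order_refl this this, of r] show "0 \<le> alpha_mix M V r" by simp
  show "alpha_mix M V r \<le> 1"
    unfolding alpha_mix_def by (intro cSUP_least alpha_dep_le_1 sigma_gen_nonempty) auto
qed

text \<open>The product is a function of the coordinates 0 and l of the shifted path, whose law does
  not depend on the shift. Coordinate 0 of the path is time 1, so time i is reached by the shift i -
  1.\<close>

lemma stationary_product_moment:
  assumes V[measurable]: "\<And>j. V j \<in> borel_measurable M" and "stationary_seq M V" and "1 \<le> i"
  shows "expectation (\<lambda>\<omega>. (V i \<omega> - c) * (V (i + l) \<omega> - c)) = expectation (\<lambda>\<omega>. (V 1 \<omega> - c) * (V (1 + l) \<omega> - c))"
proof -
  define h where "h = i - 1"
  have i: "i = h + 1" using assms by (simp add: h_def)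
  have [measurable]: "(\<lambda>\<omega> j. V (j + 1 + h) \<omega>) \<in> measurable M (Pi\<^sub>M UNIV (\<lambda>_. borel))"
    "(\<lambda>\<omega> j. V (j + 1) \<omega>) \<in> measurable M (Pi\<^sub>M UNIV (\<lambda>_. borel))"
    by (rule measurable_PiM_single'; simp)+
  have [measurable]: "(\<lambda>x :: nat \<Rightarrow> real. x k) \<in> borel_measurable (Pi\<^sub>M UNIV (\<lambda>_. borel))" for k
    by (rule measurable_component_singleton) simp
  let ?F = "\<lambda>x :: nat \<Rightarrow> real. (x 0 - c) * (x l - c)"
  have "expectation (\<lambda>\<omega>. ?F (\<lambda>j. V (j + 1 + h) \<omega>))
      = (\<integral>x. ?F x \<partial>distr M (Pi\<^sub>M UNIV (\<lambda>_. borel)) (\<lambda>\<omega> j. V (j + 1 + h) \<omega>))"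
    by (rule integral_distr [symmetric]) measurable
  also have "distr M (Pi\<^sub>M UNIV (\<lambda>_. borel)) (\<lambda>\<omega> j. V (j + 1 + h) \<omega>) = distr M (Pi\<^sub>M UNIV (\<lambda>_. borel)) (\<lambda>\<omega> j. V (j + 1) \<omega>)"
    using assms(2) by (simp add: stationary_seq_def)
  also have "(\<integral>x. ?F x \<partial>\<dots>) = expectation (\<lambda>\<omega>. ?F (\<lambda>j. V (j + 1) \<omega>))"
    by (rule integral_distr) measurable
  finally show ?thesis by (simp add: i add_ac)
qed

text \<open>The parameter in \<open>log_beta_prime\<close> is x = (N - 1) / 2, and x and x - 1/2 are
  the two digamma arguments of \<open>Dfun\<close> at N - 2. The exponent 1 / (2 N) for V is s = 1/2
  for ln (1 + \<rho>), which satisfies s < x - 1/2 = (N - 2) / 2 because N >= 4.\<close>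

lemma Vstat_moments:
  fixes X Y :: "nat \<Rightarrow> nat \<Rightarrow> 'a \<Rightarrow> real"
  assumes n: "n1 + n2 \<ge> 4" "n1 \<ge> 1" "n2 \<ge> 1"
    and X: "\<forall>i\<in>{1..n1}. gaussian_process M (X i) mu Sig"
    and Y: "\<forall>k\<in>{1..n2}. gaussian_process M (Y k) mu Sig"
    and indep: "indep_vars (\<lambda>_. Pi\<^sub>M UNIV (\<lambda>_. borel))
                  (\<lambda>s \<omega> j. case s of Inl i \<Rightarrow> X i j \<omega> | Inr k \<Rightarrow> Y k j \<omega>)
                  (Inl ` {1..n1} \<union> Inr ` {1..n2})"
    and Sig: "Sig j j > 0"
  defines "N \<equiv> n1 + n2"
  shows Vstat_measurable: "Vstat n1 n2 X Y j \<in> borel_measurable M"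
    and Vstat_nonneg: "0 \<le> Vstat n1 n2 X Y j \<omega>"
    and Vstat_mean: "expectation (Vstat n1 n2 X Y j) = G1 N"
    and Vstat_second_moment: "expectation (\<lambda>\<omega>. (Vstat n1 n2 X Y j \<omega>)\<^sup>2) = G2 N"
    and Vstat_mgf: "(\<integral>\<^sup>+ \<omega>. ennreal (exp (1 / (2 * real N) * Vstat n1 n2 X Y j \<omega>)) \<partial>M)
       = ennreal (beta_prime_const ((real N - 2) / 2) / beta_prime_const ((real N - 1) / 2))"
proof -
  let ?\<rho> = "\<lambda>\<omega>. (tstat n1 n2 X Y j \<omega>)\<^sup>2 / (real (n1 + n2) - 2)"
  define x where "x = (real N - 1) / 2"
  have N: "real N \<ge> 4" using n by (simp add: N_def)
  have [measurable]: "X i j \<in> borel_measurable M" if "i \<in> {1..n1}" for i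
    using X that by (simp add: gaussian_process_def)
  have [measurable]: "Y i j \<in> borel_measurable M" if "i \<in> {1..n2}" for i
    using Y that by (simp add: gaussian_process_def)
  have xbar[measurable]: "xbar n1 X j \<in> borel_measurable M" "xbar n2 Y j \<in> borel_measurable M"
    unfolding xbar_def [abs_def] by measurable
  have [measurable]: "s2pool n1 n2 X Y j \<in> borel_measurable M"
    unfolding s2pool_def [abs_def] by measurable
  have [measurable]: "tstat n1 n2 X Y j \<in> borel_measurable M"
    unfolding tstat_def [abs_def] by measurable
  show "Vstat n1 n2 X Y j \<in> borel_measurable M"
    unfolding Vstat_def [abs_def] by measurable
  have \<rho>m: "?\<rho> \<in> borel_measurable M" by measurable
  have \<rho>0: "0 \<le> ?\<rho> \<omega>" for \<omega> using N by (simp add: N_def)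
  have x: "x > 1 / 2" using N by (simp add: x_def)
  obtain C where law: "\<And>h. h \<in> borel_measurable borel \<Longrightarrow>
      (\<integral>\<^sup>+ \<omega>. h (?\<rho> \<omega>) \<partial>M) = C * (\<integral>\<^sup>+ v. h (v\<^sup>2) * ennreal ((1 + v\<^sup>2) powr - x) \<partial>lborel)"
    using tstat_law[OF prob_space_axioms n X Y indep Sig] unfolding x_def N_def by blast
  have mean: "expectation (\<lambda>\<omega>. ln (1 + ?\<rho> \<omega>)) = Digamma x - Digamma (x - 1 / 2)"
    by (rule log_beta_prime_mean[OF \<rho>m \<rho>0 x law])
  have second: "expectation (\<lambda>\<omega>. (ln (1 + ?\<rho> \<omega>))\<^sup>2)
      = (Digamma x - Digamma (x - 1 / 2))\<^sup>2 + (Polygamma 1 (x - 1 / 2) - Polygamma 1 x)"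
    by (rule log_beta_prime_second_moment[OF \<rho>m \<rho>0 x law])
  have V: "Vstat n1 n2 X Y j = (\<lambda>\<omega>. real N * ln (1 + ?\<rho> \<omega>))"
    by (simp add: Vstat_def N_def fun_eq_iff)
  show "0 \<le> Vstat n1 n2 X Y j \<omega>" unfolding V using \<rho>0[of \<omega>] by simp
  have D: "Digamma x - Digamma (x - 1 / 2) = Dfun (real N - 2)"
    by (simp add: Dfun_def x_def algebra_simps diff_divide_distrib)
  show "expectation (Vstat n1 n2 X Y j) = G1 N"
    unfolding V integral_mult_right_zero mean D G1_def ..
  have arg: "(real N - 2 + 1) / 2 = x" "(real N - 2) / 2 = x - 1 / 2"
    by (simp_all add: x_def diff_divide_distrib)
  \<comment> \<open>The factor 1/2 of the chain rule in \<open>deriv_Dfun\<close> makes the trigamma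
    difference equal to -2 times the derivative.\<close>
  have D': "Polygamma 1 (x - 1 / 2) - Polygamma 1 x = - 2 * deriv Dfun (real N - 2)"
    using N by (subst deriv_Dfun) (simp_all only: arg, simp_all)
  show "expectation (\<lambda>\<omega>. (Vstat n1 n2 X Y j \<omega>)\<^sup>2) = G2 N"
    unfolding V power_mult_distrib integral_mult_right_zero second D D' G2_def by simp
  have "(\<integral>\<^sup>+ \<omega>. ennreal (exp (1 / 2 * ln (1 + ?\<rho> \<omega>))) \<partial>M) = ennreal (beta_prime_const (x - 1 / 2) / beta_prime_const x)"
    by (rule log_beta_prime_mgf[OF \<rho>m \<rho>0 x law]) (use N in \<open>simp_all add: x_def\<close>)
  moreover have "1 / (2 * real N) * (real N * ln (1 + ?\<rho> \<omega>)) = 1 / 2 * ln (1 + ?\<rho> \<omega>)" for \<omega>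
    using N by simp
  ultimately show "(\<integral>\<^sup>+ \<omega>. ennreal (exp (1 / (2 * real N) * Vstat n1 n2 X Y j \<omega>)) \<partial>M)
       = ennreal (beta_prime_const ((real N - 2) / 2) / beta_prime_const ((real N - 1) / 2))"
    unfolding V by (simp only: arg x_def [symmetric])
qed

end

section \<open>The logarithmic t-statistics as a centered mixing sequence\<close>

theorem theorem3:
  fixes M :: "'a measure"
    and n1 n2 :: nat
    and X Y :: "nat \<Rightarrow> nat \<Rightarrow> 'a \<Rightarrow> real"
    and mu :: "nat \<Rightarrow> real"
    and Sig :: "nat \<Rightarrow> nat \<Rightarrow> real"
    and gamma :: "nat \<Rightarrow> real"
  assumes "prob_space M"
    and "n1 + n2 \<ge> 4" and "n1 \<ge> 1" and "n2 \<ge> 1"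
    and X_gauss: "\<forall>i\<in>{1..n1}. gaussian_process M (X i) mu Sig"
    and Y_gauss: "\<forall>k\<in>{1..n2}. gaussian_process M (Y k) mu Sig"
    and indep: "prob_space.indep_vars M (\<lambda>_. Pi\<^sub>M UNIV (\<lambda>_. borel))
                  (\<lambda>s \<omega> j. case s of Inl i \<Rightarrow> X i j \<omega> | Inr k \<Rightarrow> Y k j \<omega>)
                  (Inl ` {1..n1} \<union> Inr ` {1..n2})"
    and Sig_pos: "\<forall>j. Sig j j > 0"
    and stat: "stationary_seq M (Vstat n1 n2 X Y)"
    and C1: "decseq (alpha_mix M (Vstat n1 n2 X Y)) \<and> alpha_mix M (Vstat n1 n2 X Y) \<longlonglongrightarrow> 0"
    and C2a: "\<exists>\<delta>>0. summable (\<lambda>r. alpha_mix M (Vstat n1 n2 X Y) (Suc r) powr (\<delta> / (2 + \<delta>)))"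
    and C2b: "\<forall>k. (\<lambda>p. (\<Sum>j=1..p-k. cov M (Vstat n1 n2 X Y j) (Vstat n1 n2 X Y (j + k)))
                         / real (p - k)) \<longlonglongrightarrow> gamma k"
    and tau_pos: "G2 (n1 + n2) - (G1 (n1 + n2))\<^sup>2 + 2 * (\<Sum>k. gamma (Suc k)) > 0"
  shows "weak_conv_m
           (\<lambda>p. distr M borel
              (\<lambda>\<omega>. (T2stat n1 n2 X Y p \<omega> - real p * G1 (n1 + n2)) /
                   (sqrt (G2 (n1 + n2) - (G1 (n1 + n2))\<^sup>2 + 2 * (\<Sum>k. gamma (Suc k))) * sqrt (real p))))
           std_normal_distribution"
proof -
  interpret prob_space M by fact
  define V where "V = Vstat n1 n2 X Y"
  define N where "N = n1 + n2"
  have Sig': "Sig j j > 0" for j using Sig_pos by blast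
  note V_facts = Vstat_moments[OF assms(2-4) X_gauss Y_gauss indep Sig', folded N_def V_def]
  have V_measurable [measurable]: "V j \<in> borel_measurable M" for j by (rule V_facts)
  have V_mean: "expectation (V j) = G1 N" for j by (rule V_facts)
  define s where "s = 1 / (2 * real N)"
  define \<kappa> where "\<kappa> = beta_prime_const ((real N - 2) / 2) / beta_prime_const ((real N - 1) / 2)"
  have N: "real N \<ge> 4" using assms(2) by (simp add: N_def)
  have s: "s > 0" using N by (simp add: s_def)
  have \<kappa>: "\<kappa> \<ge> 0"
    unfolding \<kappa>_def using N by (intro divide_nonneg_nonneg less_imp_le[OF beta_prime_const_pos]) auto
  have exp_integrable: "integrable M (\<lambda>\<omega>. exp (s * V j \<omega>))" and exp_mean: "expectation (\<lambda>\<omega>. exp (s * V j \<omega>)) = \<kappa>" for j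
  proof -
    have mgf: "(\<integral>\<^sup>+ \<omega>. ennreal (exp (s * V j \<omega>)) \<partial>M) = ennreal \<kappa>"
      unfolding s_def \<kappa>_def by (rule V_facts)
    show "integrable M (\<lambda>\<omega>. exp (s * V j \<omega>))"
      by (rule integrableI_nn_integral_finite[OF _ _ mgf]) auto
    show "expectation (\<lambda>\<omega>. exp (s * V j \<omega>)) = \<kappa>"
      using mgf \<kappa> by (subst integral_eq_nn_integral) auto
  qed
  obtain \<delta> where \<delta>: "\<delta> > 0" "summable (\<lambda>r. alpha_mix M V (Suc r) powr (\<delta> / (2 + \<delta>)))"
    using C2a unfolding V_def by blast
  define q where "q = 2 + \<delta>"
  have q: "q > 2" "1 - 2 / q = \<delta> / (2 + \<delta>)" using \<delta> by (simp_all add: q_def field_simps)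
  define X' where "X' j \<omega> = V j \<omega> - G1 N" for j \<omega>
  \<comment> \<open>The constant of \<open>powr_le_exp\<close> at exponent 2 q, times the cost of
    centering: V >= 0 gives |X'| <= |G1| + V. Then \<open>b * \<kappa>\<close> bounds the moments of
    order 2 q of all coordinates at once.\<close>
  define b where "b = (2 * q / s) powr (2 * q) * exp (s * \<bar>G1 N\<bar>)"
  have X'_powr_le: "\<bar>X' j \<omega>\<bar> powr (2 * q) \<le> b * exp (s * V j \<omega>)" for j \<omega>
  proof -
    have "0 \<le> V j \<omega>" by (rule V_facts)
    then have "\<bar>X' j \<omega>\<bar> \<le> \<bar>G1 N\<bar> + V j \<omega>" by (simp add: X'_def)
    then have "exp (s * \<bar>X' j \<omega>\<bar>) \<le> exp (s * \<bar>G1 N\<bar>) * exp (s * V j \<omega>)"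
      using s by (simp add: exp_add [symmetric] distrib_left [symmetric])
    then have "(2 * q / s) powr (2 * q) * exp (s * \<bar>X' j \<omega>\<bar>) \<le> b * exp (s * V j \<omega>)"
      unfolding b_def mult.assoc by (intro mult_left_mono) auto
    then show ?thesis using powr_le_exp[of "\<bar>X' j \<omega>\<bar>" "2 * q" s] q s by simp
  qed
  have X'_measurable [measurable]: "X' j \<in> borel_measurable M" for j
    unfolding X'_def by measurable
  have X'_powr_integrable: "integrable M (\<lambda>\<omega>. \<bar>X' j \<omega>\<bar> powr (2 * q))" for j
    by (rule Bochner_Integration.integrable_bound[OF integrable_mult_right[OF exp_integrable[of j], of b]])
       (use X'_powr_le in \<open>auto intro!: AE_I2 intro: order_trans[OF _ abs_ge_self]\<close>)
  have X'_powr_mean: "expectation (\<lambda>\<omega>. \<bar>X' j \<omega>\<bar> powr (2 * q)) \<le> b * \<kappa>" for j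
  proof -
    have "expectation (\<lambda>\<omega>. \<bar>X' j \<omega>\<bar> powr (2 * q)) \<le> expectation (\<lambda>\<omega>. b * exp (s * V j \<omega>))"
      by (rule integral_mono[OF X'_powr_integrable _ X'_powr_le]) (simp add: exp_integrable)
    then show ?thesis by (simp add: exp_mean)
  qed
  have X'_powr_1: "integrable M (\<lambda>\<omega>. \<bar>X' j \<omega>\<bar> powr q)" for j
    by (rule Bochner_Integration.integrable_bound[where f = "\<lambda>\<omega>. 1 + \<bar>X' j \<omega>\<bar> powr (2 * q)"])
       (use X'_powr_integrable[of j] q powr_le_one_plus_powr[of "\<bar>X' j \<omega>\<bar>" q "2 * q" for \<omega>] in \<open>auto intro!: AE_I2\<close>)
  have X'_integrable: "integrable M (X' j)" for j
    by (rule integrable_of_abs_powr[OF _ X'_powr_integrable _ X'_powr_mean]) (use q in auto)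
  have V_integrable: "integrable M (V j)" for j
    using Bochner_Integration.integrable_add[OF X'_integrable[of j] integrable_const[of "G1 N"]] by (simp add: X'_def)
  have X'_sq_integrable: "integrable M (\<lambda>\<omega>. X' j \<omega> * X' j \<omega>)" for j
    by (rule integrable_mult_of_abs_powr[OF _ _ X'_powr_1 X'_powr_1]) (use q in auto)
  have X'_mean: "expectation (X' j) = 0" for j
    using V_integrable[of j] by (simp add: X'_def [abs_def] V_mean prob_space)
  have cov_eq: "cov M (V i) (V (i + l)) = expectation (\<lambda>\<omega>. X' i \<omega> * X' (i + l) \<omega>)" for i l
    by (simp add: cov_def V_mean X'_def)
  have X'_cov_const: "expectation (\<lambda>\<omega>. X' i \<omega> * X' (i + l) \<omega>) = expectation (\<lambda>\<omega>. X' 1 \<omega> * X' (1 + l) \<omega>)" if "1 \<le> i" for i l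
    unfolding X'_def using stat that by (intro stationary_product_moment) (auto simp: V_def [symmetric])
  have X'_cov: "expectation (\<lambda>\<omega>. X' i \<omega> * X' (i + l) \<omega>) = gamma l" if "1 \<le> i" for i l
  proof -
    define c where "c = expectation (\<lambda>\<omega>. X' 1 \<omega> * X' (1 + l) \<omega>)"
    \<comment> \<open>Stated for p > l: otherwise the natural subtraction leaves an empty sum and
      the divisor 0.\<close>
    have "(\<Sum>j=1..p-l. cov M (V j) (V (j + l))) / real (p - l) = c" if "p > l" for p
    proof -
      have "(\<Sum>j=1..p-l. cov M (V j) (V (j + l))) = (\<Sum>j=1..p-l. c)"
        unfolding cov_eq c_def by (intro sum.cong refl X'_cov_const) simp
      then show ?thesis using that by simp
    qed
    then have "eventually (\<lambda>p. (\<Sum>j=1..p-l. cov M (V j) (V (j + l))) / real (p - l) = c) sequentially"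
      by (rule eventually_mono[OF eventually_gt_at_top[of l]])
    then have "(\<lambda>p. (\<Sum>j=1..p-l. cov M (V j) (V (j + l))) / real (p - l)) \<longlonglongrightarrow> c"
      by (rule tendsto_eventually)
    then have "gamma l = c" using C2b LIMSEQ_unique unfolding V_def by blast
    then show ?thesis using X'_cov_const[OF that] by (simp add: c_def)
  qed
  have gamma_0: "gamma 0 = G2 N - (G1 N)\<^sup>2"
  proof -
    have V_sq: "integrable M (\<lambda>\<omega>. (V 1 \<omega>)\<^sup>2)"
    proof -
      have "integrable M (\<lambda>\<omega>. X' 1 \<omega> * X' 1 \<omega> + 2 * G1 N * V 1 \<omega> - (G1 N)\<^sup>2)"
        using X'_sq_integrable V_integrable by simp
      then show ?thesis by (simp add: X'_def power2_eq_square algebra_simps)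
    qed
    have "gamma 0 = expectation (\<lambda>\<omega>. (V 1 \<omega>)\<^sup>2 - 2 * G1 N * V 1 \<omega> + (G1 N)\<^sup>2)"
      using X'_cov[of 1 0] by (simp add: X'_def power2_eq_square algebra_simps)
    also have "\<dots> = expectation (\<lambda>\<omega>. (V 1 \<omega>)\<^sup>2) - 2 * G1 N * G1 N + (G1 N)\<^sup>2"
      using V_sq V_integrable[of 1] by (simp add: V_mean prob_space)
    also have "expectation (\<lambda>\<omega>. (V 1 \<omega>)\<^sup>2) = G2 N" by (rule V_facts)
    finally show ?thesis by (simp add: power2_eq_square)
  qed
  interpret mixing_sequence M "\<lambda>k. generated_algebra M V {1..k}" "\<lambda>k. generated_algebra M V {k..}"
    X' "alpha_mix M V" q "b * \<kappa>" gamma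
  proof
    fix k j r l i :: nat and A C
    show "subalgebra M (generated_algebra M V {1..k})" "subalgebra M (generated_algebra M V {k..})"
      by (rule subalgebra_generated_algebra; rule V_measurable)+
    show "X' j \<in> borel_measurable (generated_algebra M V {1..k})" if "1 \<le> j" "j \<le> k"
      unfolding X'_def using measurable_generated_algebra[of j "{1..k}" V M] that by simp
    show "X' j \<in> borel_measurable (generated_algebra M V {k..})" if "1 \<le> k" "k \<le> j"
      unfolding X'_def using measurable_generated_algebra[of j "{k..}" V M] that by simp
    show "\<bar>prob (A \<inter> C) - prob A * prob C\<bar> \<le> alpha_mix M V r"
      if "1 \<le> k" "A \<in> sets (generated_algebra M V {1..k})" "C \<in> sets (generated_algebra M V {k + r..})"
      using that alpha_mix_upper by (simp add: sets_generated_algebra)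
    show "0 \<le> alpha_mix M V r" "alpha_mix M V r \<le> 1" by (rule alpha_mix_bounds)+
    show "summable (\<lambda>r. alpha_mix M V (Suc r) powr (1 - 2 / q))" unfolding q(2) by (rule \<delta>(2))
  qed (rule q(1) X'_mean X'_powr_integrable X'_powr_mean X'_cov; assumption?)+
  have \<sigma>2: "\<sigma>2 = G2 N - (G1 N)\<^sup>2 + 2 * (\<Sum>k. gamma (Suc k))"
    by (simp add: \<sigma>2_def gamma_0)
  have "S p \<omega> = T2stat n1 n2 X Y p \<omega> - real p * G1 N" for p \<omega>
    by (simp add: S_def T2stat_def X'_def V_def sum_subtractf)
  with central_limit tau_pos show ?thesis
    unfolding N_def [symmetric] \<sigma>2 [symmetric] by simp
qed

end
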